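(* Consider one-hidden-layer networks $f(\cdot,\theta):\mathbb{R}^{h_0}\to\mathbb{R}$ of hidden width $h$, with the parametrization and random initialization given in the context. Fix an input $x\in\mathbb{R}^{h_0}$ and training data $(\mathcal{X},\mathcal{Y})$ with $N$ points, and assume that $\bar\Theta(\mathcal{X},\mathcal{X})$ is invertible. Assume that the random kernel $\Theta_{\theta_0}$ (evaluated on $\mathcal{X}\cup\{x\}$) is independent of the random initial function values $f(\mathcal{X},\theta_0)$, in the sense made precise in the context. Then, as $h\to\infty$, the following convergence in distribution over the random initialization $\theta_0$ holds: $$\sqrt{h}\,[\mathcal{Q}_{\theta_0}(x,\mathcal{X})-\bar{\mathcal{Q}}(x,\mathcal{X})](\mathcal{Y}-f(\mathcal{X},\theta_0))\ \overset{dist.}{\longrightarrow}\ Z(x),$$ where $Z(x)$ is a linear combination of two Chi-square distributions, such that $$\mathbb{V}(Z(x))=\lim_{h\to\infty}\big(h\,\mathbb{V}^c(x)+h\,\mathbb{V}^i(x)\big),$$ where $$\begin{aligned}\mathbb{V}^{c}(x)=\;&\mathbb{V}[\Theta_{\theta_0}(x,\mathcal{X})\bar{\Theta}(\mathcal{X},\mathcal{X})^{-1}\mathcal{Y}]+\mathbb{V}[\bar{\mathcal{Q}}(x,\mathcal{X})\Theta_{\theta_0}(\mathcal{X},\mathcal{X})\bar{\Theta}(\mathcal{X},\mathcal{X})^{-1}\mathcal{Y}]\\&-2\,\mathrm{Cov}[\bar{\mathcal{Q}}(x,\mathcal{X})\Theta_{\theta_0}(\mathcal{X},\mathcal{X})\bar{\Theta}(\mathcal{X},\mathcal{X})^{-1}\mathcal{Y},\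 \Theta_{\theta_0}(x,\mathcal{X})\bar{\Theta}(\mathcal{X},\mathcal{X})^{-1}\mathcal{Y}],\\ \mathbb{V}^{i}(x)=\;&\mathbb{V}[\Theta_{\theta_0}(x,\mathcal{X})\bar{\Theta}(\mathcal{X},\mathcal{X})^{-1}f(\mathcal{X},\theta_0)]+\mathbb{V}[\bar{\mathcal{Q}}(x,\mathcal{X})\Theta_{\theta_0}(\mathcal{X},\mathcal{X})\bar{\Theta}(\mathcal{X},\mathcal{X})^{-1}f(\mathcal{X},\theta_0)]\\&-2\,\mathrm{Cov}[\bar{\mathcal{Q}}(x,\mathcal{X})\Theta_{\theta_0}(\mathcal{X},\mathcal{X})\bar{\Theta}(\mathcal{X},\mathcal{X})^{-1}f(\mathcal{X},\theta_0),\ \Theta_{\theta_0}(x,\mathcal{X})\bar{\Theta}(\mathcal{X},\mathcal{X})^{-1}f(\mathcal{X},\theta_0)].\end{aligned}$$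
   Context: Network. A one-hidden-layer network of width $h$ with input dimension $h_0$ and output dimension $1$ is $f(x,\theta)=\frac{\sigma_w}{\sqrt{h}}W^2\phi\big(\frac{\sigma_w}{\sqrt{h_0}}W^1x+b^1\big)+b^2$, where $W^1\in\mathbb{R}^{h\times h_0}$, $b^1\in\mathbb{R}^h$, $W^2\in\mathbb{R}^{1\times h}$, $b^2\in\mathbb{R}$, $\theta=(W^1,b^1,W^2,b^2)$, $\sigma_w=\sqrt2$, and $\phi:\mathbb{R}\to\mathbb{R}$ is a non-linearity applied entrywise (such as the softplus $\log(1+e^x)$ or the ReLU $\max(0,x)$), for which the NTK entries defined below have finite second moments, so that all expectations and variances in the statement are defined. At random initialization $\theta_0$ all entries of $W^1,b^1,W^2,b^2$ are i.i.d. $\mathcal{N}(0,1)$. The dependence of $\theta_0$ on $h$ is suppressed. Data. $\mathcal{X}=(x_i)$ is a finite family of $N$ inputs in $\mathbb{R}^{h_0}$, $\mathcal{Y}\in\mathbb{R}^N$ the vector of targets, and $f(\mathcal{X},\theta)\in\mathbb{R}^N$ the vector of values $f(x_i,\theta)$. $N$, $h_0$, $\mathcal{X}$, $\mathcal{Y}$ and $x$ do not depend on $h$. Neural tangent kernel (NTK). $\Theta_\theta(x,x')=\langle\nabla_\theta f(x,\theta),\nabla_\theta f(x',\theta)\rangle$; $\Theta_\theta(\mathcal{X},\mathcal{X})\in\mathbb{R}^{N\times N}$ is the matrix with entries $\Theta_\theta(x_i,x_j)$, and $\Theta_\theta(x,\mathcal{X})\in\mathbb{R}^{1\times N}$ is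 the row vector with entries $\Theta_\theta(x,x_j)$. $\bar\Theta=\mathbb{E}[\Theta_{\theta_0}]$ denotes the entrywise expectation over initialization. Further, $$\mathcal{Q}_{\theta_0}(x,\mathcal{X})=\Theta_{\theta_0}(x,\mathcal{X})\Theta_{\theta_0}(\mathcal{X},\mathcal{X})^{-1},\qquad \bar{\mathcal{Q}}(x,\mathcal{X})=\bar\Theta(x,\mathcal{X})\bar\Theta(\mathcal{X},\mathcal{X})^{-1}.$$ $\mathcal{Q}_{\theta_0}$ is defined on the event that $\Theta_{\theta_0}(\mathcal{X},\mathcal{X})$ is invertible (and may be set arbitrarily elsewhere). Independence. The kernel $\Theta_{\theta_0}$ and the initial function values $f(\mathcal{X},\theta_0)$ are taken independent: they are computed from two independent draws $\theta_0^k,\theta_0^f$ of the initialization, so that everywhere in the statement $\Theta_{\theta_0}$ (hence $\mathcal{Q}_{\theta_0}$) means $\Theta_{\theta_0^k}$ and $f(\mathcal{X},\theta_0)$ means $f(\mathcal{X},\theta_0^f)$. $\mathbb{V}$ and $\mathrm{Cov}$ denote variance and covariance over the random initialization. Here a "Chi-square distribution" is understood in the generalized sense of the law of the squared Euclidean norm of a (not necessarily centered, not necessarily isotropic, possibly degenerate) Gaussian vector; "$Z$ is a linear combination of two Chi-square distributions" means that $Z$ has the law of a linear combination of two random variables of this kind defined on a common probability space. *)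

theory Defs
  imports "HOL-Probability.Probability"
begin

text \<open>The width varies in the theorem, so parameter vectors are real-valued functions on the
  type of parameter names below; a network of width \<open>h\<close> only uses the names in \<open>params h\<close>.
  The input dimension is \<open>CARD('d)\<close>.\<close>

datatype 'd param = W1 nat 'd | B1 nat | W2 nat | B2

definition params :: "nat \<Rightarrow> 'd param set" where
  "params h = {W1 i j | i j. i < h} \<union> B1 ` {..<h} \<union> W2 ` {..<h} \<union> {B2}"

definition sigma_w :: real where
  "sigma_w = sqrt 2"

definition net :: "(real \<Rightarrow> real) \<Rightarrow> nat \<Rightarrow> real ^ 'd \<Rightarrow> ('d param \<Rightarrow> real) \<Rightarrow> real" where
  "net \<phi> h x \<theta> =
     sigma_w / sqrt (real h) *
       (\<Sum>i<h. \<theta> (W2 i) * \<phi> (sigma_w / sqrt (real CARD('d)) * (\<Sum>j\<in>UNIV. \<theta> (W1 i j) * x $ j) + \<theta> (B1 i)))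
     + \<theta> B2"

definition net_vec ::
  "(real \<Rightarrow> real) \<Rightarrow> nat \<Rightarrow> ('n \<Rightarrow> real ^ 'd) \<Rightarrow> ('d param \<Rightarrow> real) \<Rightarrow> real ^ 'n" where
  "net_vec \<phi> h X \<theta> = (\<chi> i. net \<phi> h (X i) \<theta>)"

definition init :: "nat \<Rightarrow> ('d param \<Rightarrow> real) measure" where
  "init h = Pi\<^sub>M (params h) (\<lambda>_. density lborel std_normal_density)"

text \<open>Two independent draws: the first component is used in the kernel, the second one in the
  initial function values.\<close>

definition init2 :: "nat \<Rightarrow> (('d param \<Rightarrow> real) \<times> ('d param \<Rightarrow> real)) measure" where
  "init2 h = init h \<Otimes>\<^sub>M init h"

definition partial_deriv :: "'p \<Rightarrow> (('p \<Rightarrow> real) \<Rightarrow> real) \<Rightarrow> ('p \<Rightarrow> real) \<Rightarrow> real" where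
  "partial_deriv p F \<theta> = deriv (\<lambda>t. F (\<theta>(p := t))) (\<theta> p)"

text \<open>If \<open>\<phi>\<close> is differentiable almost everywhere, then so is the network as a function
  of its parameters; at the
  remaining parameters, which form a null set, \<^const>\<open>deriv\<close> may have an unspecified value.\<close>

definition ntk ::
  "(real \<Rightarrow> real) \<Rightarrow> nat \<Rightarrow> real ^ 'd \<Rightarrow> real ^ 'd \<Rightarrow> ('d param \<Rightarrow> real) \<Rightarrow> real" where
  "ntk \<phi> h x x' \<theta> =
     (\<Sum>p\<in>params h. partial_deriv p (net \<phi> h x) \<theta> * partial_deriv p (net \<phi> h x') \<theta>)"

definition mean_ntk :: "(real \<Rightarrow> real) \<Rightarrow> nat \<Rightarrow> real ^ 'd \<Rightarrow> real ^ 'd \<Rightarrow> real" where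
  "mean_ntk \<phi> h x x' = (\<integral>\<theta>. ntk \<phi> h x x' \<theta> \<partial>init h)"

definition ntk_mat ::
  "(real \<Rightarrow> real) \<Rightarrow> nat \<Rightarrow> ('n \<Rightarrow> real ^ 'd) \<Rightarrow> ('d param \<Rightarrow> real) \<Rightarrow> real ^ 'n ^ 'n" where
  "ntk_mat \<phi> h X \<theta> = (\<chi> i j. ntk \<phi> h (X i) (X j) \<theta>)"

definition ntk_row ::
  "(real \<Rightarrow> real) \<Rightarrow> nat \<Rightarrow> real ^ 'd \<Rightarrow> ('n \<Rightarrow> real ^ 'd) \<Rightarrow> ('d param \<Rightarrow> real) \<Rightarrow> real ^ 'n" where
  "ntk_row \<phi> h x X \<theta> = (\<chi> j. ntk \<phi> h x (X j) \<theta>)"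

definition mean_ntk_mat :: "(real \<Rightarrow> real) \<Rightarrow> nat \<Rightarrow> ('n \<Rightarrow> real ^ 'd) \<Rightarrow> real ^ 'n ^ 'n" where
  "mean_ntk_mat \<phi> h X = (\<chi> i j. mean_ntk \<phi> h (X i) (X j))"

definition mean_ntk_row :: "(real \<Rightarrow> real) \<Rightarrow> nat \<Rightarrow> real ^ 'd \<Rightarrow> ('n \<Rightarrow> real ^ 'd) \<Rightarrow> real ^ 'n" where
  "mean_ntk_row \<phi> h x X = (\<chi> j. mean_ntk \<phi> h x (X j))"

text \<open>Where the random kernel matrix is singular, \<^const>\<open>matrix_inv\<close> is an unspecified
  matrix.\<close>

definition Q :: "(real \<Rightarrow> real) \<Rightarrow> nat \<Rightarrow> real ^ 'd \<Rightarrow> ('n \<Rightarrow> real ^ 'd) \<Rightarrow> ('d param \<Rightarrow> real) \<Rightarrow> real ^ 'n" where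
  "Q \<phi> h x X \<theta> = ntk_row \<phi> h x X \<theta> v* matrix_inv (ntk_mat \<phi> h X \<theta>)"

definition mean_Q :: "(real \<Rightarrow> real) \<Rightarrow> nat \<Rightarrow> real ^ 'd \<Rightarrow> ('n \<Rightarrow> real ^ 'd) \<Rightarrow> real ^ 'n" where
  "mean_Q \<phi> h x X = mean_ntk_row \<phi> h x X v* matrix_inv (mean_ntk_mat \<phi> h X)"

definition has_second_moment :: "'a measure \<Rightarrow> ('a \<Rightarrow> real) \<Rightarrow> bool" where
  "has_second_moment M U \<longleftrightarrow> U \<in> borel_measurable M \<and> integrable M (\<lambda>\<omega>. (U \<omega>)\<^sup>2)"

definition covariance :: "'a measure \<Rightarrow> ('a \<Rightarrow> real) \<Rightarrow> ('a \<Rightarrow> real) \<Rightarrow> real" where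
  "covariance M U V =
     (\<integral>\<omega>. (U \<omega> - prob_space.expectation M U) * (V \<omega> - prob_space.expectation M V) \<partial>M)"

definition V_c ::
  "(real \<Rightarrow> real) \<Rightarrow> nat \<Rightarrow> real ^ 'd \<Rightarrow> ('n \<Rightarrow> real ^ 'd) \<Rightarrow> real ^ 'n \<Rightarrow> real" where
  "V_c \<phi> h x X Y =
     (let A = (\<lambda>\<theta>. ntk_row \<phi> h x X \<theta> \<bullet> (matrix_inv (mean_ntk_mat \<phi> h X) *v Y));
          B = (\<lambda>\<theta>. mean_Q \<phi> h x X \<bullet>
                (ntk_mat \<phi> h X \<theta> *v (matrix_inv (mean_ntk_mat \<phi> h X) *v Y)))
      in prob_space.variance (init h) A + prob_space.variance (init h) B
           - 2 * covariance (init h) B A)"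

definition V_i :: "(real \<Rightarrow> real) \<Rightarrow> nat \<Rightarrow> real ^ 'd \<Rightarrow> ('n::finite \<Rightarrow> real ^ 'd) \<Rightarrow> real" where
  "V_i \<phi> h x X =
     (let A = (\<lambda>(\<theta>k, \<theta>f). ntk_row \<phi> h x X \<theta>k \<bullet>
                (matrix_inv (mean_ntk_mat \<phi> h X) *v net_vec \<phi> h X \<theta>f));
          B = (\<lambda>(\<theta>k, \<theta>f). mean_Q \<phi> h x X \<bullet>
                (ntk_mat \<phi> h X \<theta>k *v (matrix_inv (mean_ntk_mat \<phi> h X) *v net_vec \<phi> h X \<theta>f)))
      in prob_space.variance (init2 h) A + prob_space.variance (init2 h) B
           - 2 * covariance (init2 h) B A)"

definition normal_law :: "real measure \<Rightarrow> bool" where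
  "normal_law \<mu> \<longleftrightarrow>
     (\<exists>m. \<mu> = return borel m) \<or> (\<exists>m s. s > 0 \<and> \<mu> = density lborel (normal_density m s))"

text \<open>Laws of possibly degenerate Gaussian vectors in \<open>\<real>\<^sup>k\<close>, with vectors represented as
  extensional functions on \<open>{..<k}\<close>: all linear forms are (possibly degenerate) normal.\<close>

definition gaussian_vector_law :: "nat \<Rightarrow> (nat \<Rightarrow> real) measure \<Rightarrow> bool" where
  "gaussian_vector_law k \<nu> \<longleftrightarrow>
     prob_space \<nu> \<and> sets \<nu> = sets (Pi\<^sub>M {..<k} (\<lambda>_. borel :: real measure)) \<and>
     (\<forall>u. normal_law (distr \<nu> borel (\<lambda>v. \<Sum>i<k. u i * v i)))"

definition chi_square_law :: "real measure \<Rightarrow> bool" where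
  "chi_square_law \<mu> \<longleftrightarrow>
     (\<exists>k \<nu>. gaussian_vector_law k \<nu> \<and> \<mu> = distr \<nu> borel (\<lambda>v. \<Sum>i<k. (v i)\<^sup>2))"

text \<open>The measure \<open>\<rho>\<close> is the joint law of two arbitrarily dependent random variables on a common
  probability space.\<close>

definition lin_comb_two_chi_squares :: "real measure \<Rightarrow> bool" where
  "lin_comb_two_chi_squares \<mu> \<longleftrightarrow>
     (\<exists>(\<rho> :: (real \<times> real) measure) a b.
        prob_space \<rho> \<and> sets \<rho> = sets borel \<and>
        chi_square_law (distr \<rho> borel fst) \<and> chi_square_law (distr \<rho> borel snd) \<and>
        \<mu> = distr \<rho> borel (\<lambda>(c, d). a * c + b * d))"

end

theory Submission
  imports Defs
begin

text \<open>Up to a null set, the kernel is \<open>1\<close> plus an average of i.i.d. contributions of the neurons.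
  Hence \<open>U = \<surd>h (\<Theta>(x, X) - q \<Theta>(X, X)) K\<^sup>-\<^sup>1\<close>, where \<open>K\<close> is the mean kernel matrix and
  \<open>q\<close> is \<^const>\<open>mean_Q\<close>, is a normalized sum of centered i.i.d. vectors whose covariance does not
  depend on \<open>h\<close>; so is the vector \<open>f\<close> of initial function values, apart from the output bias. The
  statistic is \<open>U K \<Theta>(X, X)\<^sup>-\<^sup>1 \<bullet> (Y - f)\<close>, and \<open>K \<Theta>(X, X)\<^sup>-\<^sup>1\<close> tends to the identity in
  probability, which leaves \<open>U \<bullet> (Y - f)\<close>. By independence, its characteristic
  function at \<open>t\<close> is the mean over \<open>f\<close> of that of \<open>U\<close> at the random point \<open>t (Y - f)\<close>. A central
  limit theorem that is uniform on balls replaces \<open>U\<close> by a Gaussian vector \<open>G\<close>, and integrating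
  in the other order replaces \<open>f\<close> by a Gaussian vector \<open>F\<close>; so no multivariate
  weak convergence is needed. The limit \<open>G \<bullet> (Y - F)\<close> polarizes into two squared
  norms of Gaussian vectors, and as the covariances are exact at every width,
  \<open>h V\<^sub>c + h V\<^sub>i\<close> does not depend on \<open>h\<close> and equals its variance.\<close>

section \<open>Moments and characteristic functions\<close>

text \<open>The ratio \<open>Q\<close> is not linear in the kernel, yet its inverse is never
  expanded: \<open>q\<close> times the random matrix times its inverse is \<open>q\<close> again, so
  \<open>Q - mean_Q\<close> is exactly (row - q matrix) times the inverse of that matrix wherever
  this exists. The first factor is linear in the kernel and centered; of the second only convergence
  in probability is needed. The obstacle is that the statistic itself need not have moments, since
  the random matrix may come close to being singular. Hence convergence goes through characteristic
  functions, which are bounded, and every variance is computed for U \<bullet> (Y - f), never for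
  the statistic. Uniformity on balls is forced by the random point t (Y - f), whose law moves with
  the width; a second moment bound on f controls the part outside the ball. For f, where the roles
  are exchanged, pointwise convergence is enough. A further obstacle is that \<open>deriv\<close> is
  unspecified where \<phi> is not differentiable: identities for the kernel hold almost surely only,
  and its measurability is taken from the moment hypotheses.\<close>

text \<open>Only second moments are at hand, so the cubic Taylor remainder is truncated by a
  quadratic one. On the ball, \<open>R * norm (v \<omega>)\<close> dominates
  \<open>\<bar>y \<bullet> v \<omega>\<bar>\<close> for all \<open>y\<close> at once, which turns
  the remainder into one integral tending to 0 by dominated convergence. Comparing
  \<open>h\<close>-th powers in the unit disc costs a factor \<open>h\<close>, absorbed by the
  \<open>1 / h\<close> in front of the remainder.\<close>

lemma (in prob_space) cf_clt_uniform:
  fixes v :: "'a \<Rightarrow> 'b::euclidean_space"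
  assumes v[measurable]: "v \<in> borel_measurable M"
    and sq: "integrable M (\<lambda>\<omega>. (norm (v \<omega>))\<^sup>2)"
    and mean: "\<And>y. expectation (\<lambda>\<omega>. y \<bullet> v \<omega>) = 0"
  shows "\<exists>\<epsilon>. \<epsilon> \<longlonglongrightarrow> 0 \<and> (\<forall>h>0. \<forall>y. norm y \<le> R \<longrightarrow>
      norm ((CLINT \<omega>|M. iexp (y \<bullet> v \<omega> / sqrt (real h))) ^ h
        - of_real (exp (- expectation (\<lambda>\<omega>. (y \<bullet> v \<omega>)\<^sup>2) / 2))) \<le> \<epsilon> h)"
proof -
  define m where "m h \<omega> = min (6 * (R\<^sup>2 * (norm (v \<omega>))\<^sup>2)) (1 / sqrt (real h) * (R * norm (v \<omega>)) ^ 3)" for h \<omega>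
  define c where "c = R\<^sup>2 * expectation (\<lambda>\<omega>. (norm (v \<omega>))\<^sup>2)"
  \<comment> \<open>The first term is \<open>h\<close> times the Taylor remainder at
    \<open>t = 1 / sqrt h\<close>; the second bounds \<open>h\<close> times the error
    \<open>z^2 / 2\<close> of replacing \<open>1 - z\<close> by \<open>exp (- z)\<close> at
    \<open>z = q / (2 h)\<close>, where \<open>q \<le> c\<close>.\<close>
  define \<epsilon> where "\<epsilon> h = expectation (m h) / 6 + c\<^sup>2 / 8 * (1 / real h)" for h
  have [measurable]: "m h \<in> borel_measurable M" for h
    unfolding m_def by measurable
  have sq1: "integrable M (\<lambda>\<omega>. 6 * (R\<^sup>2 * (norm (v \<omega>))\<^sup>2))"
    using sq by simp
  show ?thesis
  proof (cases "R < 0")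
    case True
    then show ?thesis
      by (intro exI[of _ "\<lambda>_. 0"]) (auto simp: not_le dest: order_trans[OF norm_ge_zero])
  next
    case False
    then have R: "0 \<le> R" by simp
    have mb: "\<bar>m h \<omega>\<bar> \<le> 6 * (R\<^sup>2 * (norm (v \<omega>))\<^sup>2)" for h \<omega>
      using R unfolding m_def by (auto simp: min_def)
    have mi: "integrable M (m h)" for h
      by (rule Bochner_Integration.integrable_bound[OF sq1]) (use mb in \<open>auto intro!: AE_I2\<close>)
    have mlim: "(\<lambda>h. m h \<omega>) \<longlonglongrightarrow> 0" for \<omega>
    proof -
      have "(\<lambda>h. 1 / sqrt (real h) * (R * norm (v \<omega>)) ^ 3) \<longlonglongrightarrow> 0 * (R * norm (v \<omega>)) ^ 3"
        by (intro tendsto_mult tendsto_const tendsto_divide_0[OF tendsto_const]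
            filterlim_at_top_imp_at_infinity filterlim_compose[OF sqrt_at_top filterlim_real_sequentially])
      then show ?thesis
        unfolding m_def using R
        by (intro tendsto_eq_rhs[OF tendsto_min[OF tendsto_const]]) auto
    qed
    have "(\<lambda>h. expectation (m h)) \<longlonglongrightarrow> expectation (\<lambda>_. 0)"
      by (rule integral_dominated_convergence[where w="\<lambda>\<omega>. 6 * (R\<^sup>2 * (norm (v \<omega>))\<^sup>2)"])
         (use sq1 mlim mb in auto)
    then have "(\<lambda>h. expectation (m h) / 6 + c\<^sup>2 / 8 * (1 / real h)) \<longlonglongrightarrow> 0 / 6 + c\<^sup>2 / 8 * 0"
      by (intro tendsto_intros lim_1_over_n) auto
    then have "\<epsilon> \<longlonglongrightarrow> 0" unfolding \<epsilon>_def by simp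
    moreover have "norm ((CLINT \<omega>|M. iexp (y \<bullet> v \<omega> / sqrt (real h))) ^ h
        - of_real (exp (- expectation (\<lambda>\<omega>. (y \<bullet> v \<omega>)\<^sup>2) / 2))) \<le> \<epsilon> h"
      if h: "h > 0" and y: "norm y \<le> R" for h y
    proof -
      define q where "q = expectation (\<lambda>\<omega>. (y \<bullet> v \<omega>)\<^sup>2)"
      define t where "t = 1 / sqrt (real h)"
      define X where "X \<omega> = y \<bullet> v \<omega>" for \<omega>
      have [measurable]: "X \<in> borel_measurable M" unfolding X_def by measurable
      have absX: "\<bar>X \<omega>\<bar> \<le> R * norm (v \<omega>)" for \<omega>
        unfolding X_def using Cauchy_Schwarz_ineq2[of y "v \<omega>"] mult_right_mono[OF y norm_ge_zero[of "v \<omega>"]] by linarith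
      have X2: "(X \<omega>)\<^sup>2 \<le> R\<^sup>2 * (norm (v \<omega>))\<^sup>2" for \<omega>
        using power_mono[OF absX[of \<omega>], of 2] by (simp add: power_mult_distrib)
      have sqR: "integrable M (\<lambda>\<omega>. R\<^sup>2 * (norm (v \<omega>))\<^sup>2)" using sq by simp
      have iX2: "integrable M (\<lambda>\<omega>. (X \<omega>)\<^sup>2)"
        by (rule Bochner_Integration.integrable_bound[OF sqR]) (use X2 in \<open>auto intro!: AE_I2\<close>)
      have iX: "integrable M X"
        by (rule square_integrable_imp_integrable[OF _ iX2]) simp
      have EX: "expectation X = 0" unfolding X_def by (rule mean)
      have q0: "0 \<le> q" unfolding q_def by (simp add: integral_nonneg_AE)
      have qc: "q \<le> c"
        unfolding q_def c_def X_def[symmetric] integral_mult_right_zero[symmetric]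
        by (rule integral_mono[OF iX2 sqR X2])
      have t2: "t\<^sup>2 = 1 / real h" "0 \<le> t" using h by (auto simp: t_def power_divide)
      have 1: "cmod (char (distr M borel X) t - (1 - t^2 * q / 2)) \<le>
          (t^2 / 6) * expectation (\<lambda>\<omega>. min (6 * (X \<omega>)^2) (\<bar>t\<bar> * \<bar>X \<omega>\<bar>^3))"
        by (rule char_approx3'[OF _ iX iX2 EX]) (auto simp: EX q_def X_def[symmetric])
      have 2: "expectation (\<lambda>\<omega>. min (6 * (X \<omega>)^2) (\<bar>t\<bar> * \<bar>X \<omega>\<bar>^3)) \<le> expectation (m h)"
      proof (rule integral_mono)
        have "integrable M (\<lambda>\<omega>. 6 * (X \<omega>)\<^sup>2)" using iX2 by simp
        then show "integrable M (\<lambda>\<omega>. min (6 * (X \<omega>)^2) (\<bar>t\<bar> * \<bar>X \<omega>\<bar>^3))"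
          by (rule Bochner_Integration.integrable_bound) (auto intro!: AE_I2)
        show "integrable M (m h)" by (rule mi)
        fix \<omega>
        have "\<bar>t\<bar> * \<bar>X \<omega>\<bar>^3 \<le> t * (R * norm (v \<omega>))^3"
          using t2 power_mono[OF absX[of \<omega>], of 3] by (auto intro!: mult_left_mono)
        then show "min (6 * (X \<omega>)^2) (\<bar>t\<bar> * \<bar>X \<omega>\<bar>^3) \<le> m h \<omega>"
          unfolding m_def t_def[symmetric] using X2[of \<omega>] by (intro min.mono) auto
      qed
      have ch: "char (distr M borel X) t = (CLINT \<omega>|M. iexp (y \<bullet> v \<omega> / sqrt (real h)))"
        unfolding char_def by (subst integral_distr) (auto simp: X_def t_def)
      have dX: "real_distribution (distr M borel X)"
        by (rule real_distribution_distr) measurable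
      \<comment> \<open>The \<open>h\<close>-th root of the Gaussian limit, so that two
        \<open>h\<close>-th powers are compared.\<close>
      define w where "w = exp (- (q / (2 * real h)))"
      have w: "0 \<le> w" "w \<le> 1" using q0 h by (auto simp: w_def)
      have expb: "\<bar>1 - z - exp (- z)\<bar> \<le> z\<^sup>2 / 2" if z: "0 \<le> z" for z :: real
      proof -
        have 1: "1 - z \<le> exp (- z)" using exp_ge_add_one_self[of "- z"] by simp
        have "exp (- z) = inverse (exp z)" by (simp add: exp_minus)
        also have "\<dots> \<le> inverse (1 + z + z\<^sup>2 / 2)"
          using exp_lower_Taylor_quadratic[OF z] z
          by (intro le_imp_inverse_le) (auto intro!: add_pos_nonneg)
        also have "\<dots> \<le> 1 - z + z\<^sup>2 / 2"
        proof -
          \<comment> \<open>With \<open>a = z^2 / 2\<close> the product is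
            \<open>(1 + a)^2 - z^2\<close>, and the quadratic terms cancel.\<close>
          have "(1 - z + z\<^sup>2 / 2) * (1 + z + z\<^sup>2 / 2) = 1 + z ^ 4 / 4"
            by (simp add: field_simps power2_eq_square eval_nat_numeral)
          then have "1 \<le> (1 - z + z\<^sup>2 / 2) * (1 + z + z\<^sup>2 / 2)"
            by simp
          moreover have "0 < 1 + z + z\<^sup>2 / 2" using z by (auto intro!: add_pos_nonneg)
          ultimately show ?thesis by (simp add: inverse_eq_divide pos_divide_le_eq)
        qed
        finally show ?thesis using 1 by linarith
      qed
      have wh: "w ^ h = exp (- q / 2)"
        using h by (simp add: w_def exp_of_nat_mult[symmetric])
      have "norm ((char (distr M borel X) t) ^ h - (of_real w) ^ h) \<le> real h * norm (char (distr M borel X) t - of_real w)"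
        using real_distribution.cmod_char_le_1[OF dX, of t] w by (intro norm_power_diff) auto
      also have "\<dots> \<le> real h * (norm (char (distr M borel X) t - (1 - t^2 * q / 2)) + norm (complex_of_real (1 - t\<^sup>2 * q / 2) - of_real w))"
      proof -
        have eq: "char (distr M borel X) t - of_real w = (char (distr M borel X) t - (1 - t^2 * q / 2)) + (complex_of_real (1 - t\<^sup>2 * q / 2) - of_real w)"
          by simp
        show ?thesis by (subst eq, intro mult_left_mono norm_triangle_ineq) simp
      qed
      also have "\<dots> \<le> real h * ((t^2 / 6) * expectation (m h) + (q / (2 * real h))\<^sup>2 / 2)"
      proof (intro mult_left_mono add_mono)
        show "cmod (char (distr M borel X) t - (1 - t^2 * q / 2)) \<le> (t^2 / 6) * expectation (m h)"
          by (rule order_trans[OF 1]) (intro mult_left_mono 2, simp)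
        have "norm (complex_of_real (1 - t\<^sup>2 * q / 2) - of_real w) = \<bar>1 - q / (2 * real h) - w\<bar>"
          by (simp add: t2 of_real_diff[symmetric] del: of_real_diff of_real_mult of_real_divide)
        also have "\<dots> \<le> (q / (2 * real h))\<^sup>2 / 2"
          unfolding w_def by (rule expb) (use q0 h in auto)
        finally show "norm (complex_of_real (1 - t\<^sup>2 * q / 2) - of_real w) \<le> (q / (2 * real h))\<^sup>2 / 2" .
      qed simp
      also have "\<dots> = expectation (m h) / 6 + q\<^sup>2 / 8 * (1 / real h)"
        using h unfolding t2(1) by (simp add: field_simps power2_eq_square)
      also have "\<dots> \<le> \<epsilon> h"
        unfolding \<epsilon>_def using power_mono[OF qc q0, of 2] by (auto intro!: divide_right_mono)
      finally show ?thesis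
        unfolding ch of_real_power[symmetric] wh q_def .
    qed
    ultimately show ?thesis by blast
  qed
qed

section \<open>Second moments of sums and of inner products\<close>

lemma integrable_mult_of_squares:
  fixes f g :: "'a \<Rightarrow> real"
  assumes [measurable]: "f \<in> borel_measurable M" "g \<in> borel_measurable M"
    and "integrable M (\<lambda>\<omega>. (f \<omega>)\<^sup>2)" "integrable M (\<lambda>\<omega>. (g \<omega>)\<^sup>2)"
  shows "integrable M (\<lambda>\<omega>. f \<omega> * g \<omega>)"
proof -
  have "integrable M (\<lambda>\<omega>. (f \<omega>)\<^sup>2 + (g \<omega>)\<^sup>2)" using assms by simp
  then show ?thesis
  proof (rule Bochner_Integration.integrable_bound)
    show "AE \<omega> in M. norm (f \<omega> * g \<omega>) \<le> norm ((f \<omega>)\<^sup>2 + (g \<omega>)\<^sup>2)"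
    proof (rule AE_I2)
      fix \<omega>
      have "2 * \<bar>f \<omega> * g \<omega>\<bar> \<le> (f \<omega>)\<^sup>2 + (g \<omega>)\<^sup>2"
        using sum_squares_bound[of "\<bar>f \<omega>\<bar>" "\<bar>g \<omega>\<bar>"] by (simp add: abs_mult)
      then show "norm (f \<omega> * g \<omega>) \<le> norm ((f \<omega>)\<^sup>2 + (g \<omega>)\<^sup>2)" by simp
    qed
  qed simp
qed

lemma square_integrable_sum:
  fixes f :: "'i \<Rightarrow> 'a \<Rightarrow> real"
  assumes "finite I" "\<And>i. i \<in> I \<Longrightarrow> f i \<in> borel_measurable M"
    and "\<And>i. i \<in> I \<Longrightarrow> integrable M (\<lambda>\<omega>. (f i \<omega>)\<^sup>2)"
  shows "integrable M (\<lambda>\<omega>. (\<Sum>i\<in>I. f i \<omega>)\<^sup>2)"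
  unfolding power2_eq_square sum_product
  by (intro Bochner_Integration.integrable_sum integrable_mult_of_squares assms)

text \<open>Independence and centering kill the off-diagonal terms of the double sum. This is what
  makes covariances exact at every width; it also computes the covariance of a Gaussian vector built
  from independent coordinates.\<close>

lemma (in prob_space) indep_vec_sum_second_moment:
  fixes V :: "'i \<Rightarrow> 'a \<Rightarrow> real ^ 'n"
  assumes ind: "indep_vars (\<lambda>_. borel) V I" and I: "finite I"
    and sq: "\<And>i a. i \<in> I \<Longrightarrow> integrable M (\<lambda>\<omega>. (V i \<omega> $ a)\<^sup>2)"
    and mean: "\<And>i a. i \<in> I \<Longrightarrow> expectation (\<lambda>\<omega>. V i \<omega> $ a) = 0"
  shows "expectation (\<lambda>\<omega>. (\<Sum>i\<in>I. V i \<omega>) $ a * (\<Sum>i\<in>I. V i \<omega>) $ b)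
     = (\<Sum>i\<in>I. expectation (\<lambda>\<omega>. V i \<omega> $ a * V i \<omega> $ b))"
proof -
  have V[measurable]: "V i \<in> borel_measurable M" if "i \<in> I" for i
    using ind that by (auto simp: indep_vars_def)
  have nth[measurable]: "(\<lambda>x::real^'n. x $ c) \<in> borel_measurable borel" for c
    by (intro borel_measurable_continuous_onI continuous_intros)
  have Vc: "(\<lambda>\<omega>. V i \<omega> $ c) \<in> borel_measurable M" if "i \<in> I" for i c
    using V[OF that] by measurable
  have int: "integrable M (\<lambda>\<omega>. V i \<omega> $ a * V j \<omega> $ b)" if "i \<in> I" "j \<in> I" for i j
    by (rule integrable_mult_of_squares[OF Vc Vc sq sq]) (rule that)+
  have int1: "integrable M (\<lambda>\<omega>. V i \<omega> $ c)" if "i \<in> I" for i c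
    by (rule square_integrable_imp_integrable[OF Vc sq]) (rule that)+
  have cross: "expectation (\<lambda>\<omega>. V i \<omega> $ a * V j \<omega> $ b) = 0" if ij: "i \<in> I" "j \<in> I" "i \<noteq> j" for i j
  proof -
    have "indep_var (\<Pi>\<^sub>M i\<in>{i}. borel) (\<lambda>\<omega>. restrict (\<lambda>i. V i \<omega>) {i})
        (\<Pi>\<^sub>M j\<in>{j}. borel) (\<lambda>\<omega>. restrict (\<lambda>i. V i \<omega>) {j})"
      by (rule indep_var_restrict[OF ind]) (use ij in auto)
    then have "indep_var borel ((\<lambda>x. x i $ a) \<circ> (\<lambda>\<omega>. restrict (\<lambda>i. V i \<omega>) {i}))
        borel ((\<lambda>x. x j $ b) \<circ> (\<lambda>\<omega>. restrict (\<lambda>i. V i \<omega>) {j}))"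
      by (rule indep_var_compose) measurable
    then have "expectation (\<lambda>\<omega>. V i \<omega> $ a * V j \<omega> $ b) = expectation (\<lambda>\<omega>. V i \<omega> $ a) * expectation (\<lambda>\<omega>. V j \<omega> $ b)"
      using indep_var_lebesgue_integral[of "\<lambda>\<omega>. V i \<omega> $ a" "\<lambda>\<omega>. V j \<omega> $ b"] int1 ij
      by (simp add: comp_def)
    then show ?thesis using mean ij by simp
  qed
  have "expectation (\<lambda>\<omega>. (\<Sum>i\<in>I. V i \<omega>) $ a * (\<Sum>i\<in>I. V i \<omega>) $ b)
     = (\<Sum>i\<in>I. \<Sum>j\<in>I. expectation (\<lambda>\<omega>. V i \<omega> $ a * V j \<omega> $ b))"
    using int by (simp add: sum_component sum_product)
  also have "\<dots> = (\<Sum>i\<in>I. \<Sum>j\<in>I. if j = i then expectation (\<lambda>\<omega>. V i \<omega> $ a * V i \<omega> $ b) else 0)"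
    using cross by (intro sum.cong refl) auto
  also have "\<dots> = (\<Sum>i\<in>I. expectation (\<lambda>\<omega>. V i \<omega> $ a * V i \<omega> $ b))"
    using I by simp
  finally show ?thesis .
qed

lemma (in pair_prob_space)
  fixes f g :: "_ \<Rightarrow> real"
  assumes f: "integrable M1 f" and g: "integrable M2 g"
  shows integrable_fst_mult_snd: "integrable (M1 \<Otimes>\<^sub>M M2) (\<lambda>(x, y). f x * g y)"
    and integral_fst_mult_snd: "(\<integral>(x, y). f x * g y \<partial>(M1 \<Otimes>\<^sub>M M2)) = integral\<^sup>L M1 f * integral\<^sup>L M2 g"
proof -
  have [measurable]: "f \<in> borel_measurable M1" "g \<in> borel_measurable M2" using f g by auto
  show int: "integrable (M1 \<Otimes>\<^sub>M M2) (\<lambda>(x, y). f x * g y)"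
  proof (rule Fubini_integrable)
    have "integrable M1 (\<lambda>x. \<bar>f x\<bar> * (\<integral>y. \<bar>g y\<bar> \<partial>M2))" using f by simp
    then show "integrable M1 (\<lambda>x. \<integral>y. norm ((\<lambda>(x, y). f x * g y) (x, y)) \<partial>M2)"
      by (simp add: abs_mult)
  qed (use g in auto)
  show "(\<integral>(x, y). f x * g y \<partial>(M1 \<Otimes>\<^sub>M M2)) = integral\<^sup>L M1 f * integral\<^sup>L M2 g"
    using integral_fst'[OF int] by simp
qed

text \<open>On a product space the square of the inner product factorizes entry by entry, so its
  mean pairs the two second moment matrices. The same formula serves at finite width and in the
  limit, which is how the variances come to agree. Only \<open>U\<close> has to be centered.\<close>

lemma (in pair_prob_space) inner_second_moment:
  fixes U :: "'a \<Rightarrow> real ^ 'n" and V :: "'b \<Rightarrow> real ^ 'n"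
  assumes [measurable]: "U \<in> borel_measurable M1" "V \<in> borel_measurable M2"
    and U2: "\<And>a. integrable M1 (\<lambda>\<omega>. (U \<omega> $ a)\<^sup>2)" and V2: "\<And>a. integrable M2 (\<lambda>\<omega>. (V \<omega> $ a)\<^sup>2)"
  shows "integrable (M1 \<Otimes>\<^sub>M M2) (\<lambda>(x, y). (U x \<bullet> V y)\<^sup>2)"
    and "(\<And>a. M1.expectation (\<lambda>\<omega>. U \<omega> $ a) = 0) \<Longrightarrow> (\<integral>(x, y). U x \<bullet> V y \<partial>(M1 \<Otimes>\<^sub>M M2)) = 0"
    and "(\<integral>(x, y). (U x \<bullet> V y)\<^sup>2 \<partial>(M1 \<Otimes>\<^sub>M M2)) =
      (\<Sum>a\<in>UNIV. \<Sum>b\<in>UNIV. M1.expectation (\<lambda>x. U x $ a * U x $ b) * M2.expectation (\<lambda>y. V y $ a * V y $ b))"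
proof -
  have nth[measurable]: "(\<lambda>x::real^'n. x $ c) \<in> borel_measurable borel" for c
    by (intro borel_measurable_continuous_onI continuous_intros)
  have iU: "integrable M1 (\<lambda>x. U x $ a * U x $ b)" for a b
    by (rule integrable_mult_of_squares[OF _ _ U2 U2]) measurable
  have iV: "integrable M2 (\<lambda>x. V x $ a * V x $ b)" for a b
    by (rule integrable_mult_of_squares[OF _ _ V2 V2]) measurable
  have iU1: "integrable M1 (\<lambda>x. U x $ a)" for a
    by (rule M1.square_integrable_imp_integrable[OF _ U2]) measurable
  have iV1: "integrable M2 (\<lambda>x. V x $ a)" for a
    by (rule M2.square_integrable_imp_integrable[OF _ V2]) measurable
  have eq: "(U x \<bullet> V y)\<^sup>2 = (\<Sum>a\<in>UNIV. \<Sum>b\<in>UNIV. (U x $ a * U x $ b) * (V y $ a * V y $ b))" for x y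
    unfolding inner_vec_def power2_eq_square sum_product by (auto intro!: sum.cong)
  note ifs = integrable_fst_mult_snd[OF iU iV, unfolded split_beta']
  note ifs1 = integrable_fst_mult_snd[OF iU1 iV1, unfolded split_beta']
  have dsum: "(\<integral>p. (\<Sum>a\<in>UNIV. \<Sum>b\<in>UNIV. g a b p) \<partial>N) = (\<Sum>a\<in>UNIV. \<Sum>b\<in>UNIV. \<integral>p. g a b p \<partial>N)"
    if "\<And>a b. integrable N (g a b)" for g :: "'n \<Rightarrow> 'n \<Rightarrow> 'c \<Rightarrow> real" and N
    using that by simp
  have ssum: "(\<integral>p. (\<Sum>a\<in>UNIV. g a p) \<partial>N) = (\<Sum>a\<in>UNIV. \<integral>p. g a p \<partial>N)"
    if "\<And>a. integrable N (g a)" for g :: "'n \<Rightarrow> 'c \<Rightarrow> real" and N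
    using that by simp
  show "integrable (M1 \<Otimes>\<^sub>M M2) (\<lambda>(x, y). (U x \<bullet> V y)\<^sup>2)"
    unfolding eq split_beta'
    by (rule Bochner_Integration.integrable_sum, rule Bochner_Integration.integrable_sum, rule ifs)
  show "(\<integral>(x, y). (U x \<bullet> V y)\<^sup>2 \<partial>(M1 \<Otimes>\<^sub>M M2)) =
      (\<Sum>a\<in>UNIV. \<Sum>b\<in>UNIV. M1.expectation (\<lambda>x. U x $ a * U x $ b) * M2.expectation (\<lambda>y. V y $ a * V y $ b))"
    unfolding eq integral_fst_mult_snd[OF iU iV, symmetric] split_beta'
    by (rule dsum) (rule ifs)
  have "(\<integral>(x, y). U x \<bullet> V y \<partial>(M1 \<Otimes>\<^sub>M M2)) = (\<Sum>a\<in>UNIV. M1.expectation (\<lambda>x. U x $ a) * M2.expectation (\<lambda>y. V y $ a))"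
    unfolding inner_vec_def integral_fst_mult_snd[OF iU1 iV1, symmetric] split_beta' inner_real_def
    by (rule ssum) (rule ifs1)
  then show "(\<integral>(x, y). U x \<bullet> V y \<partial>(M1 \<Otimes>\<^sub>M M2)) = 0"
    if "\<And>a. M1.expectation (\<lambda>\<omega>. U \<omega> $ a) = 0" using that by simp
qed

section \<open>Limits of characteristic functions\<close>

lemma cmod_iexp_diff_le: "cmod (iexp x - iexp y) \<le> \<bar>x - y\<bar>"
proof -
  have "iexp x - iexp y = iexp y * (iexp (x - y) - 1)"
    by (simp add: algebra_simps exp_add[symmetric])
  then have "cmod (iexp x - iexp y) = cmod (iexp (x - y) - 1)"
    by (simp add: norm_mult)
  also have "\<dots> \<le> \<bar>x - y\<bar>"
    using iexp_approx1[of "x - y" 0] by simp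
  finally show ?thesis .
qed

text \<open>A form of Slutsky's lemma: the error is small relative to a variable \<open>B n\<close>
  of bounded mean, which replaces a tightness argument. Off the bad event the Lipschitz bound for
  \<open>iexp\<close> applies, on it the trivial bound 2.\<close>

lemma cf_diff_tendsto_0:
  fixes P :: "nat \<Rightarrow> 'a measure" and D W B :: "nat \<Rightarrow> 'a \<Rightarrow> real"
  assumes P: "\<And>n. prob_space (P n)"
    and meas: "\<And>n. D n \<in> borel_measurable (P n)" "\<And>n. W n \<in> borel_measurable (P n)"
    and B: "\<And>n. integrable (P n) (B n)" "\<And>n \<omega>. 0 \<le> B n \<omega>" "\<And>n. (\<integral>\<omega>. B n \<omega> \<partial>P n) \<le> C"
    and close: "\<And>\<eta>. \<eta> > 0 \<Longrightarrow>
      (\<lambda>n. measure (P n) {\<omega>\<in>space (P n). \<not> \<bar>D n \<omega> - W n \<omega>\<bar> \<le> \<eta> * B n \<omega>}) \<longlonglongrightarrow> 0"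
  shows "(\<lambda>n. (CLINT \<omega>|P n. iexp (t * D n \<omega>)) - (CLINT \<omega>|P n. iexp (t * W n \<omega>))) \<longlonglongrightarrow> 0"
proof (rule LIMSEQ_I)
  fix e :: real assume e: "0 < e"
  have C: "0 \<le> C"
    using B(3)[of 0] by (rule order_trans[rotated]) (simp add: B(2) integral_nonneg_AE)
  \<comment> \<open>Chosen so that \<open>\<bar>t\<bar> * \<eta> * C \<le> e / 2\<close>; the
    summands 1 keep the denominator positive. The bad event contributes less than
    \<open>2 * (e / 4)\<close>.\<close>
  define \<eta> where "\<eta> = e / (2 * (\<bar>t\<bar> + 1) * (C + 1))"
  have \<eta>: "0 < \<eta>" unfolding \<eta>_def using e C by simp
  define bad where "bad n = {\<omega>\<in>space (P n). \<not> \<bar>D n \<omega> - W n \<omega>\<bar> \<le> \<eta> * B n \<omega>}" for n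
  have "(\<lambda>n. measure (P n) (bad n)) \<longlonglongrightarrow> 0" unfolding bad_def by (rule close[OF \<eta>])
  then have "eventually (\<lambda>n. measure (P n) (bad n) < e / 4) sequentially"
    by (rule order_tendstoD) (use e in simp)
  then obtain N where N: "\<And>n. n \<ge> N \<Longrightarrow> measure (P n) (bad n) < e / 4"
    unfolding eventually_sequentially by blast
  have "norm ((CLINT \<omega>|P n. iexp (t * D n \<omega>)) - (CLINT \<omega>|P n. iexp (t * W n \<omega>)) - 0) < e" if n: "n \<ge> N" for n
  proof -
    interpret prob_space "P n" by (rule P)
    note [measurable] = meas[of n]
    have [measurable]: "B n \<in> borel_measurable (P n)" using B(1) by auto
    have badm[measurable]: "bad n \<in> sets (P n)" unfolding bad_def by measurable
    have i: "integrable (P n) (\<lambda>\<omega>. iexp (t * D n \<omega>))" "integrable (P n) (\<lambda>\<omega>. iexp (t * W n \<omega>))"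
      by (intro integrable_iexp; measurable)+
    have ib: "integrable (P n) (\<lambda>\<omega>. \<bar>t\<bar> * \<eta> * B n \<omega> + 2 * indicat_real (bad n) \<omega>)"
      using B(1)[of n] by (intro Bochner_Integration.integrable_add integrable_mult_right)
        (auto simp: integrable_indicator_iff emeasure_eq_measure)
    have "norm ((CLINT \<omega>|P n. iexp (t * D n \<omega>)) - (CLINT \<omega>|P n. iexp (t * W n \<omega>)))
        = norm (CLINT \<omega>|P n. iexp (t * D n \<omega>) - iexp (t * W n \<omega>))"
      by (simp only: Bochner_Integration.integral_diff[OF i])
    also have "\<dots> \<le> (\<integral>\<omega>. norm (iexp (t * D n \<omega>) - iexp (t * W n \<omega>)) \<partial>P n)"
      by (rule integral_norm_bound)
    also have "\<dots> \<le> (\<integral>\<omega>. \<bar>t\<bar> * \<eta> * B n \<omega> + 2 * indicat_real (bad n) \<omega> \<partial>P n)"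
    proof (rule integral_mono)
      show "integrable (P n) (\<lambda>\<omega>. norm (iexp (t * D n \<omega>) - iexp (t * W n \<omega>)))"
        by (intro integrable_norm Bochner_Integration.integrable_diff i)
      show "norm (iexp (t * D n \<omega>) - iexp (t * W n \<omega>)) \<le> \<bar>t\<bar> * \<eta> * B n \<omega> + 2 * indicat_real (bad n) \<omega>"
        if \<omega>: "\<omega> \<in> space (P n)" for \<omega>
      proof (cases "\<omega> \<in> bad n")
        case True
        have "norm (iexp (t * D n \<omega>) - iexp (t * W n \<omega>)) \<le> norm (iexp (t * D n \<omega>)) + norm (iexp (t * W n \<omega>))"
          by (rule norm_triangle_ineq4)
        also have "\<dots> = 2" by simp
        also have "\<dots> \<le> \<bar>t\<bar> * \<eta> * B n \<omega> + 2"
          using B(2) \<eta> by (intro le_add_same_cancel2[THEN iffD2] mult_nonneg_nonneg) auto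
        finally show ?thesis using True by simp
      next
        case False
        have "norm (iexp (t * D n \<omega>) - iexp (t * W n \<omega>)) \<le> \<bar>t\<bar> * \<bar>D n \<omega> - W n \<omega>\<bar>"
          using cmod_iexp_diff_le[of "t * D n \<omega>" "t * W n \<omega>"]
          by (simp only: abs_mult[symmetric] right_diff_distrib)
        also have "\<dots> \<le> \<bar>t\<bar> * (\<eta> * B n \<omega>)"
          using False \<omega> unfolding bad_def by (intro mult_left_mono) auto
        finally show ?thesis using False by (simp add: mult.assoc)
      qed
    qed (rule ib)
    also have "\<dots> = \<bar>t\<bar> * \<eta> * (\<integral>\<omega>. B n \<omega> \<partial>P n) + 2 * prob (bad n)"
      using B(1)[of n] by (subst Bochner_Integration.integral_add) (auto simp: integrable_indicator_iff emeasure_eq_measure)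
    also have "\<dots> \<le> \<bar>t\<bar> * \<eta> * C + 2 * prob (bad n)"
      using B(3)[of n] \<eta> by (intro add_mono mult_left_mono) auto
    also have "\<bar>t\<bar> * \<eta> * C \<le> e / 2"
    proof -
      have "\<bar>t\<bar> * C \<le> (\<bar>t\<bar> + 1) * (C + 1)" using C by (intro mult_mono) auto
      then have "\<bar>t\<bar> * C / ((\<bar>t\<bar> + 1) * (C + 1)) \<le> 1" using C by (simp add: divide_le_eq)
      then have "e / 2 * (\<bar>t\<bar> * C / ((\<bar>t\<bar> + 1) * (C + 1))) \<le> e / 2 * 1"
        using e by (intro mult_left_mono) auto
      then show ?thesis unfolding \<eta>_def by (simp add: algebra_simps)
    qed
    finally show ?thesis using N[OF n] by simp
  qed
  then show "\<exists>no. \<forall>n\<ge>no. norm ((CLINT \<omega>|P n. iexp (t * D n \<omega>)) - (CLINT \<omega>|P n. iexp (t * W n \<omega>)) - 0) < e"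
    by blast
qed

text \<open>The hypotheses are asymmetric because the two factors are replaced one after the other.
  Replacing \<open>u n\<close> evaluates its characteristic function at the moving point
  \<open>t\<close> times \<open>w n\<close>, which needs uniformity on balls and the bound
  \<open>C\<close> for the tails; afterwards the other factor has the fixed law
  \<open>\<Gamma>\<close>, and dominated convergence needs only pointwise limits.\<close>

lemma cf_inner_product_tendsto:
  fixes K :: "nat \<Rightarrow> 'k measure" and L :: "nat \<Rightarrow> 'l measure"
    and u :: "nat \<Rightarrow> 'k \<Rightarrow> 'b::euclidean_space" and w :: "nat \<Rightarrow> 'l \<Rightarrow> 'b"
    and G :: "'g \<Rightarrow> 'b" and W :: "'w \<Rightarrow> 'b"
  assumes K: "\<And>n. prob_space (K n)" and L: "\<And>n. prob_space (L n)"
    and \<Gamma>: "prob_space \<Gamma>" and \<Delta>: "prob_space \<Delta>"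
    and meas: "\<And>n. u n \<in> borel_measurable (K n)" "\<And>n. w n \<in> borel_measurable (L n)"
      "G \<in> borel_measurable \<Gamma>" "W \<in> borel_measurable \<Delta>"
    and u: "\<And>R. \<exists>\<epsilon>. \<epsilon> \<longlonglongrightarrow> 0 \<and> (\<forall>n y. norm y \<le> R \<longrightarrow>
      norm ((CLINT a|K n. iexp (y \<bullet> u n a)) - (CLINT a|\<Gamma>. iexp (y \<bullet> G a))) \<le> \<epsilon> n)"
    and w: "\<And>y. (\<lambda>n. CLINT b|L n. iexp (y \<bullet> w n b)) \<longlonglongrightarrow> (CLINT b|\<Delta>. iexp (y \<bullet> W b))"
    and w2: "\<And>n. integrable (L n) (\<lambda>b. (norm (w n b))\<^sup>2)" "\<And>n. (\<integral>b. (norm (w n b))\<^sup>2 \<partial>L n) \<le> C"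
  shows "(\<lambda>n. CLINT p|K n \<Otimes>\<^sub>M L n. iexp (t * (u n (fst p) \<bullet> w n (snd p))))
    \<longlonglongrightarrow> (CLINT p|\<Gamma> \<Otimes>\<^sub>M \<Delta>. iexp (t * (G (fst p) \<bullet> W (snd p))))"
proof -
  interpret \<Gamma>: prob_space \<Gamma> by (rule \<Gamma>)
  interpret \<Delta>: prob_space \<Delta> by (rule \<Delta>)
  interpret \<Gamma>\<Delta>: pair_prob_space \<Gamma> \<Delta> ..
  note [measurable] = meas
  define \<psi> where "\<psi> y = (CLINT a|\<Gamma>. iexp (y \<bullet> G a))" for y
  define \<zeta> where "\<zeta> y = (CLINT b|\<Delta>. iexp (y \<bullet> W b))" for y
  have bnd: "norm (CLINT a|M. iexp (f a)) \<le> 1" if "prob_space M" for M :: "'z measure" and f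
  proof -
    interpret prob_space M by (rule that)
    show ?thesis
      using integral_norm_bound[of M "\<lambda>a. iexp (f a)"] by (simp add: prob_space)
  qed
  have iint: "integrable M (\<lambda>a. iexp (f a))" if "prob_space M" "f \<in> borel_measurable M" for M :: "'z measure" and f
    using prob_space.integrable_iexp[OF that(1), of f] that(2) by simp
  have \<psi>m[measurable]: "\<psi> \<in> borel_measurable borel" unfolding \<psi>_def by measurable
  have \<zeta>m[measurable]: "\<zeta> \<in> borel_measurable borel" unfolding \<zeta>_def by measurable
  have KL: "(CLINT p|K n \<Otimes>\<^sub>M L n. iexp (t * (u n (fst p) \<bullet> w n (snd p))))
      = (CLINT b|L n. CLINT a|K n. iexp ((t *\<^sub>R w n b) \<bullet> u n a))" for n
  proof -
    interpret K: prob_space "K n" by (rule K)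
    interpret L: prob_space "L n" by (rule L)
    interpret pair_prob_space "K n" "L n" ..
    have "integrable (K n \<Otimes>\<^sub>M L n) (\<lambda>(a, b). iexp ((t *\<^sub>R w n b) \<bullet> u n a))"
      unfolding split_beta' by (rule iint) (unfold_locales, measurable)
    from integral_snd[OF this] show ?thesis
      by (simp add: split_beta' inner_commute)
  qed
  \<comment> \<open>Exchanging the integrals moves all dependence on \<open>n\<close> inside an
    integral over the fixed measure \<open>\<Gamma>\<close>.\<close>
  have L\<Gamma>: "(CLINT b|L n. \<psi> (t *\<^sub>R w n b)) = (CLINT a|\<Gamma>. CLINT b|L n. iexp ((t *\<^sub>R G a) \<bullet> w n b))" for n
  proof -
    interpret L: prob_space "L n" by (rule L)
    interpret pair_prob_space \<Gamma> "L n" ..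
    have i: "integrable (\<Gamma> \<Otimes>\<^sub>M L n) (\<lambda>(a, b). iexp ((t *\<^sub>R w n b) \<bullet> G a))"
      unfolding split_beta' by (rule iint) (unfold_locales, measurable)
    from integral_snd[OF this] integral_fst[OF this] show ?thesis
      by (simp add: \<psi>_def inner_commute)
  qed
  have \<Gamma>\<Delta>: "(CLINT p|\<Gamma> \<Otimes>\<^sub>M \<Delta>. iexp (t * (G (fst p) \<bullet> W (snd p)))) = (CLINT a|\<Gamma>. \<zeta> (t *\<^sub>R G a))"
  proof -
    have "integrable (\<Gamma> \<Otimes>\<^sub>M \<Delta>) (\<lambda>(a, b). iexp ((t *\<^sub>R G a) \<bullet> W b))"
      unfolding split_beta' by (rule iint) (unfold_locales, measurable)
    from \<Gamma>\<Delta>.integral_fst[OF this] show ?thesis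
      by (simp add: \<zeta>_def split_beta')
  qed
  have lim2: "(\<lambda>n. CLINT b|L n. \<psi> (t *\<^sub>R w n b)) \<longlonglongrightarrow> (CLINT a|\<Gamma>. \<zeta> (t *\<^sub>R G a))"
    unfolding L\<Gamma>
  proof (rule integral_dominated_convergence[where w="\<lambda>_. 1"])
    show "(\<lambda>a. CLINT b|L n. iexp ((t *\<^sub>R G a) \<bullet> w n b)) \<in> borel_measurable \<Gamma>" for n
    proof -
      interpret L: prob_space "L n" by (rule L)
      show ?thesis by measurable
    qed
    show "AE a in \<Gamma>. (\<lambda>n. CLINT b|L n. iexp ((t *\<^sub>R G a) \<bullet> w n b)) \<longlonglongrightarrow> \<zeta> (t *\<^sub>R G a)"
      unfolding \<zeta>_def by (intro AE_I2 w)
    show "AE a in \<Gamma>. norm (CLINT b|L n. iexp ((t *\<^sub>R G a) \<bullet> w n b)) \<le> 1" for n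
      by (intro AE_I2 bnd L)
  qed auto
  have C: "0 \<le> C" using w2(2)[of 0] by (rule order_trans[rotated]) (simp add: integral_nonneg_AE)
  have lim1: "(\<lambda>n. (CLINT b|L n. CLINT a|K n. iexp ((t *\<^sub>R w n b) \<bullet> u n a)) - (CLINT b|L n. \<psi> (t *\<^sub>R w n b))) \<longlonglongrightarrow> 0"
  proof (rule LIMSEQ_I)
    fix e :: real assume e: "0 < e"
    \<comment> \<open>Outside the ball the two characteristic functions differ by at most 2, hence
      by at most \<open>2 * t^2 * norm (w n b)^2 / R^2\<close>, whose mean this choice of
      \<open>R\<close> keeps below \<open>e / 2\<close>.\<close>
    define R where "R = sqrt (4 * (t\<^sup>2 * C + 1) / e)"
    have R: "0 < R" "R\<^sup>2 = 4 * (t\<^sup>2 * C + 1) / e"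
      unfolding R_def using e C by (auto intro!: add_nonneg_pos divide_pos_pos add_nonneg_nonneg)
    from u[of R] obtain \<epsilon> where \<epsilon>: "\<epsilon> \<longlonglongrightarrow> 0"
      "\<And>n y. norm y \<le> R \<Longrightarrow> norm ((CLINT a|K n. iexp (y \<bullet> u n a)) - \<psi> y) \<le> \<epsilon> n"
      unfolding \<psi>_def by blast
    have \<epsilon>0: "0 \<le> \<epsilon> n" for n using order_trans[OF norm_ge_zero \<epsilon>(2)[of 0 n]] R by simp
    have "eventually (\<lambda>n. \<epsilon> n < e / 2) sequentially"
      using \<epsilon>(1) by (rule order_tendstoD) (use e in simp)
    then obtain N where N: "\<And>n. n \<ge> N \<Longrightarrow> \<epsilon> n < e / 2"
      unfolding eventually_sequentially by blast
    have "norm ((CLINT b|L n. CLINT a|K n. iexp ((t *\<^sub>R w n b) \<bullet> u n a)) - (CLINT b|L n. \<psi> (t *\<^sub>R w n b)) - 0) < e"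
      if n: "n \<ge> N" for n
    proof -
      interpret L: prob_space "L n" by (rule L)
      interpret K: prob_space "K n" by (rule K)
      define c where "c b = (CLINT a|K n. iexp ((t *\<^sub>R w n b) \<bullet> u n a))" for b
      have [measurable]: "c \<in> borel_measurable (L n)" unfolding c_def by measurable
      have c1: "norm (c b) \<le> 1" for b unfolding c_def by (rule bnd[OF K])
      have \<psi>1: "norm (\<psi> y) \<le> 1" for y unfolding \<psi>_def by (rule bnd[OF \<Gamma>])
      have i: "integrable (L n) c" "integrable (L n) (\<lambda>b. \<psi> (t *\<^sub>R w n b))"
        by (auto intro!: L.integrable_const_bound[where B=1] AE_I2 c1 \<psi>1)
      have "norm ((CLINT b|L n. c b) - (CLINT b|L n. \<psi> (t *\<^sub>R w n b)))
        = norm (CLINT b|L n. c b - \<psi> (t *\<^sub>R w n b))"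
        by (simp only: Bochner_Integration.integral_diff[OF i])
      also have "\<dots> \<le> (\<integral>b. norm (c b - \<psi> (t *\<^sub>R w n b)) \<partial>L n)"
        by (rule integral_norm_bound)
      also have "\<dots> \<le> (\<integral>b. \<epsilon> n + 2 * t\<^sup>2 / R\<^sup>2 * (norm (w n b))\<^sup>2 \<partial>L n)"
      proof (rule integral_mono)
        show "integrable (L n) (\<lambda>b. norm (c b - \<psi> (t *\<^sub>R w n b)))"
          by (intro integrable_norm Bochner_Integration.integrable_diff i)
        show "integrable (L n) (\<lambda>b. \<epsilon> n + 2 * t\<^sup>2 / R\<^sup>2 * (norm (w n b))\<^sup>2)"
          using w2(1)[of n] by simp
        show "norm (c b - \<psi> (t *\<^sub>R w n b)) \<le> \<epsilon> n + 2 * t\<^sup>2 / R\<^sup>2 * (norm (w n b))\<^sup>2" for b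
        proof (cases "norm (t *\<^sub>R w n b) \<le> R")
          case True
          have "norm (c b - \<psi> (t *\<^sub>R w n b)) \<le> \<epsilon> n"
            unfolding c_def by (rule \<epsilon>(2)[OF True])
          then show ?thesis by (rule order_trans) simp
        next
          case False
          have "R\<^sup>2 \<le> (norm (t *\<^sub>R w n b))\<^sup>2" using False R by (intro power_mono) auto
          then have "1 \<le> t\<^sup>2 * (norm (w n b))\<^sup>2 / R\<^sup>2" using R(1) by (simp add: power_mult_distrib)
          moreover have "norm (c b - \<psi> (t *\<^sub>R w n b)) \<le> 1 + 1"
            by (rule order_trans[OF norm_triangle_ineq4 add_mono[OF c1 \<psi>1]])
          ultimately show ?thesis using \<epsilon>0[of n] by simp
        qed
      qed
      also have "\<dots> = \<epsilon> n + 2 * t\<^sup>2 / R\<^sup>2 * (\<integral>b. (norm (w n b))\<^sup>2 \<partial>L n)"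
        using w2(1)[of n] by (simp add: L.prob_space)
      also have "\<dots> \<le> \<epsilon> n + 2 * t\<^sup>2 / R\<^sup>2 * C"
        using w2(2)[of n] by (intro add_left_mono mult_left_mono) auto
      also have "2 * t\<^sup>2 / R\<^sup>2 * C \<le> e / 2"
      proof -
        have "0 < t\<^sup>2 * C + 1" using C by (intro add_nonneg_pos) auto
        then show ?thesis unfolding R(2) using e by (simp add: field_simps)
      qed
      finally show ?thesis using N[OF n] by (simp add: c_def)
    qed
    then show "\<exists>no. \<forall>n\<ge>no. norm ((CLINT b|L n. CLINT a|K n. iexp ((t *\<^sub>R w n b) \<bullet> u n a)) - (CLINT b|L n. \<psi> (t *\<^sub>R w n b)) - 0) < e"
      by blast
  qed
  show ?thesis
    unfolding KL \<Gamma>\<Delta> using tendsto_add[OF lim1 lim2] by simp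
qed

section \<open>Normal laws through their characteristic functions\<close>

lemma char_normal_density:
  assumes s: "0 < s"
  shows "char (density lborel (normal_density m s)) t = iexp (t * m) * of_real (exp (- (t * s)\<^sup>2 / 2))"
proof -
  interpret N: prob_space std_normal_distribution by (rule prob_space_normal_density) simp
  have "distributed std_normal_distribution lborel (\<lambda>x. x) std_normal_density"
    by (simp add: distributed_def distr_id2)
  then have "distributed std_normal_distribution lborel (\<lambda>x. m + s * x) (normal_density (m + s * 0) (\<bar>s\<bar> * 1))"
    by (rule N.normal_density_affine) (use s in auto)
  then have eq: "density lborel (normal_density m s) = distr std_normal_distribution lborel (\<lambda>x. m + s * x)"
    using s by (simp add: distributed_def)
  have "char (density lborel (normal_density m s)) t = (CLINT x|std_normal_distribution. iexp (t * (m + s * x)))"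
    unfolding char_def eq by (subst integral_distr) auto
  also have "\<dots> = (CLINT x|std_normal_distribution. iexp (t * m) * iexp ((t * s) * x))"
    by (intro Bochner_Integration.integral_cong refl) (simp add: exp_add[symmetric] algebra_simps)
  also have "\<dots> = iexp (t * m) * char std_normal_distribution (t * s)"
    unfolding char_def by (rule integral_mult_right_zero)
  finally show ?thesis by (simp add: char_std_normal_distribution)
qed

lemma eq_normal_density_of_char:
  assumes \<mu>: "real_distribution \<mu>" and s: "0 < s"
    and ch: "\<And>t. char \<mu> t = iexp (t * m) * of_real (exp (- (t * s)\<^sup>2 / 2))"
  shows "\<mu> = density lborel (normal_density m s)"
proof (rule Levy_uniqueness[OF \<mu>])
  show "real_distribution (density lborel (normal_density m s))"
    using prob_space_normal_density[OF s] by (auto simp: real_distribution_def real_distribution_axioms_def)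
  show "char \<mu> = char (density lborel (normal_density m s))"
    using ch char_normal_density[OF s] by auto
qed

text \<open>The parameter is the variance rather than a standard deviation, so that the value 0 is
  included and yields the point mass allowed by \<open>normal_law\<close>.\<close>

lemma normal_law_of_char:
  assumes \<mu>: "real_distribution \<mu>" and s2: "0 \<le> s2"
    and ch: "\<And>t. char \<mu> t = iexp (t * m) * of_real (exp (- (t\<^sup>2 * s2) / 2))"
  shows "normal_law \<mu>"
proof (cases "s2 = 0")
  case True
  have "\<mu> = return borel m"
  proof (rule Levy_uniqueness[OF \<mu>])
    show "real_distribution (return borel m)"
      by (auto simp: real_distribution_def real_distribution_axioms_def intro!: prob_space_return)
    show "char \<mu> = char (return borel m)"
      using ch True by (intro ext) (simp add: char_def[of "return borel m"] integral_return)
  qed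
  then show ?thesis by (auto simp: normal_law_def)
next
  case False
  then have "\<mu> = density lborel (normal_density m (sqrt s2))"
    using s2 ch by (intro eq_normal_density_of_char \<mu>) (auto simp: power_mult_distrib)
  moreover have "0 < sqrt s2" using s2 False by simp
  ultimately show ?thesis unfolding normal_law_def by blast
qed

lemma indep_vars_PiM_coordinates:
  assumes M: "\<And>i. i \<in> I \<Longrightarrow> prob_space (M i)" and I: "I \<noteq> {}"
  shows "prob_space.indep_vars (Pi\<^sub>M I M) M (\<lambda>i \<omega>. \<omega> i) I"
proof -
  interpret prob_space "Pi\<^sub>M I M" by (rule prob_space_PiM) (rule M)
  have "distr (Pi\<^sub>M I M) (Pi\<^sub>M I M) (\<lambda>\<omega>. \<lambda>i\<in>I. \<omega> i) = distr (Pi\<^sub>M I M) (Pi\<^sub>M I M) (\<lambda>\<omega>. \<omega>)"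
    by (intro distr_cong) (auto simp: space_PiM PiE_def extensional_restrict)
  also have "\<dots> = Pi\<^sub>M I M" by (simp add: distr_id2)
  also have "\<dots> = (\<Pi>\<^sub>M i\<in>I. distr (Pi\<^sub>M I M) (M i) (\<lambda>\<omega>. \<omega> i))"
    by (intro PiM_cong refl distr_PiM_component[symmetric] M)
  finally show ?thesis
    by (subst indep_vars_iff_distr_eq_PiM'[OF I]) auto
qed

lemma cf_std_normal_linear:
  assumes I: "finite I" "I \<noteq> {}"
  shows "(CLINT \<omega>|Pi\<^sub>M I (\<lambda>_. std_normal_distribution). iexp (\<Sum>i\<in>I. c i * \<omega> i))
    = of_real (exp (- (\<Sum>i\<in>I. (c i)\<^sup>2) / 2))"
proof -
  define M where "M = Pi\<^sub>M I (\<lambda>_. std_normal_distribution)"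
  have N: "prob_space std_normal_distribution" by (rule prob_space_normal_density) simp
  interpret prob_space M unfolding M_def by (rule prob_space_PiM) (rule N)
  have comp: "(\<lambda>\<omega>. \<omega> i) \<in> M \<rightarrow>\<^sub>M std_normal_distribution" if "i \<in> I" for i
    unfolding M_def using that by (rule measurable_component_singleton)
  have ind: "indep_vars (\<lambda>_. borel) (\<lambda>i \<omega>. c i * \<omega> i) I"
    by (rule indep_vars_compose2[OF indep_vars_PiM_coordinates[OF N I(2), folded M_def]]) auto
  have meas: "(\<lambda>\<omega>. c i * \<omega> i) \<in> borel_measurable M" if "i \<in> I" for i
    using comp[OF that] by simp
  have "(CLINT \<omega>|M. iexp (\<Sum>i\<in>I. c i * \<omega> i)) = char (distr M borel (\<lambda>\<omega>. \<Sum>i\<in>I. c i * \<omega> i)) 1"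
    unfolding char_def using meas by (subst integral_distr) auto
  also have "\<dots> = (\<Prod>i\<in>I. char (distr M borel (\<lambda>\<omega>. c i * \<omega> i)) 1)"
    by (rule char_distr_sum[OF ind])
  also have "\<dots> = (\<Prod>i\<in>I. of_real (exp (- (c i)\<^sup>2 / 2)))"
  proof (rule prod.cong[OF refl])
    fix i assume i: "i \<in> I"
    have "char (distr M borel (\<lambda>\<omega>. c i * \<omega> i)) 1 = (CLINT \<omega>|M. iexp (c i * \<omega> i))"
      unfolding char_def using meas[OF i] by (subst integral_distr) auto
    also have "\<dots> = (CLINT x|distr M std_normal_distribution (\<lambda>\<omega>. \<omega> i). iexp (c i * x))"
      by (subst integral_distr[OF comp[OF i]]) auto
    also have "distr M std_normal_distribution (\<lambda>\<omega>. \<omega> i) = std_normal_distribution"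
      unfolding M_def by (rule distr_PiM_component[OF N i])
    finally show "char (distr M borel (\<lambda>\<omega>. c i * \<omega> i)) 1 = of_real (exp (- (c i)\<^sup>2 / 2))"
      using char_std_normal_distribution by (simp add: char_def fun_eq_iff)
  qed
  also have "\<dots> = of_real (exp (- (\<Sum>i\<in>I. (c i)\<^sup>2) / 2))"
    unfolding of_real_prod[symmetric] by (simp add: I exp_sum[symmetric] sum_negf sum_divide_distrib)
  finally show ?thesis unfolding M_def .
qed

section \<open>Factorization of positive semidefinite matrices\<close>

text \<open>Cholesky factorization by induction on the index set: split off the pivot
  \<open>i\<close> and factor the Schur complement. Singular matrices are included, as degenerate
  Gaussian vectors must be covered.\<close>

lemma psd_factorization:
  fixes S :: "'i \<Rightarrow> 'i \<Rightarrow> real"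
  assumes "finite I" "\<And>a b. S a b = S b a"
    and "\<And>c. 0 \<le> (\<Sum>a\<in>I. \<Sum>b\<in>I. c a * c b * S a b)"
  shows "\<exists>A. \<forall>a\<in>I. \<forall>b\<in>I. S a b = (\<Sum>k\<in>I. A a k * A b k)"
  using assms
proof (induction I arbitrary: S rule: finite_induct)
  case empty
  then show ?case by simp
next
  case (insert i I)
  have sym: "S a b = S b a" for a b by (rule insert.prems(1))
  define L where "L c = (\<Sum>a\<in>I. c a * S a i)" for c :: "'i \<Rightarrow> real"
  \<comment> \<open>The Schur complement of the pivot. For a zero pivot, division by zero gives
    \<open>T = S\<close>, which is right because \<open>off\<close> shows that the column of
    \<open>i\<close> then vanishes on \<open>I\<close>.\<close>
  define T where "T a b = S a b - S a i * S b i / S i i" for a b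
  have expand: "(\<Sum>a\<in>insert i I. \<Sum>b\<in>insert i I. c a * c b * S a b)
      = (\<Sum>a\<in>I. \<Sum>b\<in>I. c a * c b * S a b) + 2 * c i * L c + (c i)\<^sup>2 * S i i" for c
  proof -
    have "(\<Sum>b\<in>I. c i * c b * S i b) = c i * L c" "(\<Sum>a\<in>I. c a * c i * S a i) = c i * L c"
      unfolding L_def sum_distrib_left by (auto intro!: sum.cong simp: sym[of i])
    then show ?thesis
      using insert.hyps by (simp add: sum.distrib power2_eq_square algebra_simps)
  qed
  have ii: "0 \<le> S i i"
  proof -
    define c where "c a = (if a = i then 1 else 0 :: real)" for a
    have "(\<Sum>a\<in>I. \<Sum>b\<in>I. c a * c b * S a b) = 0" "L c = 0"
      unfolding L_def using insert.hyps by (auto intro!: sum.neutral simp: c_def)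
    moreover have "c i = 1" by (simp add: c_def)
    ultimately show ?thesis using insert.prems(2)[of c] unfolding expand by simp
  qed
  have off: "S a i = 0" if "a \<in> I" "S i i = 0" for a
  proof (rule ccontr)
    assume ne: "S a i \<noteq> 0"
    \<comment> \<open>This value makes \<open>S a a + 2 * r * S a i\<close> equal to -1,
      contradicting positivity of the form.\<close>
    define r where "r = - (S a a + 1) / (2 * S a i)"
    define c where "c b = (if b = i then r else if b = a then 1 else 0)" for b
    have ai: "a \<noteq> i" using that insert.hyps by auto
    have cI: "c b = (if b = a then 1 else 0)" if "b \<in> I" for b
      using that insert.hyps by (auto simp: c_def)
    have "(\<Sum>x\<in>I. \<Sum>y\<in>I. c x * c y * S x y) = (\<Sum>x\<in>I. \<Sum>y\<in>I. if y = a then (if x = a then S a a else 0) else 0)"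
      by (intro sum.cong refl) (auto simp: cI)
    also have "\<dots> = S a a" using that insert.hyps by simp
    finally have Q: "(\<Sum>x\<in>I. \<Sum>y\<in>I. c x * c y * S x y) = S a a" .
    have "L c = (\<Sum>x\<in>I. if x = a then S a i else 0)"
      unfolding L_def by (intro sum.cong refl) (auto simp: cI)
    then have Lc: "L c = S a i" using that insert.hyps by simp
    have "0 \<le> S a a + 2 * r * S a i"
      using insert.prems(2)[of c] unfolding expand Q Lc using that by (simp add: c_def)
    then show False using ne by (simp add: r_def field_simps)
  qed
  have "0 \<le> (\<Sum>a\<in>I. \<Sum>b\<in>I. c a * c b * T a b)" for c
  proof -
    \<comment> \<open>Completing the square: for a positive pivot this coordinate at
      \<open>i\<close> minimizes the form of \<open>S\<close>, and the minimum is the form of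
      \<open>T\<close>. For a zero pivot it is 0, and both sides still agree.\<close>
    define c' where "c' = c(i := - L c / S i i)"
    have eqI: "c' b = c b" if "b \<in> I" for b using that insert.hyps by (auto simp: c'_def)
    have "(\<Sum>a\<in>I. \<Sum>b\<in>I. c a * c b * T a b)
        = (\<Sum>a\<in>I. \<Sum>b\<in>I. c a * c b * S a b) - (\<Sum>a\<in>I. \<Sum>b\<in>I. (c a * S a i) * (c b * S b i)) / S i i"
      unfolding T_def sum_divide_distrib sum_subtractf[symmetric]
      by (intro sum.cong refl) (simp add: algebra_simps)
    also have "(\<Sum>a\<in>I. \<Sum>b\<in>I. (c a * S a i) * (c b * S b i)) = (L c)\<^sup>2"
      unfolding L_def power2_eq_square sum_product ..
    also have "(\<Sum>a\<in>I. \<Sum>b\<in>I. c a * c b * S a b) - (L c)\<^sup>2 / S i i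
        = (\<Sum>a\<in>insert i I. \<Sum>b\<in>insert i I. c' a * c' b * S a b)"
    proof -
      have "(\<Sum>a\<in>I. \<Sum>b\<in>I. c' a * c' b * S a b) = (\<Sum>a\<in>I. \<Sum>b\<in>I. c a * c b * S a b)"
        by (intro sum.cong refl) (auto simp: eqI)
      moreover have "L c' = L c" unfolding L_def by (intro sum.cong refl) (auto simp: eqI)
      moreover have "c' i = - L c / S i i" by (simp add: c'_def)
      ultimately show ?thesis
        unfolding expand by (cases "S i i = 0") (auto simp: power2_eq_square field_simps)
    qed
    finally show ?thesis using insert.prems(2) by simp
  qed
  moreover have "T a b = T b a" for a b unfolding T_def using sym by (simp add: mult.commute)
  ultimately obtain A where A: "\<And>a b. a \<in> I \<Longrightarrow> b \<in> I \<Longrightarrow> T a b = (\<Sum>k\<in>I. A a k * A b k)"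
    using insert.IH[of T] by blast
  \<comment> \<open>Triangular step: the new column \<open>i\<close> carries the pivot column
    divided by \<open>sqrt (S i i)\<close>, and row \<open>i\<close> vanishes in all other
    columns.\<close>
  define B where "B a k = (if k = i then (if a = i then sqrt (S i i) else S a i / sqrt (S i i)) else if a = i then 0 else A a k)" for a k
  have nin: "k \<noteq> i" if "k \<in> I" for k using that insert.hyps by auto
  have sumI: "(\<Sum>k\<in>insert i I. B a k * B b k) = B a i * B b i + (\<Sum>k\<in>I. B a k * B b k)" for a b
    using insert.hyps by simp
  have "S a b = (\<Sum>k\<in>insert i I. B a k * B b k)" if ab: "a \<in> insert i I" "b \<in> insert i I" for a b
  proof -
    consider "a = i" "b = i" | "a = i" "b \<in> I" | "a \<in> I" "b = i" | "a \<in> I" "b \<in> I" using ab by auto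
    then show ?thesis
    proof cases
      case 1
      have "(\<Sum>k\<in>I. B i k * B i k) = 0" by (intro sum.neutral) (auto simp: B_def nin)
      then show ?thesis unfolding sumI 1 using ii by (simp add: B_def)
    next
      case 2
      have "(\<Sum>k\<in>I. B i k * B b k) = 0" by (intro sum.neutral) (auto simp: B_def nin)
      then show ?thesis unfolding sumI 2(1)
        using ii off[OF 2(2)] nin[OF 2(2)] sym[of i b] by (cases "S i i = 0") (auto simp: B_def)
    next
      case 3
      have "(\<Sum>k\<in>I. B a k * B i k) = 0" by (intro sum.neutral) (auto simp: B_def nin)
      then show ?thesis unfolding sumI 3(2)
        using ii off[OF 3(1)] nin[OF 3(1)] by (cases "S i i = 0") (auto simp: B_def)
    next
      case 4
      have "(\<Sum>k\<in>I. B a k * B b k) = T a b"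
        unfolding A[OF 4] by (intro sum.cong refl) (use 4 nin in \<open>auto simp: B_def\<close>)
      then show ?thesis unfolding sumI
        using 4 nin ii by (auto simp: B_def T_def real_sqrt_mult[symmetric])
    qed
  qed
  then show ?case by blast
qed

section \<open>Gaussian vectors and generalized chi-square laws\<close>

abbreviation std_gaussian :: "('n \<Rightarrow> real) measure" where
  "std_gaussian \<equiv> \<Pi>\<^sub>M _\<in>UNIV. std_normal_distribution"

lemma prob_space_std_normal: "prob_space std_normal_distribution"
  by (rule prob_space_normal_density) simp

lemma measurable_vec_nth[measurable]: "(\<lambda>x::real^'n. x $ c) \<in> borel_measurable borel"
  by (intro borel_measurable_continuous_onI continuous_intros)

lemma borel_measurable_vecI:
  fixes f :: "'a \<Rightarrow> real ^ 'n"
  assumes "\<And>a. (\<lambda>\<omega>. f \<omega> $ a) \<in> borel_measurable M"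
  shows "f \<in> borel_measurable M"
  unfolding borel_measurable_euclidean_space[of f] 
  using assms by (auto simp: Basis_vec_def inner_axis)

text \<open>The second moment matrix of \<open>v\<close> is positive semidefinite, its quadratic
  form being the mean of a square. A factor \<open>A\<close> of it, applied to independent standard
  normal coordinates, gives a Gaussian vector with these second moments, possibly
  degenerate.\<close>

lemma (in prob_space) exists_gaussian_vector:
  fixes v :: "'a \<Rightarrow> real ^ 'n"
  assumes v[measurable]: "v \<in> borel_measurable M"
    and sq: "\<And>a. integrable M (\<lambda>\<omega>. (v \<omega> $ a)\<^sup>2)"
  shows "\<exists>G \<in> borel_measurable (std_gaussian :: ('n \<Rightarrow> real) measure).
    (\<forall>y. (CLINT \<omega>|std_gaussian. iexp (y \<bullet> G \<omega>)) = of_real (exp (- expectation (\<lambda>\<omega>. (y \<bullet> v \<omega>)\<^sup>2) / 2))) \<and>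
    (\<forall>a. integrable std_gaussian (\<lambda>\<omega>. (G \<omega> $ a)\<^sup>2)) \<and>
    (\<forall>a. (\<integral>\<omega>. G \<omega> $ a \<partial>std_gaussian) = 0) \<and>
    (\<forall>a b. (\<integral>\<omega>. G \<omega> $ a * G \<omega> $ b \<partial>std_gaussian) = expectation (\<lambda>\<omega>. v \<omega> $ a * v \<omega> $ b))"
proof -
  define S where "S a b = expectation (\<lambda>\<omega>. v \<omega> $ a * v \<omega> $ b)" for a b
  have int: "integrable M (\<lambda>\<omega>. v \<omega> $ a * v \<omega> $ b)" for a b
    by (rule integrable_mult_of_squares[OF _ _ sq sq]) measurable
  have q: "expectation (\<lambda>\<omega>. (\<Sum>a\<in>UNIV. c a * v \<omega> $ a)\<^sup>2) = (\<Sum>a\<in>UNIV. \<Sum>b\<in>UNIV. c a * c b * S a b)" for c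
  proof -
    have "(\<Sum>a\<in>UNIV. c a * v \<omega> $ a)\<^sup>2 = (\<Sum>a\<in>UNIV. \<Sum>b\<in>UNIV. c a * c b * (v \<omega> $ a * v \<omega> $ b))" for \<omega>
      unfolding power2_eq_square sum_product by (simp add: mult_ac)
    then show ?thesis using int by (simp add: S_def)
  qed
  have "\<exists>A::'n \<Rightarrow> 'n \<Rightarrow> real. \<forall>a\<in>UNIV. \<forall>b\<in>UNIV. S a b = (\<Sum>k\<in>UNIV. A a k * A b k)"
  proof (rule psd_factorization)
    show "S a b = S b a" for a b by (simp add: S_def mult.commute)
    show "0 \<le> (\<Sum>a\<in>UNIV. \<Sum>b\<in>UNIV. c a * c b * S a b)" for c
      unfolding q[symmetric] by (simp add: integral_nonneg_AE)
  qed simp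
  then obtain A :: "'n \<Rightarrow> 'n \<Rightarrow> real" where A': "\<forall>a\<in>UNIV. \<forall>b\<in>UNIV. S a b = (\<Sum>k\<in>UNIV. A a k * A b k)" ..
  have A: "S a b = (\<Sum>k\<in>UNIV. A a k * A b k)" for a b using A' by simp
  define col where "col k = (\<chi> a. A a k)" for k
  define G where "G \<omega> = (\<Sum>k\<in>UNIV. \<omega> k *\<^sub>R col k)" for \<omega> :: "'n \<Rightarrow> real"
  let ?P = "std_gaussian :: ('n \<Rightarrow> real) measure"
  interpret P: prob_space ?P by (rule prob_space_PiM) (rule prob_space_std_normal)
  have coord[measurable]: "(\<lambda>\<omega>. \<omega> k) \<in> borel_measurable ?P" for k
    using measurable_component_singleton[of k UNIV "\<lambda>_. std_normal_distribution"] by simp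
  have cd: "distr ?P std_normal_distribution (\<lambda>\<omega>. \<omega> k) = std_normal_distribution" for k
    by (rule distr_PiM_component) (auto intro: prob_space_std_normal)
  have mom: "(\<integral>\<omega>. (\<omega> k) ^ m \<partial>?P) = (\<integral>x. x ^ m \<partial>std_normal_distribution)"
    "integrable ?P (\<lambda>\<omega>. (\<omega> k) ^ m)" for k m
  proof -
    have c: "(\<lambda>\<omega>. \<omega> k) \<in> ?P \<rightarrow>\<^sub>M std_normal_distribution" by simp
    show "(\<integral>\<omega>. (\<omega> k) ^ m \<partial>?P) = (\<integral>x. x ^ m \<partial>std_normal_distribution)"
      by (subst (2) cd[of k, symmetric], subst integral_distr[OF c]) auto
    show "integrable ?P (\<lambda>\<omega>. (\<omega> k) ^ m)"
      using integrable_std_normal_distribution_moment[of m]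
      by (subst (asm) cd[of k, symmetric], subst (asm) integrable_distr_eq[OF c]) auto
  qed
  have m1: "(\<integral>\<omega>. \<omega> k \<partial>?P) = 0" for k
    using mom(1)[of k 1] integral_std_normal_distribution_moment_odd[of 1] by simp
  have m2: "(\<integral>\<omega>. (\<omega> k)\<^sup>2 \<partial>?P) = 1" for k
    using mom(1)[of k 2] std_normal_distribution_even_moments(1)[of 1] by simp
  have Gm: "G \<in> borel_measurable ?P" unfolding G_def by measurable
  have Gn: "G \<omega> $ a = (\<Sum>k\<in>UNIV. \<omega> k * A a k)" for \<omega> a unfolding G_def col_def by (simp add: sum_component)
  have ind: "P.indep_vars (\<lambda>_. borel) (\<lambda>k \<omega>. \<omega> k *\<^sub>R col k) UNIV"
    by (rule P.indep_vars_compose2[OF indep_vars_PiM_coordinates[OF prob_space_std_normal]]) auto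
  have sqV: "integrable ?P (\<lambda>\<omega>. ((\<omega> k *\<^sub>R col k) $ a)\<^sup>2)" for k a
    using mom(2)[of k 2] by (simp add: power_mult_distrib)
  have meanV: "P.expectation (\<lambda>\<omega>. (\<omega> k *\<^sub>R col k) $ a) = 0" for k a
    using m1 by simp
  have cov: "(\<integral>\<omega>. G \<omega> $ a * G \<omega> $ b \<partial>?P) = S a b" for a b
  proof -
    have eq: "(\<omega> k *\<^sub>R col k) $ a * (\<omega> k *\<^sub>R col k) $ b = A a k * A b k * (\<omega> k)\<^sup>2" for \<omega> k
      by (simp add: col_def power2_eq_square)
    have "(\<integral>\<omega>. G \<omega> $ a * G \<omega> $ b \<partial>?P) = (\<Sum>k\<in>UNIV. \<integral>\<omega>. A a k * A b k * (\<omega> k)\<^sup>2 \<partial>?P)"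
      unfolding G_def eq[symmetric]
      by (rule P.indep_vec_sum_second_moment[OF ind finite sqV meanV])
    also have "\<dots> = S a b" unfolding A by (simp add: m2)
    finally show ?thesis .
  qed
  have "integrable ?P (\<lambda>\<omega>. (G \<omega> $ a)\<^sup>2)" for a
    unfolding Gn
    by (rule square_integrable_sum) (use mom(2)[of _ 2] in \<open>auto simp: power_mult_distrib\<close>)
  moreover have "(\<integral>\<omega>. G \<omega> $ a \<partial>?P) = 0" for a
    unfolding Gn using mom(2)[of _ 1] m1 by simp
  moreover have "(CLINT \<omega>|?P. iexp (y \<bullet> G \<omega>)) = of_real (exp (- expectation (\<lambda>\<omega>. (y \<bullet> v \<omega>)\<^sup>2) / 2))" for y
  proof -
    have yG: "y \<bullet> G \<omega> = (\<Sum>k\<in>UNIV. (y \<bullet> col k) * \<omega> k)" for \<omega>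
      unfolding G_def by (simp add: inner_sum_right mult.commute)
    have "(\<Sum>k\<in>UNIV. (y \<bullet> col k)\<^sup>2) = (\<Sum>k\<in>UNIV. \<Sum>a\<in>UNIV. \<Sum>b\<in>UNIV. y $ a * y $ b * (A a k * A b k))"
      unfolding inner_vec_def col_def power2_eq_square sum_product by (simp add: mult_ac)
    also have "\<dots> = (\<Sum>a\<in>UNIV. \<Sum>b\<in>UNIV. \<Sum>k\<in>UNIV. y $ a * y $ b * (A a k * A b k))"
      by (rule trans[OF sum.swap]) (rule sum.cong[OF refl], rule sum.swap)
    also have "\<dots> = expectation (\<lambda>\<omega>. (\<Sum>a\<in>UNIV. y $ a * v \<omega> $ a)\<^sup>2)"
      unfolding q A by (simp add: sum_distrib_left)
    finally show ?thesis
      unfolding yG by (subst cf_std_normal_linear) (simp_all add: inner_vec_def)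
  qed
  ultimately show ?thesis using Gm cov unfolding S_def by blast
qed

text \<open>The laws in \<open>gaussian_vector_law\<close> live on functions on
  \<open>{..<k}\<close>. An enumeration \<open>e\<close> of the index type carries \<open>H\<close>
  there, preserving linear forms and the squared norm.\<close>

lemma chi_square_law_norm:
  fixes H :: "'a \<Rightarrow> real ^ 'n"
  assumes M: "prob_space M" and H[measurable]: "H \<in> borel_measurable M"
    and normal: "\<And>u. normal_law (distr M borel (\<lambda>\<omega>. u \<bullet> H \<omega>))"
  shows "chi_square_law (distr M borel (\<lambda>\<omega>. (norm (H \<omega>))\<^sup>2))"
proof -
  obtain e where e: "bij_betw e {..<CARD('n)} (UNIV :: 'n set)"
    using ex_bij_betw_nat_finite[of "UNIV :: 'n set"] by (auto simp: atLeast0LessThan)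
  let ?k = "CARD('n)"
  define T where "T \<omega> = (\<lambda>i\<in>{..<?k}. H \<omega> $ e i)" for \<omega>
  define \<nu> where "\<nu> = distr M (\<Pi>\<^sub>M i\<in>{..<?k}. borel) T"
  have T[measurable]: "T \<in> M \<rightarrow>\<^sub>M (\<Pi>\<^sub>M i\<in>{..<?k}. borel :: real measure)"
    unfolding T_def by measurable
  have "gaussian_vector_law ?k \<nu>"
    unfolding gaussian_vector_law_def
  proof (intro conjI allI)
    show "prob_space \<nu>" unfolding \<nu>_def by (rule prob_space.prob_space_distr[OF M T])
    show "sets \<nu> = sets (\<Pi>\<^sub>M i\<in>{..<?k}. borel :: real measure)" by (simp add: \<nu>_def)
    fix u :: "nat \<Rightarrow> real"
    define y :: "real ^ 'n" where "y = (\<chi> a. u (inv_into {..<?k} e a))"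
    have "distr \<nu> borel (\<lambda>v. \<Sum>i<?k. u i * v i) = distr M borel ((\<lambda>v. \<Sum>i<?k. u i * v i) \<circ> T)"
      unfolding \<nu>_def by (rule distr_distr) measurable
    also have "(\<lambda>v. \<Sum>i<?k. u i * v i) \<circ> T = (\<lambda>\<omega>. y \<bullet> H \<omega>)"
    proof
      fix \<omega>
      have "y \<bullet> H \<omega> = (\<Sum>i<?k. y $ e i * H \<omega> $ e i)"
        unfolding inner_vec_def inner_real_def
        by (rule sum.reindex_bij_betw[OF e, of "\<lambda>a. y $ a * H \<omega> $ a", symmetric])
      also have "\<dots> = (\<Sum>i<?k. u i * H \<omega> $ e i)"
        using e by (intro sum.cong refl) (simp add: y_def bij_betw_inv_into_left)
      finally show "((\<lambda>v. \<Sum>i<?k. u i * v i) \<circ> T) \<omega> = y \<bullet> H \<omega>" by (simp add: T_def)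
    qed
    finally show "normal_law (distr \<nu> borel (\<lambda>v. \<Sum>i<?k. u i * v i))" using normal by simp
  qed
  moreover have "distr \<nu> borel (\<lambda>v. \<Sum>i<?k. (v i)\<^sup>2) = distr M borel (\<lambda>\<omega>. (norm (H \<omega>))\<^sup>2)"
  proof -
    have "distr \<nu> borel (\<lambda>v. \<Sum>i<?k. (v i)\<^sup>2) = distr M borel ((\<lambda>v. \<Sum>i<?k. (v i)\<^sup>2) \<circ> T)"
      unfolding \<nu>_def by (rule distr_distr) measurable
    also have "(\<lambda>v. \<Sum>i<?k. (v i)\<^sup>2) \<circ> T = (\<lambda>\<omega>. (norm (H \<omega>))\<^sup>2)"
    proof
      fix \<omega>
      have "(norm (H \<omega>))\<^sup>2 = (\<Sum>a\<in>UNIV. (H \<omega> $ a)\<^sup>2)"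
        unfolding power2_norm_eq_inner inner_vec_def by (simp add: power2_eq_square)
      also have "\<dots> = (\<Sum>i<?k. (H \<omega> $ e i)\<^sup>2)"
        by (rule sum.reindex_bij_betw[OF e, symmetric])
      finally show "((\<lambda>v. \<Sum>i<?k. (v i)\<^sup>2) \<circ> T) \<omega> = (norm (H \<omega>))\<^sup>2" by (simp add: T_def)
    qed
    finally show ?thesis .
  qed
  ultimately show ?thesis
    unfolding chi_square_law_def by (intro exI[of _ ?k] exI[of _ \<nu>] conjI) simp_all
qed

text \<open>Polarization: \<open>G \<bullet> W = \<bar>G + W\<bar>\<^sup>2 / 4 - \<bar>G - W\<bar>\<^sup>2 / 4\<close>.\<close>

lemma lin_comb_two_chi_squares_inner:
  fixes G W :: "'a \<Rightarrow> real ^ 'n"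
  assumes M: "prob_space M" and [measurable]: "G \<in> borel_measurable M" "W \<in> borel_measurable M"
    and normal: "\<And>u v. normal_law (distr M borel (\<lambda>\<omega>. u \<bullet> G \<omega> + v \<bullet> W \<omega>))"
  shows "lin_comb_two_chi_squares (distr M borel (\<lambda>\<omega>. G \<omega> \<bullet> W \<omega>))"
proof -
  have [measurable]: "fst \<in> borel_measurable (borel :: (real \<times> real) measure)"
    "snd \<in> borel_measurable (borel :: (real \<times> real) measure)"
    by (intro borel_measurable_continuous_onI continuous_intros)+
  define T where "T \<omega> = ((norm (G \<omega> + W \<omega>))\<^sup>2, (norm (G \<omega> - W \<omega>))\<^sup>2)" for \<omega>
  have T[measurable]: "T \<in> borel_measurable M" unfolding T_def by measurable
  define \<rho> where "\<rho> = distr M borel T"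
  have "chi_square_law (distr \<rho> borel fst)"
  proof -
    have "distr \<rho> borel fst = distr M borel (fst \<circ> T)"
      unfolding \<rho>_def by (rule distr_distr) measurable
    also have "fst \<circ> T = (\<lambda>\<omega>. (norm (G \<omega> + W \<omega>))\<^sup>2)" by (auto simp: T_def)
    finally show ?thesis
      using normal chi_square_law_norm[OF M, of "\<lambda>\<omega>. G \<omega> + W \<omega>"] by (simp add: inner_add_right)
  qed
  moreover have "chi_square_law (distr \<rho> borel snd)"
  proof -
    have "distr \<rho> borel snd = distr M borel (snd \<circ> T)"
      unfolding \<rho>_def by (rule distr_distr) measurable
    also have "snd \<circ> T = (\<lambda>\<omega>. (norm (G \<omega> - W \<omega>))\<^sup>2)" by (auto simp: T_def)
    finally show ?thesis
      using normal[of u "- u" for u] chi_square_law_norm[OF M, of "\<lambda>\<omega>. G \<omega> - W \<omega>"]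
      by (simp add: inner_diff_right)
  qed
  moreover have "distr M borel (\<lambda>\<omega>. G \<omega> \<bullet> W \<omega>) = distr \<rho> borel (\<lambda>(c, d). 1 / 4 * c + (- 1 / 4) * d)"
  proof -
    have "(\<lambda>(c, d). 1 / 4 * c + (- 1 / 4) * d :: real) \<in> borel_measurable borel"
      unfolding borel_prod[symmetric] by measurable
    then have "distr \<rho> borel (\<lambda>(c, d). 1 / 4 * c + (- 1 / 4) * d) = distr M borel ((\<lambda>(c, d). 1 / 4 * c + (- 1 / 4) * d) \<circ> T)"
      unfolding \<rho>_def by (rule distr_distr) measurable
    also have "(\<lambda>(c, d). 1 / 4 * c + (- 1 / 4) * d) \<circ> T = (\<lambda>\<omega>. G \<omega> \<bullet> W \<omega>)"
      by (rule ext) (simp add: T_def power2_norm_eq_inner inner_add_left inner_add_right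
          inner_diff_left inner_diff_right inner_commute field_simps)
    finally show ?thesis ..
  qed
  moreover have "prob_space \<rho>" "sets \<rho> = sets borel"
    unfolding \<rho>_def using prob_space.prob_space_distr[OF M T] by auto
  ultimately show ?thesis
    unfolding lin_comb_two_chi_squares_def
    by (intro exI[of _ \<rho>] exI[of _ "1 / 4"] exI[of _ "- 1 / 4"] conjI)
qed

text \<open>Joint normality, as polarization requires it: by independence the characteristic
  function is a product, the exponents add, and homogeneity of \<open>q\<close> and \<open>r\<close>
  extracts the factor \<open>t^2\<close>.\<close>

lemma (in pair_prob_space) normal_law_linear_form:
  fixes G :: "'a \<Rightarrow> 'c::euclidean_space" and W :: "'b \<Rightarrow> 'c"
  assumes [measurable]: "G \<in> borel_measurable M1" "W \<in> borel_measurable M2"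
    and q: "\<And>y. 0 \<le> q y" "\<And>t y. q (t *\<^sub>R y) = t\<^sup>2 * q y" and r: "\<And>y. 0 \<le> r y" "\<And>t y. r (t *\<^sub>R y) = t\<^sup>2 * r y"
    and G: "\<And>y. (CLINT \<omega>|M1. iexp (y \<bullet> G \<omega>)) = of_real (exp (- q y / 2))"
    and W: "\<And>y. (CLINT \<omega>|M2. iexp (y \<bullet> W \<omega>)) = iexp (y \<bullet> m) * of_real (exp (- r y / 2))"
  shows "normal_law (distr (M1 \<Otimes>\<^sub>M M2) borel (\<lambda>p. u \<bullet> G (fst p) + v \<bullet> W (snd p)))"
proof (rule normal_law_of_char[of _ "q u + r v" "v \<bullet> m"])
  show "real_distribution (distr (M1 \<Otimes>\<^sub>M M2) borel (\<lambda>p. u \<bullet> G (fst p) + v \<bullet> W (snd p)))"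
    by (rule P.real_distribution_distr) measurable
  show "0 \<le> q u + r v" using q r by simp
  fix t
  have "char (distr (M1 \<Otimes>\<^sub>M M2) borel (\<lambda>p. u \<bullet> G (fst p) + v \<bullet> W (snd p))) t
    = (CLINT p|M1 \<Otimes>\<^sub>M M2. iexp (t * (u \<bullet> G (fst p) + v \<bullet> W (snd p))))"
    unfolding char_def by (subst integral_distr) auto
  also have "\<dots> = (CLINT a|M1. CLINT b|M2. iexp (t * (u \<bullet> G a + v \<bullet> W b)))"
    by (subst integral_fst'[symmetric, OF P.integrable_iexp]) auto
  also have "\<dots> = (CLINT a|M1. CLINT b|M2. iexp ((t *\<^sub>R u) \<bullet> G a) * iexp ((t *\<^sub>R v) \<bullet> W b))"
    by (intro Bochner_Integration.integral_cong refl) (simp add: exp_add[symmetric] algebra_simps)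
  also have "\<dots> = (CLINT a|M1. iexp ((t *\<^sub>R u) \<bullet> G a)) * (CLINT b|M2. iexp ((t *\<^sub>R v) \<bullet> W b))"
    by simp
  also have "\<dots> = of_real (exp (- q (t *\<^sub>R u) / 2)) * (iexp ((t *\<^sub>R v) \<bullet> m) * of_real (exp (- r (t *\<^sub>R v) / 2)))"
    unfolding G W ..
  also have "\<dots> = iexp (t * (v \<bullet> m)) * of_real (exp (- (t\<^sup>2 * (q u + r v)) / 2))"
    unfolding q r by (simp add: exp_add[symmetric] exp_of_real[symmetric] algebra_simps add_divide_distrib diff_divide_distrib)
  finally show "char (distr (M1 \<Otimes>\<^sub>M M2) borel (\<lambda>p. u \<bullet> G (fst p) + v \<bullet> W (snd p))) t
    = iexp (t * (v \<bullet> m)) * of_real (exp (- (t\<^sup>2 * (q u + r v)) / 2))" .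
qed

section \<open>The matrix inverse\<close>

lemma matrix_inv_mult:
  fixes A :: "real ^ 'n ^ 'n"
  assumes "invertible A"
  shows "A ** matrix_inv A = mat 1" "matrix_inv A ** A = mat 1"
  using someI_ex[OF assms[unfolded invertible_def]] unfolding matrix_inv_def by auto

text \<open>Cramer's rule applied to the columns of the inverse. Both measurability and continuity
  of the inverse are read off from this quotient of polynomials.\<close>

lemma matrix_inv_entry:
  fixes A :: "real ^ 'n ^ 'n"
  assumes "invertible A"
  shows "matrix_inv A $ k $ j = det (\<chi> i l. if l = k then axis j 1 $ i else A $ i $ l) / det A"
proof -
  have d: "det A \<noteq> 0" using assms by (simp add: invertible_det_nz)
  have "A *v (matrix_inv A *v axis j 1) = axis j 1"
    using matrix_inv_mult(1)[OF assms] by (simp add: matrix_vector_mul_assoc)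
  then have "matrix_inv A *v axis j 1 = (\<chi> k. det (\<chi> i l. if l = k then axis j 1 $ i else A $ i $ l) / det A)"
    using cramer[OF d] by blast
  moreover have "(matrix_inv A *v axis j 1) $ k = matrix_inv A $ k $ j"
    by (simp add: matrix_vector_mult_basis column_def)
  ultimately show ?thesis by simp
qed

text \<open>On singular matrices the predicate defining \<^const>\<open>matrix_inv\<close> is empty, so that it is
  one and the same unspecified matrix for all of them. This is what makes it measurable.\<close>

lemma borel_measurable_matrix_inv_entry:
  fixes A :: "'a \<Rightarrow> real ^ 'n ^ 'n"
  assumes A[measurable]: "\<And>i j. (\<lambda>\<omega>. A \<omega> $ i $ j) \<in> borel_measurable M"
  shows "(\<lambda>\<omega>. matrix_inv (A \<omega>) $ k $ j) \<in> borel_measurable M"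
proof -
  define c where "c = (SOME B :: real ^ 'n ^ 'n. False)"
  have eq: "matrix_inv (A \<omega>) $ k $ j =
    (if det (A \<omega>) \<noteq> 0 then det (\<chi> i l. if l = k then axis j 1 $ i else A \<omega> $ i $ l) / det (A \<omega>) else c $ k $ j)" for \<omega>
  proof (cases "invertible (A \<omega>)")
    case True
    then show ?thesis by (simp add: matrix_inv_entry invertible_det_nz)
  next
    case False
    then have "(\<lambda>B. A \<omega> ** B = mat 1 \<and> B ** A \<omega> = mat 1) = (\<lambda>_. False)"
      unfolding invertible_def by blast
    then have "matrix_inv (A \<omega>) = c"
      unfolding matrix_inv_def c_def by simp
    then show ?thesis using False by (simp add: invertible_det_nz)
  qed
  have [measurable]: "(\<lambda>\<omega>. if l = k then axis j 1 $ i else A \<omega> $ i $ l) \<in> borel_measurable M" for i l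
    by (cases "l = k") auto
  show ?thesis
    unfolding eq det_def vec_lambda_beta by measurable
qed

lemma continuous_det:
  fixes A :: "'a::t2_space \<Rightarrow> real ^ 'n ^ 'n"
  assumes "\<And>i j. continuous F (\<lambda>x. A x $ i $ j)"
  shows "continuous F (\<lambda>x. det (A x))"
  unfolding det_def by (intro continuous_intros assms)

text \<open>The determinant is continuous and nonzero at \<open>K\<close>, so Cramer's quotient is
  continuous there. An explicit radius \<open>\<delta>\<close> is what a Markov bound for the kernel
  matrix can be combined with.\<close>

lemma matrix_inv_near:
  fixes K :: "real ^ 'n ^ 'n"
  assumes K: "invertible K" and \<eta>: "0 < \<eta>"
  shows "\<exists>\<delta>>0. \<forall>A. norm (A - K) < \<delta> \<longrightarrow> invertible A \<and> (\<forall>k j. \<bar>matrix_inv A $ k $ j - matrix_inv K $ k $ j\<bar> < \<eta>)"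
proof -
  have dK: "det K \<noteq> 0" using K by (simp add: invertible_det_nz)
  have entry: "isCont (\<lambda>A :: real^'n^'n. A $ i $ j) K" for i j
    by (intro continuous_intros)
  have det: "isCont det K"
    by (rule continuous_det[of "at K" "\<lambda>A. A"]) (rule entry)
  have num: "isCont (\<lambda>A. det (\<chi> i l. if l = k then axis j 1 $ i else A $ i $ l)) K" for k j
  proof (rule continuous_det)
    fix i l
    show "isCont (\<lambda>A. (\<chi> i l. if l = k then axis j 1 $ i else A $ i $ l) $ i $ l) K"
      using entry by (cases "l = k") auto
  qed
  define f where "f k j A = det (\<chi> i l. if l = k then axis j 1 $ i else A $ i $ l) / det A"
    for k j and A :: "real^'n^'n"
  have cont: "isCont (f k j) K" for k j
    unfolding f_def by (rule isCont_divide[OF num det dK])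
  have f: "(f k j \<longlongrightarrow> f k j K) (nhds K)" for k j
    by (rule tendsto_at_iff_tendsto_nhds[THEN iffD1, OF cont[unfolded isCont_def]])
  have 1: "eventually (\<lambda>A. \<forall>k j. dist (f k j A) (f k j K) < \<eta>) (nhds K)"
    by (intro eventually_all_finite tendstoD[OF f \<eta>])
  have "(det \<longlongrightarrow> det K) (nhds K)"
    by (rule tendsto_at_iff_tendsto_nhds[THEN iffD1, OF det[unfolded isCont_def]])
  then have 2: "eventually (\<lambda>A. det A \<noteq> 0) (nhds K)"
    using dK by (rule tendsto_imp_eventually_ne)
  from 1 2 have "eventually (\<lambda>A. invertible A \<and> (\<forall>k j. \<bar>matrix_inv A $ k $ j - matrix_inv K $ k $ j\<bar> < \<eta>)) (nhds K)"
    by eventually_elim (use K in \<open>auto simp: invertible_det_nz matrix_inv_entry f_def dist_real_def\<close>)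
  then show ?thesis
    unfolding eventually_nhds_metric by (auto simp: dist_norm)
qed

section \<open>The network as a sum over neurons\<close>

definition preact :: "nat \<Rightarrow> real ^ 'd \<Rightarrow> ('d param \<Rightarrow> real) \<Rightarrow> real" where
  "preact i x \<theta> = sigma_w / sqrt (real CARD('d)) * (\<Sum>j\<in>UNIV. \<theta> (W1 i j) * x $ j) + \<theta> (B1 i)"

text \<open>Agrees with the derivative wherever that exists and, unlike \<^const>\<open>deriv\<close>, is
  visibly Borel measurable.\<close>

definition dphi :: "(real \<Rightarrow> real) \<Rightarrow> real \<Rightarrow> real" where
  "dphi \<phi> z = lim (\<lambda>n. (\<phi> (z + 1 / real (Suc n)) - \<phi> z) / (1 / real (Suc n)))"

lemma borel_measurable_dphi[measurable]:
  assumes [measurable]: "\<phi> \<in> borel_measurable borel"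
  shows "dphi \<phi> \<in> borel_measurable borel"
  unfolding dphi_def by (rule borel_measurable_lim_metric) measurable

lemma dphi_eq_derivative:
  assumes "\<phi> differentiable at z"
  shows "(\<phi> has_real_derivative dphi \<phi> z) (at z)"
proof -
  obtain D where D: "(\<phi> has_real_derivative D) (at z)"
    using assms by (auto simp: real_differentiable_def)
  have "filterlim (\<lambda>n. 1 / real (Suc n)) (at 0) sequentially"
    unfolding filterlim_at using LIMSEQ_inverse_real_of_nat by (simp add: inverse_eq_divide)
  then have "(\<lambda>n. (\<phi> (z + 1 / real (Suc n)) - \<phi> z) / (1 / real (Suc n))) \<longlonglongrightarrow> D"
    using D[unfolded DERIV_def] by (rule filterlim_compose[rotated])
  then have "dphi \<phi> z = D" unfolding dphi_def by (rule limI)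
  then show ?thesis using D by simp
qed

lemma net_preact:
  "net \<phi> h x \<theta> = sigma_w / sqrt (real h) * (\<Sum>i<h. \<theta> (W2 i) * \<phi> (preact i x \<theta>)) + \<theta> B2"
  by (simp add: net_def preact_def)

text \<open>One rule for all four kinds of parameters: \<open>D\<close> collects the derivatives of
  the neurons' terms and \<open>e\<close> that of the output bias.\<close>

lemma partial_deriv_net:
  assumes "\<And>k. k < h \<Longrightarrow> ((\<lambda>t. (\<theta>(p := t)) (W2 k) * \<phi> (preact k x (\<theta>(p := t)))) has_real_derivative D k) (at (\<theta> p))"
    and "((\<lambda>t. (\<theta>(p := t)) B2) has_real_derivative e) (at (\<theta> p))"
  shows "partial_deriv p (net \<phi> h x) \<theta> = sigma_w / sqrt (real h) * (\<Sum>k<h. D k) + e"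
  unfolding partial_deriv_def net_preact
  by (intro DERIV_imp_deriv DERIV_add DERIV_cmult DERIV_sum assms) auto

text \<open>A preactivation is affine in each parameter and depends only on its own neuron. Writing
  the change as a multiple of \<open>t - \<theta> p\<close> prepares the chain rule at the point
  \<open>\<theta> p\<close>.\<close>

lemma preact_upd:
  "preact k x (\<theta>(W2 i := t)) = preact k x \<theta>"
  "preact k x (\<theta>(B2 := t)) = preact k x \<theta>"
  "preact k x (\<theta>(B1 i := t)) = preact k x \<theta> + (if k = i then t - \<theta> (B1 i) else 0)"
  "preact k x (\<theta>(W1 i j := t)) =
    preact k x \<theta> + (if k = i then sigma_w / sqrt (real CARD('d)) * x $ j * (t - \<theta> (W1 i j)) else 0)"
  for x :: "real ^ 'd"
proof -
  have "(\<Sum>l\<in>UNIV. (if l = j then t else \<theta> (W1 i l)) * x $ l) =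
      (\<Sum>l\<in>UNIV. \<theta> (W1 i l) * x $ l + (if l = j then (t - \<theta> (W1 i j)) * x $ j else 0))"
    by (intro sum.cong refl) (auto simp: algebra_simps)
  then have eq: "(\<Sum>l\<in>UNIV. (if l = j then t else \<theta> (W1 i l)) * x $ l) =
      (\<Sum>l\<in>UNIV. \<theta> (W1 i l) * x $ l) + (t - \<theta> (W1 i j)) * x $ j"
    by (simp add: sum.distrib)
  show "preact k x (\<theta>(W1 i j := t)) =
    preact k x \<theta> + (if k = i then sigma_w / sqrt (real CARD('d)) * x $ j * (t - \<theta> (W1 i j)) else 0)"
  proof (cases "k = i")
    case True
    have alg: "b * (s + (t - w) * y) + B = (b * s + B) + b * y * (t - w)" for b s w y B :: real
      by (simp add: algebra_simps)
    have "preact i x (\<theta>(W1 i j := t)) =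
        sigma_w / sqrt (real CARD('d)) * (\<Sum>l\<in>UNIV. (if l = j then t else \<theta> (W1 i l)) * x $ l) + \<theta> (B1 i)"
      by (simp add: preact_def)
    then show ?thesis unfolding eq alg using True by (simp add: preact_def)
  qed (simp add: preact_def)
qed (auto simp: preact_def)

lemma partial_deriv_net_W2:
  assumes "i < h"
  shows "partial_deriv (W2 i) (net \<phi> h x) \<theta> = sigma_w / sqrt (real h) * \<phi> (preact i x \<theta>)"
proof -
  have "partial_deriv (W2 i) (net \<phi> h x) \<theta>
      = sigma_w / sqrt (real h) * (\<Sum>k<h. if k = i then \<phi> (preact i x \<theta>) else 0) + 0"
  proof (rule partial_deriv_net)
    fix k
    show "((\<lambda>t. (\<theta>(W2 i := t)) (W2 k) * \<phi> (preact k x (\<theta>(W2 i := t)))) has_real_derivative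
      (if k = i then \<phi> (preact i x \<theta>) else 0)) (at (\<theta> (W2 i)))"
      by (cases "k = i") (auto simp: preact_upd intro!: derivative_eq_intros)
  qed simp
  then show ?thesis using assms by simp
qed

lemma partial_deriv_net_B2: "partial_deriv B2 (net \<phi> h x) \<theta> = 1"
proof -
  have "partial_deriv B2 (net \<phi> h x) \<theta> = sigma_w / sqrt (real h) * (\<Sum>k<h. 0) + 1"
    by (rule partial_deriv_net) (auto simp: preact_upd intro!: derivative_eq_intros)
  then show ?thesis by simp
qed

lemma partial_deriv_net_B1:
  assumes i: "i < h" and d: "\<phi> differentiable at (preact i x \<theta>)"
  shows "partial_deriv (B1 i) (net \<phi> h x) \<theta> = sigma_w / sqrt (real h) * (\<theta> (W2 i) * dphi \<phi> (preact i x \<theta>))"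
proof -
  have "partial_deriv (B1 i) (net \<phi> h x) \<theta>
      = sigma_w / sqrt (real h) * (\<Sum>k<h. if k = i then \<theta> (W2 i) * dphi \<phi> (preact i x \<theta>) else 0) + 0"
  proof (rule partial_deriv_net)
    fix k
    have "((\<lambda>t. \<phi> (preact i x \<theta> + (t - \<theta> (B1 i)))) has_real_derivative dphi \<phi> (preact i x \<theta>) * 1) (at (\<theta> (B1 i)))"
      using dphi_eq_derivative[OF d] by (intro DERIV_chain2[where f=\<phi>]) (auto intro!: derivative_eq_intros)
    then show "((\<lambda>t. (\<theta>(B1 i := t)) (W2 k) * \<phi> (preact k x (\<theta>(B1 i := t)))) has_real_derivative
      (if k = i then \<theta> (W2 i) * dphi \<phi> (preact i x \<theta>) else 0)) (at (\<theta> (B1 i)))"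
      by (cases "k = i") (auto simp: preact_upd intro!: DERIV_cmult)
  qed simp
  then show ?thesis using i by simp
qed

lemma partial_deriv_net_W1:
  fixes x :: "real ^ 'd"
  assumes i: "i < h" and d: "\<phi> differentiable at (preact i x \<theta>)"
  shows "partial_deriv (W1 i j) (net \<phi> h x) \<theta> =
    sigma_w / sqrt (real h) * (\<theta> (W2 i) * (dphi \<phi> (preact i x \<theta>) * (sigma_w / sqrt (real CARD('d)) * x $ j)))"
proof -
  let ?c = "sigma_w / sqrt (real CARD('d)) * x $ j"
  have "partial_deriv (W1 i j) (net \<phi> h x) \<theta>
      = sigma_w / sqrt (real h) * (\<Sum>k<h. if k = i then \<theta> (W2 i) * (dphi \<phi> (preact i x \<theta>) * ?c) else 0) + 0"
  proof (rule partial_deriv_net)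
    fix k
    have "((\<lambda>t. \<phi> (preact i x \<theta> + c * (t - \<theta> (W1 i j)))) has_real_derivative dphi \<phi> (preact i x \<theta>) * c) (at (\<theta> (W1 i j)))" for c
      using dphi_eq_derivative[OF d] by (intro DERIV_chain2[where f=\<phi>]) (auto intro!: derivative_eq_intros)
    from DERIV_cmult[OF this[of ?c], of "\<theta> (W2 i)"] show "((\<lambda>t. (\<theta>(W1 i j := t)) (W2 k) * \<phi> (preact k x (\<theta>(W1 i j := t)))) has_real_derivative
      (if k = i then \<theta> (W2 i) * (dphi \<phi> (preact i x \<theta>) * ?c) else 0)) (at (\<theta> (W1 i j)))"
      by (cases "k = i") (simp_all add: preact_upd)
  qed simp
  then show ?thesis using i by simp
qed

lemma params_eq: "params h = (\<lambda>(i, j). W1 i j) ` ({..<h} \<times> UNIV) \<union> B1 ` {..<h} \<union> W2 ` {..<h} \<union> {B2}"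
  unfolding params_def by auto

lemma sum_params:
  fixes g :: "'d::finite param \<Rightarrow> real"
  shows "(\<Sum>p\<in>params h. g p) = (\<Sum>i<h. (\<Sum>j\<in>UNIV. g (W1 i j)) + g (B1 i) + g (W2 i)) + g B2"
proof -
  have "(\<Sum>p\<in>params h. g p) = (\<Sum>p\<in>(\<lambda>(i, j). W1 i j) ` ({..<h} \<times> (UNIV :: 'd set)). g p)
      + (\<Sum>p\<in>B1 ` {..<h}. g p) + (\<Sum>p\<in>W2 ` {..<h}. g p) + g B2"
    unfolding params_eq by (subst sum.union_disjoint; force?)+
  also have "(\<Sum>p\<in>(\<lambda>(i, j). W1 i j) ` ({..<h} \<times> (UNIV :: 'd set)). g p) = (\<Sum>i<h. \<Sum>j\<in>UNIV. g (W1 i j))"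
    by (subst sum.reindex) (auto simp: inj_on_def sum.cartesian_product intro!: sum.cong)
  also have "(\<Sum>p\<in>B1 ` {..<h}. g p) = (\<Sum>i<h. g (B1 i))"
    by (subst sum.reindex) (auto simp: inj_on_def)
  also have "(\<Sum>p\<in>W2 ` {..<h}. g p) = (\<Sum>i<h. g (W2 i))"
    by (subst sum.reindex) (auto simp: inj_on_def)
  finally show ?thesis by (simp add: sum.distrib)
qed

text \<open>This is \<open>h\<close> times the share of neuron \<open>i\<close> in the kernel. Each
  2 stands for the square of \<open>sigma_w\<close>; the last factor joins the derivatives in the
  hidden bias (the 1) and in the first-layer weights. The output bias is left out.\<close>

definition neuron_ntk :: "(real \<Rightarrow> real) \<Rightarrow> real ^ 'd \<Rightarrow> real ^ 'd \<Rightarrow> nat \<Rightarrow> ('d param \<Rightarrow> real) \<Rightarrow> real" where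
  "neuron_ntk \<phi> x x' i \<theta> =
     2 * \<phi> (preact i x \<theta>) * \<phi> (preact i x' \<theta>) +
     2 * (\<theta> (W2 i))\<^sup>2 * dphi \<phi> (preact i x \<theta>) * dphi \<phi> (preact i x' \<theta>) * (1 + 2 / real CARD('d) * (x \<bullet> x'))"

lemma ntk_eq_sum_neurons:
  fixes x x' :: "real ^ 'd"
  assumes h: "0 < h"
    and d: "\<And>i. i < h \<Longrightarrow> \<phi> differentiable at (preact i x \<theta>)" "\<And>i. i < h \<Longrightarrow> \<phi> differentiable at (preact i x' \<theta>)"
  shows "ntk \<phi> h x x' \<theta> = 1 + (\<Sum>i<h. neuron_ntk \<phi> x x' i \<theta>) / real h"
proof -
  define c where "c = sigma_w / sqrt (real h)"
  define b where "b = sigma_w / sqrt (real CARD('d))"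
  have c2: "c * c = 2 / real h" "b * b = 2 / real CARD('d)"
    unfolding c_def b_def sigma_w_def by auto
  have "ntk \<phi> h x x' \<theta> = (\<Sum>i<h. neuron_ntk \<phi> x x' i \<theta> / real h) + 1"
    unfolding ntk_def sum_params
  proof (intro arg_cong2[where f="(+)"] sum.cong refl)
    fix i assume "i \<in> {..<h}"
    then have i: "i < h" by simp
    let ?z = "preact i x \<theta>" and ?z' = "preact i x' \<theta>" and ?w = "\<theta> (W2 i)"
    have "(\<Sum>j\<in>UNIV. partial_deriv (W1 i j) (net \<phi> h x) \<theta> * partial_deriv (W1 i j) (net \<phi> h x') \<theta>)
      = (\<Sum>j\<in>UNIV. (c * c) * ?w\<^sup>2 * dphi \<phi> ?z * dphi \<phi> ?z' * (b * b) * (x $ j * x' $ j))"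
      unfolding partial_deriv_net_W1[OF i d(1)[OF i]] partial_deriv_net_W1[OF i d(2)[OF i]] c_def[symmetric] b_def[symmetric]
      by (intro sum.cong refl) (simp add: power2_eq_square)
    also have "\<dots> = (c * c) * ?w\<^sup>2 * dphi \<phi> ?z * dphi \<phi> ?z' * (b * b) * (x \<bullet> x')"
      by (simp add: inner_vec_def sum_distrib_left)
    finally have 1: "(\<Sum>j\<in>UNIV. partial_deriv (W1 i j) (net \<phi> h x) \<theta> * partial_deriv (W1 i j) (net \<phi> h x') \<theta>)
      = (c * c) * ?w\<^sup>2 * dphi \<phi> ?z * dphi \<phi> ?z' * (b * b) * (x \<bullet> x')" .
    have 2: "partial_deriv (B1 i) (net \<phi> h x) \<theta> * partial_deriv (B1 i) (net \<phi> h x') \<theta>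
      = (c * c) * ?w\<^sup>2 * dphi \<phi> ?z * dphi \<phi> ?z'"
      unfolding partial_deriv_net_B1[OF i d(1)[OF i]] partial_deriv_net_B1[OF i d(2)[OF i]] c_def[symmetric]
      by (simp add: power2_eq_square)
    have 3: "partial_deriv (W2 i) (net \<phi> h x) \<theta> * partial_deriv (W2 i) (net \<phi> h x') \<theta>
      = (c * c) * \<phi> ?z * \<phi> ?z'"
      unfolding partial_deriv_net_W2[OF i] c_def[symmetric] by simp
    show "(\<Sum>j\<in>UNIV. partial_deriv (W1 i j) (net \<phi> h x) \<theta> * partial_deriv (W1 i j) (net \<phi> h x') \<theta>)
      + partial_deriv (B1 i) (net \<phi> h x) \<theta> * partial_deriv (B1 i) (net \<phi> h x') \<theta>
      + partial_deriv (W2 i) (net \<phi> h x) \<theta> * partial_deriv (W2 i) (net \<phi> h x') \<theta>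
      = neuron_ntk \<phi> x x' i \<theta> / real h"
      unfolding 1 2 3 c2 neuron_ntk_def using h by (simp add: field_simps)
  qed (simp add: partial_deriv_net_B2)
  then show ?thesis by (simp add: sum_divide_distrib)
qed

section \<open>The common law of the neurons and their independence\<close>

definition neuron_params :: "nat \<Rightarrow> 'd param set" where
  "neuron_params i = insert (B1 i) (insert (W2 i) (range (W1 i)))"

definition neuron_law :: "('d param \<Rightarrow> real) measure" where
  "neuron_law = Pi\<^sub>M (neuron_params 0) (\<lambda>_. std_normal_distribution)"

fun to_neuron :: "nat \<Rightarrow> 'd param \<Rightarrow> 'd param" where
  "to_neuron i (W1 k j) = W1 i j"
| "to_neuron i (B1 k) = B1 i"
| "to_neuron i (W2 k) = W2 i"
| "to_neuron i B2 = B2"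

text \<open>Renaming the parameters of neuron \<open>i\<close> to those of neuron 0 places all
  neurons, at every width, on the one space \<open>neuron_law\<close>, where being identically
  distributed is meaningful.\<close>

definition neuron :: "nat \<Rightarrow> ('d param \<Rightarrow> real) \<Rightarrow> ('d param \<Rightarrow> real)" where
  "neuron i \<theta> = (\<lambda>p\<in>neuron_params 0. \<theta> (to_neuron i p))"

lemma neuron_simps[simp]:
  "neuron i \<theta> (W1 0 j) = \<theta> (W1 i j)" "neuron i \<theta> (B1 0) = \<theta> (B1 i)" "neuron i \<theta> (W2 0) = \<theta> (W2 i)"
  "preact 0 x (neuron i \<theta>) = preact i x \<theta>" "neuron_ntk \<phi> x x' 0 (neuron i \<theta>) = neuron_ntk \<phi> x x' i \<theta>"
  by (simp_all add: neuron_def neuron_params_def preact_def neuron_ntk_def)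

lemma neuron_params_subset: "i < h \<Longrightarrow> neuron_params i \<subseteq> params h"
  by (auto simp: neuron_params_def params_def)

lemma to_neuron_in: "p \<in> neuron_params 0 \<Longrightarrow> to_neuron i p \<in> neuron_params i"
  by (auto simp: neuron_params_def)

lemma prob_space_init: "prob_space (init h)"
  unfolding init_def by (rule prob_space_PiM) (rule prob_space_std_normal)

lemma prob_space_neuron_law: "prob_space neuron_law"
  unfolding neuron_law_def by (rule prob_space_PiM) (rule prob_space_std_normal)

lemma measurable_init_component: "p \<in> params h \<Longrightarrow> (\<lambda>\<theta>. \<theta> p) \<in> borel_measurable (init h)"
  using measurable_component_singleton[of p "params h" "\<lambda>_. std_normal_distribution"] by (simp add: init_def)

lemma measurable_neuron_component: "p \<in> neuron_params 0 \<Longrightarrow> (\<lambda>\<eta>. \<eta> p) \<in> borel_measurable neuron_law"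
  using measurable_component_singleton[of p "neuron_params 0" "\<lambda>_. std_normal_distribution"] by (simp add: neuron_law_def)

lemma measurable_neuron_coords[measurable]:
  "(\<lambda>\<eta>. \<eta> (W1 0 j)) \<in> borel_measurable neuron_law" "(\<lambda>\<eta>. \<eta> (B1 0)) \<in> borel_measurable neuron_law"
  "(\<lambda>\<eta>. \<eta> (W2 0)) \<in> borel_measurable neuron_law"
  by (auto intro!: measurable_neuron_component simp: neuron_params_def)

text \<open>An injective renaming of the coordinates of a product of equal laws gives such a product
  again.\<close>

lemma distr_neuron:
  assumes i: "i < h"
  shows "neuron i \<in> init h \<rightarrow>\<^sub>M (neuron_law :: ('a param \<Rightarrow> real) measure)"
    and "distr (init h) neuron_law (neuron i) = (neuron_law :: ('a param \<Rightarrow> real) measure)"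
proof -
  have im: "to_neuron i p \<in> params h" if "p \<in> neuron_params 0" for p :: "'a param"
    using to_neuron_in[OF that] neuron_params_subset[OF i] by blast
  have inj: "inj_on (to_neuron i) (neuron_params 0 :: 'a param set)"
    by (auto simp: inj_on_def neuron_params_def)
  show "neuron i \<in> init h \<rightarrow>\<^sub>M (neuron_law :: ('a param \<Rightarrow> real) measure)"
    unfolding neuron_def neuron_law_def using measurable_init_component[OF im]
    by (intro measurable_restrict) (simp add: measurable_def)
  show "distr (init h) neuron_law (neuron i) = (neuron_law :: ('a param \<Rightarrow> real) measure)"
    using distr_PiM_reindex[of "params h" "\<lambda>_. std_normal_distribution" "to_neuron i" "neuron_params 0"] inj im
    unfolding init_def neuron_law_def neuron_def by (auto intro: prob_space_std_normal)
qed

lemma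
  fixes g :: "_ \<Rightarrow> 'b::{banach, second_countable_topology}"
  assumes i: "i < h" and g: "g \<in> borel_measurable neuron_law"
  shows integral_neuron: "(\<integral>\<theta>. g (neuron i \<theta>) \<partial>init h) = (\<integral>\<eta>. g \<eta> \<partial>neuron_law)"
    and integrable_neuron: "integrable (init h) (\<lambda>\<theta>. g (neuron i \<theta>)) \<longleftrightarrow> integrable neuron_law g"
  using integral_distr[OF distr_neuron(1)[OF i] g] integrable_distr_eq[OF distr_neuron(1)[OF i] g]
  by (simp_all add: distr_neuron(2)[OF i])

lemma AE_neuron: "i < h \<Longrightarrow> AE \<eta> in neuron_law. P \<eta> \<Longrightarrow> AE \<theta> in init h. P (neuron i \<theta>)"
  by (rule AE_distrD[OF distr_neuron(1)], assumption) (simp only: distr_neuron(2))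

lemma distr_init_B2: "distr (init h) std_normal_distribution (\<lambda>\<theta>. \<theta> B2) = std_normal_distribution"
  unfolding init_def by (rule distr_PiM_component) (auto simp: params_def intro: prob_space_std_normal)

text \<open>Functions of disjoint blocks of independent coordinates are independent. The output bias
  is treated as a block of its own with index \<open>h\<close>, whence the index set
  \<open>{..h}\<close>.\<close>

lemma indep_neurons:
  fixes u :: "nat \<Rightarrow> ('d param \<Rightarrow> real) \<Rightarrow> 'b"
  assumes u: "\<And>j. u j \<in> neuron_law \<rightarrow>\<^sub>M N" and w: "w \<in> borel \<rightarrow>\<^sub>M N"
  shows "prob_space.indep_vars (init h) (\<lambda>_. N) (\<lambda>j \<theta>. if j < h then u j (neuron j \<theta>) else w (\<theta> B2)) {..h}"
proof -
  interpret prob_space "init h :: ('d param \<Rightarrow> real) measure" by (rule prob_space_init)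
  define K :: "nat \<Rightarrow> 'd param set" where "K j = (if j < h then neuron_params j else {B2})" for j
  have "params h \<noteq> ({} :: 'd param set)" by (auto simp: params_def)
  then have "indep_vars (\<lambda>_. std_normal_distribution) (\<lambda>p \<theta>. \<theta> p) (params h)"
    unfolding init_def by (rule indep_vars_PiM_coordinates[OF prob_space_std_normal])
  then have ind: "indep_vars (\<lambda>j. Pi\<^sub>M (K j) (\<lambda>_. std_normal_distribution)) (\<lambda>j \<theta>. restrict (\<lambda>p. \<theta> p) (K j)) {..h}"
  proof (rule indep_vars_restrict)
    show "K j \<subseteq> params h" for j
      using neuron_params_subset[of j h] by (auto simp: K_def params_def)
    show "disjoint_family_on K {..h}"
      by (auto simp: disjoint_family_on_def K_def neuron_params_def)
  qed
  \<comment> \<open>The same variable written as a function of the coordinates in \<open>K j\<close>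
    alone, as composition of independent variables requires.\<close>
  define y where "y j \<eta> = (if j < h then u j (\<lambda>p\<in>neuron_params 0. \<eta> (to_neuron j p)) else w (\<eta> B2))" for j \<eta>
  have "indep_vars (\<lambda>_. N) (\<lambda>j \<theta>. y j (restrict (\<lambda>p. \<theta> p) (K j))) {..h}"
  proof (rule indep_vars_compose2[OF ind])
    fix j
    show "y j \<in> Pi\<^sub>M (K j) (\<lambda>_. std_normal_distribution) \<rightarrow>\<^sub>M N"
    proof (cases "j < h")
      case True
      have "(\<lambda>\<eta>. \<lambda>p\<in>neuron_params 0. \<eta> (to_neuron j p)) \<in> Pi\<^sub>M (K j) (\<lambda>_. std_normal_distribution) \<rightarrow>\<^sub>M neuron_law"
        unfolding neuron_law_def
        by (intro measurable_restrict measurable_component_singleton) (use True in \<open>simp add: K_def to_neuron_in\<close>)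
      from measurable_compose[OF this u[of j]] show ?thesis
        unfolding y_def using True by simp
    next
      case False
      have "(\<lambda>\<eta>. \<eta> B2) \<in> Pi\<^sub>M (K j) (\<lambda>_. std_normal_distribution) \<rightarrow>\<^sub>M std_normal_distribution"
        by (rule measurable_component_singleton) (use False in \<open>simp add: K_def\<close>)
      then have "(\<lambda>\<eta>. \<eta> B2) \<in> Pi\<^sub>M (K j) (\<lambda>_. std_normal_distribution) \<rightarrow>\<^sub>M borel" by simp
      from measurable_compose[OF this w] show ?thesis
        unfolding y_def using False by simp
    qed
  qed
  moreover have "(\<lambda>\<theta>. y j (restrict (\<lambda>p. \<theta> p) (K j))) = (\<lambda>\<theta>. if j < h then u j (neuron j \<theta>) else w (\<theta> B2))" for j
  proof
    fix \<theta> :: "'d param \<Rightarrow> real"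
    have "(\<lambda>p\<in>neuron_params 0. restrict \<theta> (neuron_params j) (to_neuron j p)) = neuron j \<theta>"
      unfolding neuron_def by (rule restrict_ext) (simp add: to_neuron_in)
    then show "y j (restrict (\<lambda>p. \<theta> p) (K j)) = (if j < h then u j (neuron j \<theta>) else w (\<theta> B2))"
      by (simp add: y_def K_def)
  qed
  ultimately show ?thesis by simp
qed

text \<open>The preactivations are nondegenerate Gaussians because of the bias.\<close>

lemma AE_preact:
  fixes x :: "real ^ 'd"
  assumes P: "AE z in lborel. P z"
  shows "AE \<eta> in neuron_law. P (preact 0 x \<eta>)"
proof -
  interpret prob_space "neuron_law :: ('d param \<Rightarrow> real) measure" by (rule prob_space_neuron_law)
  define c :: "'d param \<Rightarrow> real" where
    "c p = (case p of W1 k j \<Rightarrow> sigma_w / sqrt (real CARD('d)) * x $ j | B1 k \<Rightarrow> 1 | _ \<Rightarrow> 0)" for p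
  have pre: "preact 0 x \<eta> = (\<Sum>p\<in>neuron_params 0. c p * \<eta> p)" for \<eta>
  proof -
    have "(\<Sum>p\<in>neuron_params 0. c p * \<eta> p) = c (B1 0) * \<eta> (B1 0) + (c (W2 0) * \<eta> (W2 0) + (\<Sum>p\<in>range (W1 0). c p * \<eta> p))"
      unfolding neuron_params_def by (subst sum.insert; auto)+
    also have "(\<Sum>p\<in>range (W1 0). c p * \<eta> p) = (\<Sum>j\<in>UNIV. c (W1 0 j) * \<eta> (W1 0 j))"
      by (subst sum.reindex) (auto simp: inj_on_def)
    finally show ?thesis by (simp add: preact_def c_def sum_distrib_left mult_ac)
  qed
  define s2 where "s2 = (\<Sum>p\<in>neuron_params 0. (c p)\<^sup>2)"
  have "(c (B1 0))\<^sup>2 \<le> s2"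
    unfolding s2_def by (rule member_le_sum) (auto simp: neuron_params_def)
  then have s2: "0 < s2" by (simp add: c_def)
  have m[measurable]: "preact 0 x \<in> borel_measurable neuron_law"
    unfolding preact_def by measurable
  have D: "distr neuron_law borel (preact 0 x) = density lborel (normal_density 0 (sqrt s2))"
  proof (rule eq_normal_density_of_char)
    show "real_distribution (distr neuron_law borel (preact 0 x))"
      by (rule real_distribution_distr) measurable
    show "0 < sqrt s2" using s2 by simp
    fix t
    have "char (distr neuron_law borel (preact 0 x)) t = (CLINT \<eta>|neuron_law. iexp (\<Sum>p\<in>neuron_params 0. (t * c p) * \<eta> p))"
      unfolding char_def by (subst integral_distr) (auto simp: pre sum_distrib_left mult.assoc)
    also have "\<dots> = of_real (exp (- (\<Sum>p\<in>neuron_params 0. (t * c p)\<^sup>2) / 2))"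
      unfolding neuron_law_def by (rule cf_std_normal_linear) (auto simp: neuron_params_def)
    also have "(\<Sum>p\<in>neuron_params 0. (t * c p)\<^sup>2) = (t * sqrt s2)\<^sup>2"
      using s2 by (simp add: power_mult_distrib s2_def sum_distrib_left)
    finally show "char (distr neuron_law borel (preact 0 x)) t = iexp (t * 0) * of_real (exp (- (t * sqrt s2)\<^sup>2 / 2))"
      by simp
  qed
  \<comment> \<open>The law has a Lebesgue density, so Lebesgue null sets remain null.\<close>
  have "AE z in density lborel (normal_density 0 (sqrt s2)). P z"
    using P by (subst AE_density) auto
  then have "AE z in distr neuron_law borel (preact 0 x). P z" unfolding D .
  then show ?thesis by (rule AE_distrD[OF m])
qed

lemma init_B2_moment:
  shows "(\<integral>\<theta>. (\<theta> B2) ^ m \<partial>(init h :: ('d::finite param \<Rightarrow> real) measure)) = (\<integral>x. x ^ m \<partial>std_normal_distribution)"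
    and "integrable (init h :: ('d param \<Rightarrow> real) measure) (\<lambda>\<theta>. (\<theta> B2) ^ m)"
proof -
  let ?M = "init h :: ('d param \<Rightarrow> real) measure"
  have c: "(\<lambda>\<theta>. \<theta> B2) \<in> ?M \<rightarrow>\<^sub>M std_normal_distribution"
    using measurable_init_component[of B2 h] by (simp add: params_def)
  have d: "distr ?M std_normal_distribution (\<lambda>\<theta>. \<theta> B2) = std_normal_distribution"
    by (rule distr_init_B2)
  show "(\<integral>\<theta>. (\<theta> B2) ^ m \<partial>?M) = (\<integral>x. x ^ m \<partial>std_normal_distribution)"
    by (subst d[symmetric], subst integral_distr[OF c]) auto
  show "integrable ?M (\<lambda>\<theta>. (\<theta> B2) ^ m)"
    using integrable_std_normal_distribution_moment[of m]
    by (subst (asm) d[symmetric], subst (asm) integrable_distr_eq[OF c]) auto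
qed

lemma W2_moment: 
  "integrable neuron_law (\<lambda>\<eta>. (\<eta> (W2 0)) ^ m)"
  "(\<integral>\<eta>. (\<eta> (W2 0)) ^ m \<partial>neuron_law) = (\<integral>t. t ^ m \<partial>std_normal_distribution)"
proof -
  have c: "(\<lambda>\<eta>. \<eta> (W2 0)) \<in> neuron_law \<rightarrow>\<^sub>M std_normal_distribution" by simp
  have d: "distr neuron_law std_normal_distribution (\<lambda>\<eta>. \<eta> (W2 0)) = std_normal_distribution"
    unfolding neuron_law_def by (rule distr_PiM_component) (auto simp: neuron_params_def intro: prob_space_std_normal)
  show "(\<integral>\<eta>. (\<eta> (W2 0)) ^ m \<partial>neuron_law) = (\<integral>t. t ^ m \<partial>std_normal_distribution)"
    by (subst d[symmetric], subst integral_distr[OF c]) auto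
  show "integrable neuron_law (\<lambda>\<eta>. (\<eta> (W2 0)) ^ m)"
    using integrable_std_normal_distribution_moment[of m]
    by (subst (asm) d[symmetric], subst (asm) integrable_distr_eq[OF c]) auto
qed

text \<open>The vector \<open>e\<close> carries the output bias: it is \<open>0\<close> for the kernel and \<open>(1, \<dots>, 1)\<close> for the
  network.\<close>

definition neuron_sum ::
  "(('d param \<Rightarrow> real) \<Rightarrow> real ^ 'n) \<Rightarrow> real ^ 'n \<Rightarrow> nat \<Rightarrow> ('d param \<Rightarrow> real) \<Rightarrow> real ^ 'n" where
  "neuron_sum u e h \<theta> = (1 / sqrt (real h)) *\<^sub>R (\<Sum>i<h. u (neuron i \<theta>)) + \<theta> B2 *\<^sub>R e"

text \<open>With the factor \<open>1 / sqrt h\<close>, the \<open>h\<close> equal contributions to a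
  second moment add up to exactly one of them, while the unscaled bias adds the products of the
  entries of \<open>e\<close>: no width enters. By independence the characteristic function is an
  \<open>h\<close>-th power times the exact Gaussian factor of the bias.\<close>

lemma
  fixes u :: "('d::finite param \<Rightarrow> real) \<Rightarrow> real ^ 'n" and e :: "real ^ 'n"
  assumes u: "u \<in> borel_measurable neuron_law"
    and sq: "\<And>a. integrable neuron_law (\<lambda>\<eta>. (u \<eta> $ a)\<^sup>2)"
    and mean: "\<And>a. (\<integral>\<eta>. u \<eta> $ a \<partial>neuron_law) = 0" and h: "0 < h"
  shows neuron_sum_measurable: "neuron_sum u e h \<in> borel_measurable (init h)"
    and neuron_sum_square_integrable: "integrable (init h) (\<lambda>\<theta>. (neuron_sum u e h \<theta> $ a)\<^sup>2)"
    and neuron_sum_mean: "(\<integral>\<theta>. neuron_sum u e h \<theta> $ a \<partial>init h) = 0"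
    and neuron_sum_second_moment: "(\<integral>\<theta>. neuron_sum u e h \<theta> $ a * neuron_sum u e h \<theta> $ b \<partial>init h)
      = (\<integral>\<eta>. u \<eta> $ a * u \<eta> $ b \<partial>neuron_law) + e $ a * e $ b"
    and neuron_sum_cf: "(CLINT \<theta>|init h. iexp (y \<bullet> neuron_sum u e h \<theta>))
      = (CLINT \<eta>|neuron_law. iexp (y \<bullet> u \<eta> / sqrt (real h))) ^ h * of_real (exp (- (y \<bullet> e)\<^sup>2 / 2))"
proof -
  let ?M = "init h :: ('d param \<Rightarrow> real) measure"
  interpret prob_space ?M by (rule prob_space_init)
  note [measurable] = u
  \<comment> \<open>Index \<open>h\<close> carries the bias, so that one independent family sums to
    the whole vector.\<close>
  define V where "V j \<theta> = (if j < h then (1 / sqrt (real h)) *\<^sub>R u (neuron j \<theta>) else \<theta> B2 *\<^sub>R e)" for j \<theta>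
  have S: "neuron_sum u e h \<theta> = (\<Sum>j\<in>{..h}. V j \<theta>)" for \<theta>
    by (simp add: neuron_sum_def V_def lessThan_Suc_atMost[symmetric] scaleR_sum_right)
  have ind: "indep_vars (\<lambda>_. borel) V {..h}"
    unfolding V_def
    by (rule indep_neurons[where u="\<lambda>_ \<eta>. (1 / sqrt (real h)) *\<^sub>R u \<eta>" and w="\<lambda>t. t *\<^sub>R e"]) measurable
  have Vm: "V j \<in> borel_measurable ?M" if "j \<le> h" for j
    using ind that by (auto simp: indep_vars_def)
  have uc[measurable]: "(\<lambda>\<eta>. u \<eta> $ a) \<in> borel_measurable neuron_law" for a by measurable
  have Vlt: "V j \<theta> $ a = 1 / sqrt (real h) * u (neuron j \<theta>) $ a" if "j < h" for j \<theta> a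
    using that by (simp add: V_def)
  have Vh: "V h \<theta> $ a = \<theta> B2 * e $ a" for \<theta> a by (simp add: V_def)
  have sqV: "integrable ?M (\<lambda>\<theta>. (V j \<theta> $ a)\<^sup>2)" if "j \<in> {..h}" for j a
  proof (cases "j < h")
    case True
    have "integrable ?M (\<lambda>\<theta>. (u (neuron j \<theta>) $ a)\<^sup>2)"
      using integrable_neuron[OF True, of "\<lambda>\<eta>. (u \<eta> $ a)\<^sup>2"] sq by simp
    then show ?thesis unfolding Vlt[OF True] power_mult_distrib by (rule integrable_mult_right)
  next
    case False
    then have "j = h" using that by simp
    then show ?thesis using init_B2_moment(2)[of h 2, where 'd='d] by (simp add: Vh power_mult_distrib)
  qed
  have iu: "integrable neuron_law (\<lambda>\<eta>. u \<eta> $ a)" for a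
    by (rule finite_measure.square_integrable_imp_integrable[OF prob_space.finite_measure[OF prob_space_neuron_law] _ sq]) measurable
  have B2mean: "(\<integral>\<theta>. \<theta> B2 \<partial>?M) = 0"
    using init_B2_moment(1)[of h 1, where 'd='d] integral_std_normal_distribution_moment_odd[of 1] by simp
  have meanV: "expectation (\<lambda>\<theta>. V j \<theta> $ a) = 0" if "j \<in> {..h}" for j a
  proof (cases "j < h")
    case True
    show ?thesis unfolding Vlt[OF True] using integral_neuron[OF True uc[of a]] mean by simp
  next
    case False
    then have "j = h" using that by simp
    then show ?thesis using B2mean by (simp add: Vh)
  qed
  have Va: "(\<lambda>\<theta>. V j \<theta> $ a) \<in> borel_measurable ?M" if "j \<in> {..h}" for j a
  proof -
    have [measurable]: "V j \<in> borel_measurable ?M" using Vm that by simp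
    show ?thesis by measurable
  qed
  show meas: "neuron_sum u e h \<in> borel_measurable ?M"
    unfolding S by (rule borel_measurable_sum) (use Vm in simp)
  show "integrable ?M (\<lambda>\<theta>. (neuron_sum u e h \<theta> $ a)\<^sup>2)"
    unfolding S sum_component by (rule square_integrable_sum[OF finite_atMost Va sqV])
  have iV: "integrable ?M (\<lambda>\<theta>. V j \<theta> $ a)" if "j \<in> {..h}" for j a
    by (rule square_integrable_imp_integrable[OF Va[OF that] sqV[OF that]])
  have "(\<integral>\<theta>. neuron_sum u e h \<theta> $ a \<partial>?M) = (\<Sum>j\<le>h. expectation (\<lambda>\<theta>. V j \<theta> $ a))"
    unfolding S sum_component by (rule Bochner_Integration.integral_sum) (rule iV)
  then show "(\<integral>\<theta>. neuron_sum u e h \<theta> $ a \<partial>?M) = 0" using meanV by simp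
  have "(\<integral>\<theta>. neuron_sum u e h \<theta> $ a * neuron_sum u e h \<theta> $ b \<partial>?M) = (\<Sum>j\<in>{..h}. expectation (\<lambda>\<theta>. V j \<theta> $ a * V j \<theta> $ b))"
    unfolding S by (rule indep_vec_sum_second_moment[OF ind finite_atMost sqV meanV])
  also have "\<dots> = (\<Sum>j<h. expectation (\<lambda>\<theta>. V j \<theta> $ a * V j \<theta> $ b)) + expectation (\<lambda>\<theta>. V h \<theta> $ a * V h \<theta> $ b)"
    by (simp add: lessThan_Suc_atMost[symmetric])
  also have "expectation (\<lambda>\<theta>. V h \<theta> $ a * V h \<theta> $ b) = (\<integral>\<theta>. (e $ a * e $ b) * (\<theta> B2)\<^sup>2 \<partial>?M)"
    by (intro Bochner_Integration.integral_cong refl) (simp add: Vh power2_eq_square)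
  also have "\<dots> = e $ a * e $ b"
    using init_B2_moment(1)[of h 2, where 'd='d] std_normal_distribution_even_moments(1)[of 1] by simp
  also have "(\<Sum>j<h. expectation (\<lambda>\<theta>. V j \<theta> $ a * V j \<theta> $ b)) = (\<Sum>j<h. (\<integral>\<eta>. u \<eta> $ a * u \<eta> $ b \<partial>neuron_law) / real h)"
  proof (rule sum.cong[OF refl])
    fix j assume "j \<in> {..<h}"
    then have j: "j < h" by simp
    have "expectation (\<lambda>\<theta>. V j \<theta> $ a * V j \<theta> $ b) = (\<integral>\<theta>. 1 / real h * (u (neuron j \<theta>) $ a * u (neuron j \<theta>) $ b) \<partial>?M)"
      by (intro Bochner_Integration.integral_cong refl) (simp add: Vlt[OF j])
    also have "\<dots> = 1 / real h * (\<integral>\<eta>. u \<eta> $ a * u \<eta> $ b \<partial>neuron_law)"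
      using integral_neuron[OF j, of "\<lambda>\<eta>. u \<eta> $ a * u \<eta> $ b"] by simp
    finally show "expectation (\<lambda>\<theta>. V j \<theta> $ a * V j \<theta> $ b) = (\<integral>\<eta>. u \<eta> $ a * u \<eta> $ b \<partial>neuron_law) / real h" by simp
  qed
  also have "\<dots> = (\<integral>\<eta>. u \<eta> $ a * u \<eta> $ b \<partial>neuron_law)" using h by simp
  finally show "(\<integral>\<theta>. neuron_sum u e h \<theta> $ a * neuron_sum u e h \<theta> $ b \<partial>?M)
      = (\<integral>\<eta>. u \<eta> $ a * u \<eta> $ b \<partial>neuron_law) + e $ a * e $ b" .
  have indy: "indep_vars (\<lambda>_. borel) (\<lambda>j \<theta>. y \<bullet> V j \<theta>) {..h}"
    by (rule indep_vars_compose2[OF ind]) measurable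
  have ym: "(\<lambda>\<theta>. y \<bullet> V j \<theta>) \<in> borel_measurable ?M" if "j \<le> h" for j
    using Vm[OF that] by measurable
  have ch: "char (distr ?M borel (\<lambda>\<theta>. y \<bullet> V j \<theta>)) 1 = (CLINT \<theta>|?M. iexp (y \<bullet> V j \<theta>))" if "j \<le> h" for j
    unfolding char_def using ym[OF that] by (subst integral_distr) auto
  have "(CLINT \<theta>|?M. iexp (y \<bullet> neuron_sum u e h \<theta>)) = char (distr ?M borel (\<lambda>\<theta>. \<Sum>j\<in>{..h}. y \<bullet> V j \<theta>)) 1"
    unfolding char_def using ym by (subst integral_distr) (auto simp: S inner_sum_right)
  also have "\<dots> = (\<Prod>j\<in>{..h}. char (distr ?M borel (\<lambda>\<theta>. y \<bullet> V j \<theta>)) 1)"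
    by (rule char_distr_sum[OF indy])
  also have "\<dots> = (\<Prod>j<h. CLINT \<theta>|?M. iexp (y \<bullet> V j \<theta>)) * (CLINT \<theta>|?M. iexp (y \<bullet> V h \<theta>))"
    by (simp add: lessThan_Suc_atMost[symmetric] ch)
  also have "(\<Prod>j<h. CLINT \<theta>|?M. iexp (y \<bullet> V j \<theta>)) = (\<Prod>j<h. CLINT \<eta>|neuron_law. iexp (y \<bullet> u \<eta> / sqrt (real h)))"
  proof (rule prod.cong[OF refl])
    fix j assume "j \<in> {..<h}"
    then have j: "j < h" by simp
    have "(CLINT \<theta>|?M. iexp (y \<bullet> V j \<theta>)) = (CLINT \<theta>|?M. iexp (y \<bullet> u (neuron j \<theta>) / sqrt (real h)))"
      using j by (simp add: V_def)
    also have "\<dots> = (CLINT \<eta>|neuron_law. iexp (y \<bullet> u \<eta> / sqrt (real h)))"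
      by (rule integral_neuron[OF j]) measurable
    finally show "(CLINT \<theta>|?M. iexp (y \<bullet> V j \<theta>)) = (CLINT \<eta>|neuron_law. iexp (y \<bullet> u \<eta> / sqrt (real h)))" .
  qed
  also have "(CLINT \<theta>|?M. iexp (y \<bullet> V h \<theta>)) = of_real (exp (- (y \<bullet> e)\<^sup>2 / 2))"
  proof -
    have c: "(\<lambda>\<theta>. \<theta> B2) \<in> ?M \<rightarrow>\<^sub>M std_normal_distribution"
      using measurable_init_component[of B2 h] by (simp add: params_def)
    have "(CLINT \<theta>|?M. iexp (y \<bullet> V h \<theta>)) = (CLINT \<theta>|?M. iexp ((y \<bullet> e) * \<theta> B2))"
      by (simp add: V_def mult.commute)
    also have "\<dots> = (CLINT t|distr ?M std_normal_distribution (\<lambda>\<theta>. \<theta> B2). iexp ((y \<bullet> e) * t))"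
      by (subst integral_distr[OF c]) auto
    also have "\<dots> = char std_normal_distribution (y \<bullet> e)"
      unfolding distr_init_B2 char_def ..
    finally show ?thesis by (simp add: char_std_normal_distribution)
  qed
  finally show "(CLINT \<theta>|?M. iexp (y \<bullet> neuron_sum u e h \<theta>))
      = (CLINT \<eta>|neuron_law. iexp (y \<bullet> u \<eta> / sqrt (real h))) ^ h * of_real (exp (- (y \<bullet> e)\<^sup>2 / 2))"
    by simp
qed

section \<open>The kernel as an average over neurons\<close>

lemma neuron_ntk_measurable:
  assumes [measurable]: "\<phi> \<in> borel_measurable borel"
  shows "neuron_ntk \<phi> a b 0 \<in> borel_measurable neuron_law"
  unfolding neuron_ntk_def preact_def by measurable

text \<open>The kernel formula fails only if some preactivation hits a point where \<phi> is not
  differentiable, a finite union of null events. The 1 due to the output bias is spread evenly over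
  the neurons, which leaves a plain average.\<close>

lemma AE_ntk_eq_sum_neurons:
  fixes a b :: "real ^ 'd"
  assumes d: "AE z in lborel. \<phi> differentiable (at z)" and h: "0 < h"
  shows "AE \<theta> in init h. ntk \<phi> h a b \<theta> = (\<Sum>i<h. 1 + neuron_ntk \<phi> a b 0 (neuron i \<theta>)) / real h"
proof -
  have 1: "AE \<theta> in init h. \<forall>i\<in>{..<h}. \<phi> differentiable at (preact i c \<theta>)" for c :: "real ^ 'd"
  proof (rule AE_ball_countable[THEN iffD2], simp, rule ballI)
    fix i assume "i \<in> {..<h}"
    then have "i < h" by simp
    from AE_neuron[OF this AE_preact[OF d, of c]]
    show "AE \<theta> in init h. \<phi> differentiable at (preact i c \<theta>)" by simp
  qed
  from 1[of a] 1[of b] show ?thesis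
  proof eventually_elim
    case (elim \<theta>)
    then have "ntk \<phi> h a b \<theta> = 1 + (\<Sum>i<h. neuron_ntk \<phi> a b i \<theta>) / real h"
      by (intro ntk_eq_sum_neurons h) auto
    then show ?case using h by (simp add: sum.distrib add_divide_distrib)
  qed
qed

text \<open>At width 1 the average has a single term, so the moment hypothesis at
  \<open>h = 1\<close> is a statement about one neuron, and this serves all widths.\<close>

lemma neuron_ntk_square_integrable:
  fixes a b :: "real ^ 'd"
  assumes m: "\<phi> \<in> borel_measurable borel" and d: "AE z in lborel. \<phi> differentiable (at z)"
    and sm: "has_second_moment (init 1) (ntk \<phi> 1 a b)"
  shows "integrable neuron_law (\<lambda>\<eta>. (1 + neuron_ntk \<phi> a b 0 \<eta>)\<^sup>2)"
proof -
  note [measurable] = neuron_ntk_measurable[OF m]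
  have meas: "(\<lambda>\<theta>. (1 + neuron_ntk \<phi> a b 0 (neuron 0 \<theta>))\<^sup>2) \<in> borel_measurable (init 1)"
    by (rule measurable_compose[OF distr_neuron(1)]) (simp, measurable)
  have "integrable (init 1) (\<lambda>\<theta>. (1 + neuron_ntk \<phi> a b 0 (neuron 0 \<theta>))\<^sup>2)"
  proof (rule integrable_cong_AE_imp)
    show "integrable (init 1) (\<lambda>\<theta>. (ntk \<phi> 1 a b \<theta>)\<^sup>2)" using sm by (simp add: has_second_moment_def)
    show "AE \<theta> in init 1. (ntk \<phi> 1 a b \<theta>)\<^sup>2 = (1 + neuron_ntk \<phi> a b 0 (neuron 0 \<theta>))\<^sup>2"
      using AE_ntk_eq_sum_neurons[OF d zero_less_one, of a b] by eventually_elim simp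
  qed (rule meas)
  then show ?thesis
    by (subst (asm) integrable_neuron[of 0 1 "\<lambda>\<eta>. (1 + neuron_ntk \<phi> a b 0 \<eta>)\<^sup>2"]) auto
qed

text \<open>An average of identically distributed terms has the mean of one term, so the mean kernel
  is the same at every positive width. Measurability of \<open>ntk\<close> is assumed because an
  almost sure identity does not provide it.\<close>

lemma mean_ntk_eq:
  fixes a b :: "real ^ 'd"
  assumes m: "\<phi> \<in> borel_measurable borel" and d: "AE z in lborel. \<phi> differentiable (at z)"
    and i: "integrable neuron_law (\<lambda>\<eta>. 1 + neuron_ntk \<phi> a b 0 \<eta>)"
    and ntk: "ntk \<phi> h a b \<in> borel_measurable (init h)" and h: "0 < h"
  shows "mean_ntk \<phi> h a b = (\<integral>\<eta>. 1 + neuron_ntk \<phi> a b 0 \<eta> \<partial>neuron_law)"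
proof -
  let ?g = "\<lambda>\<eta>. 1 + neuron_ntk \<phi> a b 0 \<eta>"
  have g: "?g \<in> borel_measurable neuron_law" using neuron_ntk_measurable[OF m, of a b] by measurable
  have gi: "integrable (init h) (\<lambda>\<theta>. ?g (neuron k \<theta>))" if "k \<in> {..<h}" for k
    using that integrable_neuron[of k h ?g] i g by simp
  have "mean_ntk \<phi> h a b = (\<integral>\<theta>. (\<Sum>k<h. ?g (neuron k \<theta>)) / real h \<partial>init h)"
    unfolding mean_ntk_def
  proof (rule integral_cong_AE[OF ntk])
    have "(\<lambda>\<theta>. ?g (neuron k \<theta>)) \<in> borel_measurable (init h)" if "k \<in> {..<h}" for k
      using gi[OF that] by (rule borel_measurable_integrable)
    then have "(\<lambda>\<theta>. \<Sum>k<h. ?g (neuron k \<theta>)) \<in> borel_measurable (init h)"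
      by (rule borel_measurable_sum)
    then show "(\<lambda>\<theta>. (\<Sum>k<h. ?g (neuron k \<theta>)) / real h) \<in> borel_measurable (init h)"
      by measurable
  qed (rule AE_ntk_eq_sum_neurons[OF d h])
  also have "\<dots> = (\<Sum>k<h. \<integral>\<theta>. ?g (neuron k \<theta>) \<partial>init h) / real h"
    by (simp only: integral_divide_zero Bochner_Integration.integral_sum[OF gi])
  also have "\<dots> = (\<Sum>k<h. \<integral>\<eta>. ?g \<eta> \<partial>neuron_law) / real h"
    using integral_neuron[OF _ g] by (intro arg_cong2[where f="(/)"] sum.cong refl) simp
  finally show ?thesis using h by simp
qed

section \<open>The limit law\<close>

lemma (in prob_space) inner_square_expand:
  fixes v :: "'a \<Rightarrow> real ^ 'n"
  assumes [measurable]: "v \<in> borel_measurable M"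
    and sq: "\<And>a. integrable M (\<lambda>\<omega>. (v \<omega> $ a)\<^sup>2)"
  shows "expectation (\<lambda>\<omega>. (y \<bullet> v \<omega>)\<^sup>2) = (\<Sum>a\<in>UNIV. \<Sum>b\<in>UNIV. y $ a * y $ b * expectation (\<lambda>\<omega>. v \<omega> $ a * v \<omega> $ b))"
    and "integrable M (\<lambda>\<omega>. (y \<bullet> v \<omega>)\<^sup>2)"
    and "integrable M (\<lambda>\<omega>. (norm (v \<omega>))\<^sup>2)"
    and "expectation (\<lambda>\<omega>. (norm (v \<omega>))\<^sup>2) = (\<Sum>a\<in>UNIV. expectation (\<lambda>\<omega>. v \<omega> $ a * v \<omega> $ a))"
    and "expectation (\<lambda>\<omega>. y \<bullet> v \<omega>) = (\<Sum>a\<in>UNIV. y $ a * expectation (\<lambda>\<omega>. v \<omega> $ a))"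
proof -
  have int: "integrable M (\<lambda>\<omega>. v \<omega> $ a * v \<omega> $ b)" for a b
    by (rule integrable_mult_of_squares[OF _ _ sq sq]) measurable
  have int1: "integrable M (\<lambda>\<omega>. v \<omega> $ a)" for a
    by (rule square_integrable_imp_integrable[OF _ sq]) measurable
  have eq: "(y \<bullet> v \<omega>)\<^sup>2 = (\<Sum>a\<in>UNIV. \<Sum>b\<in>UNIV. y $ a * y $ b * (v \<omega> $ a * v \<omega> $ b))" for \<omega>
    unfolding inner_vec_def power2_eq_square sum_product by (simp add: mult_ac)
  have eqn: "(norm (v \<omega>))\<^sup>2 = (\<Sum>a\<in>UNIV. v \<omega> $ a * v \<omega> $ a)" for \<omega>
    unfolding power2_norm_eq_inner inner_vec_def by simp
  show "expectation (\<lambda>\<omega>. (y \<bullet> v \<omega>)\<^sup>2) = (\<Sum>a\<in>UNIV. \<Sum>b\<in>UNIV. y $ a * y $ b * expectation (\<lambda>\<omega>. v \<omega> $ a * v \<omega> $ b))"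
    "integrable M (\<lambda>\<omega>. (y \<bullet> v \<omega>)\<^sup>2)"
    unfolding eq using int by simp_all
  show "integrable M (\<lambda>\<omega>. (norm (v \<omega>))\<^sup>2)"
    "expectation (\<lambda>\<omega>. (norm (v \<omega>))\<^sup>2) = (\<Sum>a\<in>UNIV. expectation (\<lambda>\<omega>. v \<omega> $ a * v \<omega> $ a))"
    unfolding eqn using int by simp_all
  show "expectation (\<lambda>\<omega>. y \<bullet> v \<omega>) = (\<Sum>a\<in>UNIV. y $ a * expectation (\<lambda>\<omega>. v \<omega> $ a))"
    unfolding inner_vec_def using int1 by simp
qed

text \<open>The left-hand side has the shape of \<open>V_c\<close> and \<open>V_i\<close>. It is the
  variance of the difference, and as the means agree this is a second moment.\<close>

lemma (in prob_space) variance_diff_eq: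
  assumes [measurable]: "A \<in> borel_measurable M" "B \<in> borel_measurable M"
    and sq: "integrable M (\<lambda>\<omega>. (A \<omega>)\<^sup>2)" "integrable M (\<lambda>\<omega>. (B \<omega>)\<^sup>2)"
    and mean: "expectation (\<lambda>\<omega>. A \<omega> - B \<omega>) = 0"
  shows "variance A + variance B - 2 * covariance M B A = expectation (\<lambda>\<omega>. (A \<omega> - B \<omega>)\<^sup>2)"
proof -
  have i: "integrable M A" "integrable M B"
    by (rule square_integrable_imp_integrable[OF _ sq(1)], measurable)
       (rule square_integrable_imp_integrable[OF _ sq(2)], measurable)
  define \<alpha> where "\<alpha> = expectation A"
  have \<alpha>: "expectation B = \<alpha>" using mean i by (simp add: \<alpha>_def)
  have sqc: "integrable M (\<lambda>\<omega>. (A \<omega> - \<alpha>)\<^sup>2)" "integrable M (\<lambda>\<omega>. (B \<omega> - \<alpha>)\<^sup>2)"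
    using sq i by (auto simp: power2_diff)
  have p: "integrable M (\<lambda>\<omega>. (B \<omega> - \<alpha>) * (A \<omega> - \<alpha>))"
    by (rule integrable_mult_of_squares[OF _ _ sqc(2,1)]) measurable
  have "(A \<omega> - B \<omega>)\<^sup>2 = (A \<omega> - \<alpha>)\<^sup>2 + (B \<omega> - \<alpha>)\<^sup>2 - 2 * ((B \<omega> - \<alpha>) * (A \<omega> - \<alpha>))" for \<omega>
    by (simp add: power2_eq_square algebra_simps)
  then show ?thesis
    using sqc p by (simp add: covariance_def \<alpha> \<alpha>_def[symmetric])
qed

lemma (in pair_prob_space)
  fixes f :: "'a \<Rightarrow> real" and g :: "'b \<Rightarrow> real"
  shows integrable_fst_only: "integrable M1 f \<Longrightarrow> integrable (M1 \<Otimes>\<^sub>M M2) (\<lambda>p. f (fst p))"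
    and integral_fst_only: "integrable M1 f \<Longrightarrow> (\<integral>p. f (fst p) \<partial>(M1 \<Otimes>\<^sub>M M2)) = integral\<^sup>L M1 f"
    and integrable_snd_only: "integrable M2 g \<Longrightarrow> integrable (M1 \<Otimes>\<^sub>M M2) (\<lambda>p. g (snd p))"
    and integral_snd_only: "integrable M2 g \<Longrightarrow> (\<integral>p. g (snd p) \<partial>(M1 \<Otimes>\<^sub>M M2)) = integral\<^sup>L M2 g"
  using integrable_fst_mult_snd[of f "\<lambda>_. 1"] integral_fst_mult_snd[of f "\<lambda>_. 1"]
    integrable_fst_mult_snd[of "\<lambda>_. 1" g] integral_fst_mult_snd[of "\<lambda>_. 1" g]
  by (simp_all add: split_beta' M1.prob_space M2.prob_space)

lemma (in prob_space) shifted_second_moment: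
  fixes f :: "'a \<Rightarrow> real ^ 'n"
  assumes [measurable]: "f \<in> borel_measurable M"
    and sq: "\<And>a. integrable M (\<lambda>\<omega>. (f \<omega> $ a)\<^sup>2)" and mean: "\<And>a. expectation (\<lambda>\<omega>. f \<omega> $ a) = 0"
  shows "integrable M (\<lambda>\<omega>. ((Y - f \<omega>) $ a)\<^sup>2)"
    and "expectation (\<lambda>\<omega>. (Y - f \<omega>) $ a * (Y - f \<omega>) $ b) = Y $ a * Y $ b + expectation (\<lambda>\<omega>. f \<omega> $ a * f \<omega> $ b)"
proof -
  have int: "integrable M (\<lambda>\<omega>. f \<omega> $ a * f \<omega> $ b)" for a b
    by (rule integrable_mult_of_squares[OF _ _ sq sq]) measurable
  have int1: "integrable M (\<lambda>\<omega>. f \<omega> $ a)" for a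
    by (rule square_integrable_imp_integrable[OF _ sq]) measurable
  show "integrable M (\<lambda>\<omega>. ((Y - f \<omega>) $ a)\<^sup>2)"
    using sq[of a] int1[of a] by (simp add: power2_diff)
  have "(Y - f \<omega>) $ a * (Y - f \<omega>) $ b = Y $ a * Y $ b - Y $ a * f \<omega> $ b - Y $ b * f \<omega> $ a + f \<omega> $ a * f \<omega> $ b" for \<omega>
    by (simp add: algebra_simps)
  then show "expectation (\<lambda>\<omega>. (Y - f \<omega>) $ a * (Y - f \<omega>) $ b) = Y $ a * Y $ b + expectation (\<lambda>\<omega>. f \<omega> $ a * f \<omega> $ b)"
    using int[of a b] int1 by (simp add: mean prob_space)
qed

lemma cf_shifted:
  "(CLINT \<omega>|M. iexp (y \<bullet> (Y - f \<omega>))) = iexp (y \<bullet> Y) * (CLINT \<omega>|M. iexp ((- y) \<bullet> f \<omega>))"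
proof -
  have "iexp (y \<bullet> (Y - f \<omega>)) = iexp (y \<bullet> Y) * iexp ((- y) \<bullet> f \<omega>)" for \<omega>
    by (simp add: exp_add[symmetric] inner_diff_right algebra_simps)
  then show ?thesis by simp
qed

section \<open>The linearized residual\<close>

text \<open>With the mean ratio as \<open>q\<close> and the inverse mean kernel as \<open>J\<close>,
  this is the first-order fluctuation of \<open>Q\<close>. It is linear in the pair
  \<open>r\<close>, \<open>M\<close>, so it commutes with sums over neurons.\<close>

definition residual_map :: "real ^ 'n \<Rightarrow> real ^ 'n ^ 'n \<Rightarrow> real ^ 'n \<Rightarrow> real ^ 'n ^ 'n \<Rightarrow> real ^ 'n" where
  "residual_map q J r M = (r - q v* M) v* J"

lemma residual_map_linear: "linear (\<lambda>p. residual_map q J (fst p) (snd p))"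
  by (rule linearI)
     (simp_all add: residual_map_def vec_eq_iff vector_matrix_mult_def sum.distrib sum_subtractf sum_distrib_left algebra_simps)

lemma residual_map_sum:
  "residual_map q J (c *\<^sub>R (\<Sum>i\<in>I. r i)) (c *\<^sub>R (\<Sum>i\<in>I. M i)) = c *\<^sub>R (\<Sum>i\<in>I. residual_map q J (r i) (M i))"
proof -
  have "residual_map q J (fst (c *\<^sub>R (\<Sum>i\<in>I. (r i, M i)))) (snd (c *\<^sub>R (\<Sum>i\<in>I. (r i, M i))))
      = c *\<^sub>R (\<Sum>i\<in>I. residual_map q J (fst (r i, M i)) (snd (r i, M i)))"
    using linear_scale[OF residual_map_linear, of q J c "\<Sum>i\<in>I. (r i, M i)"] linear_sum[OF residual_map_linear, of q J "\<lambda>i. (r i, M i)" I]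
    by simp
  then show ?thesis by (simp add: fst_sum snd_sum)
qed

lemma residual_map_nth:
  "residual_map q J r M $ b = (\<Sum>j\<in>UNIV. J $ j $ b * (r $ j - (\<Sum>i\<in>UNIV. M $ i $ j * q $ i)))"
  by (simp add: residual_map_def vector_matrix_mult_def mult_ac)

text \<open>The adjoint form, in which the random variables of \<open>V_c\<close> and
  \<open>V_i\<close> are written.\<close>

lemma residual_map_inner:
  "residual_map q J r M \<bullet> y = r \<bullet> (J *v y) - q \<bullet> (M *v (J *v y))"
  by (simp add: residual_map_def dot_lmul_matrix inner_diff_left)

lemma square_integrable_residual_map:
  assumes "\<And>j. (\<lambda>\<omega>. r \<omega> $ j) \<in> borel_measurable M" "\<And>i j. (\<lambda>\<omega>. A \<omega> $ i $ j) \<in> borel_measurable M"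
    and "\<And>j. integrable M (\<lambda>\<omega>. (r \<omega> $ j)\<^sup>2)" "\<And>i j. integrable M (\<lambda>\<omega>. (A \<omega> $ i $ j)\<^sup>2)"
  shows "integrable M (\<lambda>\<omega>. (residual_map q' J' (r \<omega>) (A \<omega>) $ b)\<^sup>2)"
proof -
  note [measurable] = assms(1,2)
  have sum: "integrable M (\<lambda>\<omega>. (\<Sum>i\<in>UNIV. A \<omega> $ i $ j * q' $ i)\<^sup>2)" for j
    by (rule square_integrable_sum) (auto simp: power_mult_distrib assms)
  have diff: "integrable M (\<lambda>\<omega>. (r \<omega> $ j - (\<Sum>i\<in>UNIV. A \<omega> $ i $ j * q' $ i))\<^sup>2)" for j
  proof -
    have "integrable M (\<lambda>\<omega>. r \<omega> $ j * (\<Sum>i\<in>UNIV. A \<omega> $ i $ j * q' $ i))"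
      by (rule integrable_mult_of_squares[OF _ _ assms(3) sum]) measurable
    then show ?thesis using assms(3)[of j] sum[of j] by (simp add: power2_diff mult.assoc)
  qed
  show ?thesis unfolding residual_map_nth
    by (rule square_integrable_sum) (use diff in \<open>auto simp: power_mult_distrib\<close>)
qed

text \<open>Bounding each product by a sum of squares gives a majorant whose mean consists of second
  moments of \<open>r\<close> and of \<open>w\<close> separately.\<close>

lemma inner_matrix_le:
  fixes r w :: "real ^ 'm" and E :: "real ^ 'm ^ 'm"
  assumes E: "\<And>i j. \<bar>E $ i $ j\<bar> \<le> \<eta>"
  shows "\<bar>r \<bullet> (E *v w)\<bar> \<le> \<eta> * (\<Sum>a\<in>UNIV. \<Sum>b\<in>UNIV. (r $ a)\<^sup>2 + (w $ b)\<^sup>2)"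
proof -
  \<comment> \<open>Index types are nonempty, so any entry of \<open>E\<close> will do.\<close>
  have "0 \<le> \<eta>" using E[of undefined undefined] by linarith
  have "\<bar>r \<bullet> (E *v w)\<bar> = \<bar>\<Sum>a\<in>UNIV. \<Sum>b\<in>UNIV. r $ a * (E $ a $ b * w $ b)\<bar>"
    by (simp add: inner_vec_def matrix_vector_mult_def sum_distrib_left)
  also have "\<dots> \<le> (\<Sum>a\<in>UNIV. \<Sum>b\<in>UNIV. \<eta> * ((r $ a)\<^sup>2 + (w $ b)\<^sup>2))"
  proof (intro order_trans[OF sum_abs] sum_mono)
    fix a b
    have "\<bar>r $ a * (E $ a $ b * w $ b)\<bar> = \<bar>E $ a $ b\<bar> * (\<bar>r $ a\<bar> * \<bar>w $ b\<bar>)" by (simp add: abs_mult)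
    also have "\<dots> \<le> \<eta> * ((r $ a)\<^sup>2 + (w $ b)\<^sup>2)"
    proof (rule mult_mono[OF E _ \<open>0 \<le> \<eta>\<close>])
      have "0 \<le> \<bar>r $ a\<bar> * \<bar>w $ b\<bar>" by simp
      then show "\<bar>r $ a\<bar> * \<bar>w $ b\<bar> \<le> (r $ a)\<^sup>2 + (w $ b)\<^sup>2"
        using sum_squares_bound[of "\<bar>r $ a\<bar>" "\<bar>w $ b\<bar>"] unfolding power2_abs by linarith
    qed simp
    finally show "\<bar>r $ a * (E $ a $ b * w $ b)\<bar> \<le> \<eta> * ((r $ a)\<^sup>2 + (w $ b)\<^sup>2)" .
  qed
  finally show ?thesis by (simp add: sum_distrib_left)
qed

section \<open>Contributions of one neuron to the residual and to the network\<close>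

locale ntk_regression =
  fixes \<phi> :: "real \<Rightarrow> real" and x :: "real ^ 'd" and X :: "'n::finite \<Rightarrow> real ^ 'd"
  assumes phi: "\<phi> \<in> borel_measurable borel"
    and phi_diff: "AE z in lborel. \<phi> differentiable (at z)"
    and moment_mat: "\<And>h i j. h > 0 \<Longrightarrow> has_second_moment (init h) (ntk \<phi> h (X i) (X j))"
    and moment_row: "\<And>h j. h > 0 \<Longrightarrow> has_second_moment (init h) (ntk \<phi> h x (X j))"
    and invertible_mean: "\<And>h. h > 0 \<Longrightarrow> invertible (mean_ntk_mat \<phi> h X)"
begin

text \<open>Here \<open>Kbar\<close> and \<open>kbar\<close> are the mean kernel on \<open>X \<times> X\<close> and \<open>{x} \<times> X\<close>, \<open>J\<close> is
  the inverse of \<open>Kbar\<close>, \<open>q\<close> is \<^const>\<open>mean_Q\<close>, and \<open>u\<close> and \<open>v\<close> are the contributions of one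
  neuron to \<open>U\<close> and to the network.\<close>

abbreviation ker where "ker a b \<eta> \<equiv> 1 + neuron_ntk \<phi> a b 0 \<eta>"

definition krow :: "('d param \<Rightarrow> real) \<Rightarrow> real ^ 'n" where "krow \<eta> = (\<chi> j. ker x (X j) \<eta>)"
definition kmat :: "('d param \<Rightarrow> real) \<Rightarrow> real ^ 'n ^ 'n" where "kmat \<eta> = (\<chi> i j. ker (X i) (X j) \<eta>)"
definition Kbar :: "real ^ 'n ^ 'n" where "Kbar = (\<chi> i j. \<integral>\<eta>. kmat \<eta> $ i $ j \<partial>neuron_law)"
definition kbar :: "real ^ 'n" where "kbar = (\<chi> j. \<integral>\<eta>. krow \<eta> $ j \<partial>neuron_law)"
definition J :: "real ^ 'n ^ 'n" where "J = matrix_inv Kbar"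
definition q :: "real ^ 'n" where "q = kbar v* J"
definition u :: "('d param \<Rightarrow> real) \<Rightarrow> real ^ 'n" where "u \<eta> = residual_map q J (krow \<eta>) (kmat \<eta>)"
definition v :: "('d param \<Rightarrow> real) \<Rightarrow> real ^ 'n" where
  "v \<eta> = (\<chi> a. sigma_w * (\<eta> (W2 0) * \<phi> (preact 0 (X a) \<eta>)))"
definition U :: "nat \<Rightarrow> ('d param \<Rightarrow> real) \<Rightarrow> real ^ 'n" where
  "U h \<theta> = sqrt (real h) *\<^sub>R residual_map q J (ntk_row \<phi> h x X \<theta>) (ntk_mat \<phi> h X \<theta>)"

lemma ker_measurable[measurable]: "(\<lambda>\<eta>. neuron_ntk \<phi> a b 0 \<eta>) \<in> borel_measurable neuron_law"
  using neuron_ntk_measurable[OF phi, of a b] by simp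

lemma ker_square_integrable:
  "integrable neuron_law (\<lambda>\<eta>. (ker (X i) (X j) \<eta>)\<^sup>2)" "integrable neuron_law (\<lambda>\<eta>. (ker x (X j) \<eta>)\<^sup>2)"
  by (auto intro!: neuron_ntk_square_integrable phi phi_diff moment_mat moment_row)

lemma ker_integrable:
  "integrable neuron_law (ker (X i) (X j))" "integrable neuron_law (ker x (X j))"
  by (rule finite_measure.square_integrable_imp_integrable[OF prob_space.finite_measure[OF prob_space_neuron_law] _ ker_square_integrable(1)], measurable)
     (rule finite_measure.square_integrable_imp_integrable[OF prob_space.finite_measure[OF prob_space_neuron_law] _ ker_square_integrable(2)], measurable)

lemma ntk_measurable:
  assumes "0 < h"
  shows "ntk \<phi> h (X i) (X j) \<in> borel_measurable (init h)" "ntk \<phi> h x (X j) \<in> borel_measurable (init h)"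
  using moment_mat[OF assms] moment_row[OF assms] by (auto simp: has_second_moment_def)

lemma mean_ntk_mat_eq: "0 < h \<Longrightarrow> mean_ntk_mat \<phi> h X = Kbar"
  unfolding mean_ntk_mat_def Kbar_def kmat_def
  by (simp add: vec_eq_iff mean_ntk_eq[OF phi phi_diff ker_integrable(1) ntk_measurable(1)])

lemma mean_ntk_row_eq: "0 < h \<Longrightarrow> mean_ntk_row \<phi> h x X = kbar"
  unfolding mean_ntk_row_def kbar_def krow_def
  by (simp add: vec_eq_iff mean_ntk_eq[OF phi phi_diff ker_integrable(2) ntk_measurable(2)])

lemma invertible_K: "invertible Kbar"
  using invertible_mean[of 1] mean_ntk_mat_eq[of 1] by simp

lemma mean_Q_eq: "0 < h \<Longrightarrow> mean_Q \<phi> h x X = q"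
  by (simp add: mean_Q_def mean_ntk_mat_eq mean_ntk_row_eq q_def J_def)

lemma q_K: "q v* Kbar = kbar"
  unfolding q_def J_def by (simp add: vector_matrix_mul_assoc matrix_inv_mult(2)[OF invertible_K])

lemma krow_kmat_measurable[measurable]:
  "(\<lambda>\<eta>. krow \<eta> $ j) \<in> borel_measurable neuron_law" "(\<lambda>\<eta>. kmat \<eta> $ i $ j) \<in> borel_measurable neuron_law"
  unfolding krow_def kmat_def by simp_all measurable

lemma u_measurable[measurable]: "u \<in> borel_measurable neuron_law"
  by (rule borel_measurable_vecI) (unfold u_def residual_map_nth, measurable)

lemma krow_kmat_square_integrable:
  "integrable neuron_law (\<lambda>\<eta>. (krow \<eta> $ j)\<^sup>2)" "integrable neuron_law (\<lambda>\<eta>. (kmat \<eta> $ i $ j)\<^sup>2)"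
  unfolding krow_def kmat_def using ker_square_integrable by simp_all

lemma krow_kmat_integrable:
  "integrable neuron_law (\<lambda>\<eta>. krow \<eta> $ j)" "integrable neuron_law (\<lambda>\<eta>. kmat \<eta> $ i $ j)"
  unfolding krow_def kmat_def using ker_integrable by simp_all

lemma u_square_integrable: "integrable neuron_law (\<lambda>\<eta>. (u \<eta> $ a)\<^sup>2)"
  unfolding u_def by (rule square_integrable_residual_map) (simp_all add: krow_kmat_square_integrable)

text \<open>By linearity the mean is the residual map at the mean kernel. It vanishes because
  \<open>q\<close> solves \<open>q v* Kbar = kbar\<close>.\<close>

lemma u_mean: "(\<integral>\<eta>. u \<eta> $ a \<partial>neuron_law) = 0"
proof -
  have "(\<integral>\<eta>. u \<eta> $ a \<partial>neuron_law) = (\<Sum>j\<in>UNIV. J $ j $ a * (kbar $ j - (\<Sum>i\<in>UNIV. Kbar $ i $ j * q $ i)))"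
    unfolding u_def residual_map_nth using krow_kmat_integrable by (simp add: kbar_def Kbar_def)
  also have "\<dots> = residual_map q J kbar Kbar $ a" by (simp add: residual_map_nth)
  also have "\<dots> = 0" by (simp add: residual_map_def q_K)
  finally show ?thesis .
qed

lemma v_measurable[measurable]: "v \<in> borel_measurable neuron_law"
proof (rule borel_measurable_vecI)
  note [measurable] = phi
  show "(\<lambda>\<eta>. v \<eta> $ a) \<in> borel_measurable neuron_law" for a
    unfolding v_def preact_def vec_lambda_beta by measurable
qed

lemma phi_preact_measurable[measurable]: "(\<lambda>\<eta>. \<phi> (preact 0 y \<eta>)) \<in> borel_measurable neuron_law"
proof -
  note [measurable] = phi
  show ?thesis unfolding preact_def by measurable
qed

text \<open>The remaining terms of the diagonal kernel are squares with nonnegative coefficients.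
  This turns moment hypotheses on the kernel into moments of the network.\<close>

lemma phi_le_ker:
  fixes y :: "real ^ 'd"
  shows "(\<phi> (preact 0 y \<eta>))\<^sup>2 \<le> ker y y \<eta>"
proof -
  have "0 \<le> y \<bullet> y" by simp
  then have "0 \<le> (\<eta> (W2 0))\<^sup>2 * (dphi \<phi> (preact 0 y \<eta>))\<^sup>2 * (1 + 2 / real CARD('d) * (y \<bullet> y))"
    by (intro mult_nonneg_nonneg add_nonneg_nonneg divide_nonneg_nonneg) auto
  then show ?thesis unfolding neuron_ntk_def by (simp add: power2_eq_square mult_ac)
qed

text \<open>Since \<open>sigma_w\<close> squared is 2, the square of \<open>v\<close> is twice a
  product of squares, at most the sum of their squares: a fourth moment of a normal variable and a
  squared kernel value.\<close>

lemma v_square_integrable: "integrable neuron_law (\<lambda>\<eta>. (v \<eta> $ a)\<^sup>2)"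
proof (rule Bochner_Integration.integrable_bound)
  show "integrable neuron_law (\<lambda>\<eta>. (\<eta> (W2 0)) ^ 4 + (ker (X a) (X a) \<eta>)\<^sup>2)"
    using W2_moment(1)[of 4] ker_square_integrable(1)[of a a] by (rule Bochner_Integration.integrable_add)
  show "AE \<eta> in neuron_law. norm ((v \<eta> $ a)\<^sup>2) \<le> norm ((\<eta> (W2 0)) ^ 4 + (ker (X a) (X a) \<eta>)\<^sup>2)"
  proof (rule AE_I2)
    fix \<eta> :: "'d param \<Rightarrow> real"
    let ?w = "\<eta> (W2 0)" and ?f = "\<phi> (preact 0 (X a) \<eta>)"
    have "(v \<eta> $ a)\<^sup>2 = 2 * ?w\<^sup>2 * ?f\<^sup>2"
      by (simp add: v_def sigma_w_def power_mult_distrib)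
    also have "\<dots> \<le> (?w\<^sup>2)\<^sup>2 + (?f\<^sup>2)\<^sup>2"
      by (rule sum_squares_bound)
    also have "(?f\<^sup>2)\<^sup>2 \<le> (ker (X a) (X a) \<eta>)\<^sup>2"
      by (intro power_mono phi_le_ker) simp
    finally show "norm ((v \<eta> $ a)\<^sup>2) \<le> norm (?w ^ 4 + (ker (X a) (X a) \<eta>)\<^sup>2)"
      by (simp add: power_mult[symmetric])
  qed
qed measurable

text \<open>The output weight is centered and independent of the preactivation of its
  neuron.\<close>

lemma v_mean: "(\<integral>\<eta>. v \<eta> $ a \<partial>neuron_law) = 0"
proof -
  interpret prob_space "neuron_law :: ('d param \<Rightarrow> real) measure" by (rule prob_space_neuron_law)
  let ?B = "neuron_params 0 - {W2 0 :: 'd param}"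
  let ?g = "\<lambda>\<eta>. \<phi> (preact 0 (X a) \<eta>)"
  have ne: "neuron_params 0 \<noteq> ({} :: 'd param set)" by (auto simp: neuron_params_def)
  have "indep_vars (\<lambda>_. std_normal_distribution) (\<lambda>p \<eta>. \<eta> p) (neuron_params 0)"
    using indep_vars_PiM_coordinates[OF prob_space_std_normal ne] unfolding neuron_law_def .
  then have "indep_var (Pi\<^sub>M {W2 0} (\<lambda>_. std_normal_distribution)) (\<lambda>\<eta>. restrict (\<lambda>p. \<eta> p) {W2 0})
      (Pi\<^sub>M ?B (\<lambda>_. std_normal_distribution)) (\<lambda>\<eta>. restrict (\<lambda>p. \<eta> p) ?B)"
    by (rule indep_var_restrict) (auto simp: neuron_params_def)
  then have "indep_var borel ((\<lambda>\<eta>. \<eta> (W2 0)) \<circ> (\<lambda>\<eta>. restrict (\<lambda>p. \<eta> p) {W2 0}))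
      borel (?g \<circ> (\<lambda>\<eta>. restrict (\<lambda>p. \<eta> p) ?B))"
  proof (rule indep_var_compose)
    have "(\<lambda>\<eta>. \<eta> (W2 0 :: 'd param)) \<in> Pi\<^sub>M {W2 0} (\<lambda>_. std_normal_distribution) \<rightarrow>\<^sub>M std_normal_distribution"
      by (rule measurable_component_singleton) simp
    then show "(\<lambda>\<eta>. \<eta> (W2 0 :: 'd param)) \<in> Pi\<^sub>M {W2 0} (\<lambda>_. std_normal_distribution) \<rightarrow>\<^sub>M borel" by simp
    have c: "(\<lambda>\<eta>. \<eta> p) \<in> borel_measurable (Pi\<^sub>M ?B (\<lambda>_. std_normal_distribution))" if "p \<in> ?B" for p
      using measurable_component_singleton[OF that, of "\<lambda>_. std_normal_distribution"] by simp
    have [measurable]: "(\<lambda>\<eta>. \<eta> (W1 0 j)) \<in> borel_measurable (Pi\<^sub>M ?B (\<lambda>_. std_normal_distribution))" for j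
      by (rule c) (simp add: neuron_params_def)
    have [measurable]: "(\<lambda>\<eta>. \<eta> (B1 0)) \<in> borel_measurable (Pi\<^sub>M ?B (\<lambda>_. std_normal_distribution))"
      by (rule c) (simp add: neuron_params_def)
    note [measurable] = phi
    show "?g \<in> borel_measurable (Pi\<^sub>M ?B (\<lambda>_. std_normal_distribution))"
      unfolding preact_def by measurable
  qed
  \<comment> \<open>The preactivation does not read the output weight, so dropping that coordinate
    leaves it unchanged.\<close>
  moreover have "?g \<circ> (\<lambda>\<eta>. restrict (\<lambda>p. \<eta> p) ?B) = ?g"
    by (auto simp: fun_eq_iff preact_def neuron_params_def)
  ultimately have ind: "indep_var borel (\<lambda>\<eta>. \<eta> (W2 0)) borel ?g"
    by (simp add: comp_def)
  have "integrable neuron_law (\<lambda>\<eta>. (?g \<eta>)\<^sup>2)"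
    by (rule Bochner_Integration.integrable_bound[OF ker_integrable(1)[of a a]])
       (measurable, use phi_le_ker[of "X a"] in \<open>auto intro!: AE_I2 simp: order_trans[OF _ abs_ge_self]\<close>)
  then have gi: "integrable neuron_law ?g"
    by (rule square_integrable_imp_integrable[rotated]) measurable
  have "(\<integral>\<eta>. v \<eta> $ a \<partial>neuron_law) = sigma_w * (\<integral>\<eta>. \<eta> (W2 0) * ?g \<eta> \<partial>neuron_law)"
    by (simp add: v_def)
  also have "\<dots> = sigma_w * ((\<integral>\<eta>. \<eta> (W2 0) \<partial>(neuron_law :: ('d param \<Rightarrow> real) measure)) * expectation ?g)"
    using indep_var_lebesgue_integral[OF ind _ gi] W2_moment(1)[of 1, where 'a='d] by simp
  also have "(\<integral>\<eta>. \<eta> (W2 0) \<partial>(neuron_law :: ('d param \<Rightarrow> real) measure)) = 0"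
    using W2_moment(2)[of 1] integral_std_normal_distribution_moment_odd[of 1] by simp
  finally show ?thesis by simp
qed

lemma net_vec_eq: "net_vec \<phi> h X \<theta> = neuron_sum v (\<chi> _. 1) h \<theta>"
  by (simp add: vec_eq_iff net_vec_def net_preact neuron_sum_def v_def sum_distrib_left mult_ac sum_component)

text \<open>The residual map is linear and \<open>sqrt h * (1 / h) = 1 / sqrt h\<close>. No
  centering is subtracted, as \<open>u\<close> has mean 0 already; the bias vector is 0 because the
  output bias enters the kernel only as a constant.\<close>

lemma AE_U:
  assumes h: "0 < h"
  shows "AE \<theta> in init h. U h \<theta> = neuron_sum u 0 h \<theta>"
proof -
  have 1: "AE \<theta> in init h. \<forall>j. ntk \<phi> h x (X j) \<theta> = (\<Sum>i<h. ker x (X j) (neuron i \<theta>)) / real h"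
    by (intro eventually_all_finite AE_ntk_eq_sum_neurons[OF phi_diff h])
  have 2: "AE \<theta> in init h. \<forall>l j. ntk \<phi> h (X l) (X j) \<theta> = (\<Sum>i<h. ker (X l) (X j) (neuron i \<theta>)) / real h"
    by (intro eventually_all_finite AE_ntk_eq_sum_neurons[OF phi_diff h])
  from 1 2 show ?thesis
  proof eventually_elim
    case (elim \<theta>)
    have r: "ntk_row \<phi> h x X \<theta> = (1 / real h) *\<^sub>R (\<Sum>i<h. krow (neuron i \<theta>))"
      by (simp add: vec_eq_iff ntk_row_def krow_def elim sum_component)
    have m: "ntk_mat \<phi> h X \<theta> = (1 / real h) *\<^sub>R (\<Sum>i<h. kmat (neuron i \<theta>))"
      by (simp add: vec_eq_iff ntk_mat_def kmat_def elim sum_component)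
    have "sqrt (real h) * (1 / real h) = 1 / sqrt (real h)"
      using h by (simp add: real_div_sqrt field_simps)
    then show ?case
      unfolding U_def r m residual_map_sum by (simp add: neuron_sum_def u_def)
  qed
qed

text \<open>A scalar fluctuation is encoded as a vector with equal entries, so that the results on
  \<open>neuron_sum\<close> apply to it.\<close>

lemma AE_ntk_mat_entry:
  assumes h: "0 < h"
  shows "AE \<theta> in init h. sqrt (real h) * (ntk \<phi> h (X i) (X j) \<theta> - Kbar $ i $ j)
    = neuron_sum (\<lambda>\<eta>. (\<chi> c::'n. kmat \<eta> $ i $ j - Kbar $ i $ j)) 0 h \<theta> $ c"
  using AE_ntk_eq_sum_neurons[OF phi_diff h, of "X i" "X j"]
proof eventually_elim
  case (elim \<theta>)
  have "sqrt (real h) * (s / real h - Kbar $ i $ j) = 1 / sqrt (real h) * (s - real h * Kbar $ i $ j)" for s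
    using h by (simp add: field_simps)
  then show ?case unfolding elim
    by (simp add: neuron_sum_def sum_component kmat_def sum_subtractf)
qed

definition S :: "'n \<Rightarrow> 'n \<Rightarrow> real" where "S a b = (\<integral>\<eta>. u \<eta> $ a * u \<eta> $ b \<partial>neuron_law)"
text \<open>The covariance of the network values at every width; the 1 is the variance of the output
  bias, which all inputs share.\<close>

definition C :: "'n \<Rightarrow> 'n \<Rightarrow> real" where "C a b = (\<integral>\<eta>. v \<eta> $ a * v \<eta> $ b \<partial>neuron_law) + 1"

lemma ntk_vec_measurable:
  assumes "0 < h"
  shows "(\<lambda>\<theta>. ntk_row \<phi> h x X \<theta> $ j) \<in> borel_measurable (init h)"
    and "(\<lambda>\<theta>. ntk_mat \<phi> h X \<theta> $ i $ j) \<in> borel_measurable (init h)"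
  unfolding ntk_row_def ntk_mat_def using ntk_measurable[OF assms] by simp_all

lemma ntk_vec_square_integrable:
  assumes "0 < h"
  shows "integrable (init h) (\<lambda>\<theta>. (ntk_row \<phi> h x X \<theta> $ j)\<^sup>2)"
    and "integrable (init h) (\<lambda>\<theta>. (ntk_mat \<phi> h X \<theta> $ i $ j)\<^sup>2)"
  unfolding ntk_row_def ntk_mat_def using moment_row[OF assms] moment_mat[OF assms]
  by (simp_all add: has_second_moment_def)

lemma residual_map_ntk_measurable:
  assumes h: "0 < h"
  shows "(\<lambda>\<theta>. residual_map q' J' (ntk_row \<phi> h x X \<theta>) (ntk_mat \<phi> h X \<theta>)) \<in> borel_measurable (init h)"
    and "(\<lambda>\<theta>. residual_map q' J' 0 (ntk_mat \<phi> h X \<theta>)) \<in> borel_measurable (init h)"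
proof -
  note [measurable] = ntk_vec_measurable[OF h]
  show "(\<lambda>\<theta>. residual_map q' J' (ntk_row \<phi> h x X \<theta>) (ntk_mat \<phi> h X \<theta>)) \<in> borel_measurable (init h)"
    by (rule borel_measurable_vecI) (unfold residual_map_nth, measurable)
  show "(\<lambda>\<theta>. residual_map q' J' 0 (ntk_mat \<phi> h X \<theta>)) \<in> borel_measurable (init h)"
    by (rule borel_measurable_vecI) (unfold residual_map_nth, measurable)
qed

lemma U_measurable: "0 < h \<Longrightarrow> U h \<in> borel_measurable (init h)"
  unfolding U_def using residual_map_ntk_measurable(1) by measurable

lemma
  fixes F :: "real ^ 'n \<Rightarrow> 'z::{banach, second_countable_topology}"
  assumes h: "0 < h" and F: "F \<in> borel_measurable borel"
  shows integral_U: "(\<integral>\<theta>. F (U h \<theta>) \<partial>init h) = (\<integral>\<theta>. F (neuron_sum u 0 h \<theta>) \<partial>init h)"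
    and integrable_U: "integrable (init h) (\<lambda>\<theta>. F (U h \<theta>)) \<longleftrightarrow> integrable (init h) (\<lambda>\<theta>. F (neuron_sum u 0 h \<theta>))"
proof -
  have m: "(\<lambda>\<theta>. F (U h \<theta>)) \<in> borel_measurable (init h)" "(\<lambda>\<theta>. F (neuron_sum u 0 h \<theta>)) \<in> borel_measurable (init h)"
    by (rule measurable_compose[OF _ F],
        rule U_measurable[OF h] neuron_sum_measurable[OF u_measurable u_square_integrable u_mean h])+
  have ae: "AE \<theta> in init h. F (U h \<theta>) = F (neuron_sum u 0 h \<theta>)"
    using AE_U[OF h] by eventually_elim simp
  show "(\<integral>\<theta>. F (U h \<theta>) \<partial>init h) = (\<integral>\<theta>. F (neuron_sum u 0 h \<theta>) \<partial>init h)"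
    by (rule integral_cong_AE[OF m ae])
  show "integrable (init h) (\<lambda>\<theta>. F (U h \<theta>)) \<longleftrightarrow> integrable (init h) (\<lambda>\<theta>. F (neuron_sum u 0 h \<theta>))"
    by (rule integrable_cong_AE[OF m ae])
qed

lemma U_square_integrable: "0 < h \<Longrightarrow> integrable (init h) (\<lambda>\<theta>. (U h \<theta> $ a)\<^sup>2)"
  using integrable_U[of h "\<lambda>z. (z $ a)\<^sup>2"] neuron_sum_square_integrable[OF u_measurable u_square_integrable u_mean, of h 0 a]
  by simp

lemma U_mean: "0 < h \<Longrightarrow> (\<integral>\<theta>. U h \<theta> $ a \<partial>init h) = 0"
  using integral_U[of h "\<lambda>z. z $ a"] neuron_sum_mean[OF u_measurable u_square_integrable u_mean, of h 0 a]
  by simp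

lemma U_second_moment: "0 < h \<Longrightarrow> (\<integral>\<theta>. U h \<theta> $ a * U h \<theta> $ b \<partial>init h) = S a b"
  using integral_U[of h "\<lambda>z. z $ a * z $ b"] neuron_sum_second_moment[OF u_measurable u_square_integrable u_mean, of h 0 a b]
  by (simp add: S_def)

lemma U_cf: "0 < h \<Longrightarrow> (CLINT \<theta>|init h. iexp (y \<bullet> U h \<theta>)) = (CLINT \<eta>|neuron_law. iexp (y \<bullet> u \<eta> / sqrt (real h))) ^ h"
  using integral_U[of h "\<lambda>z. iexp (y \<bullet> z)"] neuron_sum_cf[OF u_measurable u_square_integrable u_mean, of h y 0]
  by simp

lemma net_vec_measurable: "0 < h \<Longrightarrow> net_vec \<phi> h X \<in> borel_measurable (init h)"
  using neuron_sum_measurable[OF v_measurable v_square_integrable v_mean, of h "\<chi> _. 1"] by (simp add: net_vec_eq[abs_def])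

lemma net_vec_square_integrable: "0 < h \<Longrightarrow> integrable (init h) (\<lambda>\<theta>. (net_vec \<phi> h X \<theta> $ a)\<^sup>2)"
  using neuron_sum_square_integrable[OF v_measurable v_square_integrable v_mean, of h "\<chi> _. 1"] by (simp add: net_vec_eq)

lemma net_vec_mean: "0 < h \<Longrightarrow> (\<integral>\<theta>. net_vec \<phi> h X \<theta> $ a \<partial>init h) = 0"
  using neuron_sum_mean[OF v_measurable v_square_integrable v_mean, of h "\<chi> _. 1"] by (simp add: net_vec_eq)

lemma net_vec_second_moment: "0 < h \<Longrightarrow> (\<integral>\<theta>. net_vec \<phi> h X \<theta> $ a * net_vec \<phi> h X \<theta> $ b \<partial>init h) = C a b"
  using neuron_sum_second_moment[OF v_measurable v_square_integrable v_mean, of h "\<chi> _. 1" a b] by (simp add: net_vec_eq C_def)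

lemma net_vec_cf: "0 < h \<Longrightarrow> (CLINT \<theta>|init h. iexp (y \<bullet> net_vec \<phi> h X \<theta>))
    = (CLINT \<eta>|neuron_law. iexp (y \<bullet> v \<eta> / sqrt (real h))) ^ h * of_real (exp (- (y \<bullet> (\<chi> _. 1))\<^sup>2 / 2))"
  unfolding net_vec_eq by (rule neuron_sum_cf[OF v_measurable v_square_integrable v_mean])

section \<open>Exact variances at finite width\<close>

text \<open>The two variables in \<open>V_c\<close> differ by
  \<open>Y \<bullet> U h \<theta> / sqrt h\<close>, and the second moments of \<open>U h\<close> do
  not depend on \<open>h\<close>.\<close>

lemma V_c_eq:
  assumes h: "0 < h"
  shows "real h * V_c \<phi> h x X Y = (\<Sum>a\<in>UNIV. \<Sum>b\<in>UNIV. S a b * (Y $ a * Y $ b))"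
proof -
  interpret prob_space "init h :: ('d param \<Rightarrow> real) measure" by (rule prob_space_init)
  \<comment> \<open>Setting \<open>q\<close> to 0 in the residual map isolates the row term, and
    setting the row to 0 with \<open>- q\<close> isolates the matrix term. Both thus inherit
    measurability and square integrability from one map.\<close>
  define P where "P \<theta> = residual_map 0 J (ntk_row \<phi> h x X \<theta>) (ntk_mat \<phi> h X \<theta>)" for \<theta>
  define R where "R \<theta> = residual_map (- q) J 0 (ntk_mat \<phi> h X \<theta>)" for \<theta>
  have [measurable]: "P \<in> borel_measurable (init h)" "R \<in> borel_measurable (init h)" "U h \<in> borel_measurable (init h)"
    unfolding P_def R_def by (rule residual_map_ntk_measurable[OF h] U_measurable[OF h])+
  have Psq: "integrable (init h) (\<lambda>\<theta>. (P \<theta> $ a)\<^sup>2)" and Rsq: "integrable (init h) (\<lambda>\<theta>. (R \<theta> $ a)\<^sup>2)" for a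
    unfolding P_def R_def
    by (rule square_integrable_residual_map; simp add: ntk_vec_measurable[OF h] ntk_vec_square_integrable[OF h])+
  have A: "ntk_row \<phi> h x X \<theta> \<bullet> (matrix_inv (mean_ntk_mat \<phi> h X) *v Y) = Y \<bullet> P \<theta>" for \<theta>
    unfolding P_def inner_commute[of Y] residual_map_inner mean_ntk_mat_eq[OF h] J_def by simp
  have B: "mean_Q \<phi> h x X \<bullet> (ntk_mat \<phi> h X \<theta> *v (matrix_inv (mean_ntk_mat \<phi> h X) *v Y)) = Y \<bullet> R \<theta>" for \<theta>
    unfolding R_def inner_commute[of Y] residual_map_inner mean_ntk_mat_eq[OF h] mean_Q_eq[OF h] J_def by simp
  have diff: "Y \<bullet> P \<theta> - Y \<bullet> R \<theta> = 1 / sqrt (real h) * (Y \<bullet> U h \<theta>)" for \<theta>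
    using h unfolding P_def R_def U_def inner_scaleR_right inner_commute[of Y] residual_map_inner by simp
  have "V_c \<phi> h x X Y = expectation (\<lambda>\<theta>. (Y \<bullet> P \<theta> - Y \<bullet> R \<theta>)\<^sup>2)"
    unfolding V_c_def Let_def A B
  proof (rule variance_diff_eq)
    show "integrable (init h) (\<lambda>\<theta>. (Y \<bullet> P \<theta>)\<^sup>2)" by (rule inner_square_expand(2)[OF _ Psq]) measurable
    show "integrable (init h) (\<lambda>\<theta>. (Y \<bullet> R \<theta>)\<^sup>2)" by (rule inner_square_expand(2)[OF _ Rsq]) measurable
    show "expectation (\<lambda>\<theta>. Y \<bullet> P \<theta> - Y \<bullet> R \<theta>) = 0"
      unfolding diff using inner_square_expand(5)[OF U_measurable[OF h] U_square_integrable[OF h], of Y] U_mean[OF h] by simp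
  qed measurable
  also have "\<dots> = 1 / real h * expectation (\<lambda>\<theta>. (Y \<bullet> U h \<theta>)\<^sup>2)"
    unfolding diff by (simp add: power_mult_distrib power_divide)
  also have "expectation (\<lambda>\<theta>. (Y \<bullet> U h \<theta>)\<^sup>2) = (\<Sum>a\<in>UNIV. \<Sum>b\<in>UNIV. S a b * (Y $ a * Y $ b))"
    unfolding inner_square_expand(1)[OF U_measurable[OF h] U_square_integrable[OF h]] U_second_moment[OF h]
    by (simp add: mult_ac)
  finally show ?thesis using h by simp
qed

text \<open>The independent vector of network values takes the place of \<open>Y\<close>, so the
  products of entries of \<open>Y\<close> become the second moments \<open>C\<close>.\<close>

lemma V_i_eq:
  assumes h: "0 < h"
  shows "real h * V_i \<phi> h x X = (\<Sum>a\<in>UNIV. \<Sum>b\<in>UNIV. S a b * C a b)"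
proof -
  let ?M = "init h :: ('d param \<Rightarrow> real) measure"
  interpret M: prob_space ?M by (rule prob_space_init)
  interpret pair_prob_space ?M ?M ..
  let ?f = "net_vec \<phi> h X"
  define P where "P \<theta> = residual_map 0 J (ntk_row \<phi> h x X \<theta>) (ntk_mat \<phi> h X \<theta>)" for \<theta>
  define R where "R \<theta> = residual_map (- q) J 0 (ntk_mat \<phi> h X \<theta>)" for \<theta>
  have m[measurable]: "P \<in> borel_measurable ?M" "R \<in> borel_measurable ?M" "U h \<in> borel_measurable ?M" "?f \<in> borel_measurable ?M"
    unfolding P_def R_def by (rule residual_map_ntk_measurable[OF h] U_measurable[OF h] net_vec_measurable[OF h])+
  have Psq: "integrable ?M (\<lambda>\<theta>. (P \<theta> $ a)\<^sup>2)" and Rsq: "integrable ?M (\<lambda>\<theta>. (R \<theta> $ a)\<^sup>2)" for a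
    unfolding P_def R_def
    by (rule square_integrable_residual_map; simp add: ntk_vec_measurable[OF h] ntk_vec_square_integrable[OF h])+
  have A: "ntk_row \<phi> h x X \<theta> \<bullet> (matrix_inv (mean_ntk_mat \<phi> h X) *v y) = P \<theta> \<bullet> y" for \<theta> y
    unfolding P_def residual_map_inner mean_ntk_mat_eq[OF h] J_def by simp
  have B: "mean_Q \<phi> h x X \<bullet> (ntk_mat \<phi> h X \<theta> *v (matrix_inv (mean_ntk_mat \<phi> h X) *v y)) = R \<theta> \<bullet> y" for \<theta> y
    unfolding R_def residual_map_inner mean_ntk_mat_eq[OF h] mean_Q_eq[OF h] J_def by simp
  have diff: "P \<theta> \<bullet> y - R \<theta> \<bullet> y = 1 / sqrt (real h) * (U h \<theta> \<bullet> y)" for \<theta> y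
    using h unfolding P_def R_def U_def inner_scaleR_left residual_map_inner by simp
  note ism = inner_second_moment[OF m(3,4) U_square_integrable[OF h] net_vec_square_integrable[OF h], unfolded split_beta']
  have "V_i \<phi> h x X = P.expectation (\<lambda>p. (P (fst p) \<bullet> ?f (snd p) - R (fst p) \<bullet> ?f (snd p))\<^sup>2)"
    unfolding V_i_def Let_def A B init2_def split_beta'
  proof (rule P.variance_diff_eq)
    show "integrable (?M \<Otimes>\<^sub>M ?M) (\<lambda>p. (P (fst p) \<bullet> ?f (snd p))\<^sup>2)"
      using inner_second_moment(1)[OF m(1,4) Psq net_vec_square_integrable[OF h]] by (simp add: split_beta')
    show "integrable (?M \<Otimes>\<^sub>M ?M) (\<lambda>p. (R (fst p) \<bullet> ?f (snd p))\<^sup>2)"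
      using inner_second_moment(1)[OF m(2,4) Rsq net_vec_square_integrable[OF h]] by (simp add: split_beta')
    show "P.expectation (\<lambda>p. P (fst p) \<bullet> ?f (snd p) - R (fst p) \<bullet> ?f (snd p)) = 0"
      unfolding diff using ism(2) U_mean[OF h] by simp
  qed measurable
  also have "\<dots> = 1 / real h * P.expectation (\<lambda>p. (U h (fst p) \<bullet> ?f (snd p))\<^sup>2)"
    unfolding diff by (simp add: power_mult_distrib power_divide)
  also have "P.expectation (\<lambda>p. (U h (fst p) \<bullet> ?f (snd p))\<^sup>2) = (\<Sum>a\<in>UNIV. \<Sum>b\<in>UNIV. S a b * C a b)"
    unfolding ism(3) U_second_moment[OF h] net_vec_second_moment[OF h] ..
  finally show ?thesis using h by simp
qed

section \<open>Replacing the random inverse by the inverse mean kernel\<close>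

lemma ntk_mat_concentration:
  assumes h: "0 < h"
  shows "integrable (init h) (\<lambda>\<theta>. (norm (ntk_mat \<phi> h X \<theta> - Kbar))\<^sup>2)"
    and "(\<integral>\<theta>. (norm (ntk_mat \<phi> h X \<theta> - Kbar))\<^sup>2 \<partial>init h)
      = (\<Sum>i\<in>UNIV. \<Sum>j\<in>UNIV. \<integral>\<eta>. (kmat \<eta> $ i $ j - Kbar $ i $ j)\<^sup>2 \<partial>neuron_law) / real h"
proof -
  let ?M = "init h :: ('d param \<Rightarrow> real) measure"
  interpret N: prob_space "neuron_law :: ('d param \<Rightarrow> real) measure" by (rule prob_space_neuron_law)
  note [measurable] = ntk_vec_measurable[OF h]
  have entry: "integrable ?M (\<lambda>\<theta>. (ntk_mat \<phi> h X \<theta> $ i $ j - Kbar $ i $ j)\<^sup>2) \<and>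
      (\<integral>\<theta>. (ntk_mat \<phi> h X \<theta> $ i $ j - Kbar $ i $ j)\<^sup>2 \<partial>?M) = (\<integral>\<eta>. (kmat \<eta> $ i $ j - Kbar $ i $ j)\<^sup>2 \<partial>neuron_law) / real h" for i j
  proof -
    define g :: "('d param \<Rightarrow> real) \<Rightarrow> real ^ 'n" where "g \<eta> = (\<chi> c. kmat \<eta> $ i $ j - Kbar $ i $ j)" for \<eta>
    have gn: "g \<eta> $ c = kmat \<eta> $ i $ j - Kbar $ i $ j" for \<eta> c by (simp add: g_def)
    have gm: "g \<in> borel_measurable neuron_law"
      by (rule borel_measurable_vecI) (simp add: g_def)
    have gs: "integrable neuron_law (\<lambda>\<eta>. (g \<eta> $ a)\<^sup>2)" for a
      unfolding g_def using krow_kmat_square_integrable(2)[of i j] krow_kmat_integrable(2)[of i j]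
      by (simp add: power2_diff)
    have g0: "(\<integral>\<eta>. g \<eta> $ a \<partial>neuron_law) = 0" for a
      unfolding g_def using krow_kmat_integrable(2)[of i j] by (simp add: N.prob_space Kbar_def)
    let ?T = "\<lambda>\<theta>. neuron_sum g 0 h \<theta> $ i"
    have ae: "AE \<theta> in ?M. real h * (ntk_mat \<phi> h X \<theta> $ i $ j - Kbar $ i $ j)\<^sup>2 = (?T \<theta>)\<^sup>2"
      using AE_ntk_mat_entry[OF h, of i j i]
    proof eventually_elim
      case (elim \<theta>)
      have "?T \<theta> = sqrt (real h) * (ntk \<phi> h (X i) (X j) \<theta> - Kbar $ i $ j)"
        unfolding elim g_def ..
      then show ?case by (simp add: ntk_mat_def power_mult_distrib)
    qed
    have [measurable]: "neuron_sum g 0 h \<in> borel_measurable ?M" by (rule neuron_sum_measurable[OF gm gs g0 h])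
    have m: "(\<lambda>\<theta>. real h * (ntk_mat \<phi> h X \<theta> $ i $ j - Kbar $ i $ j)\<^sup>2) \<in> borel_measurable ?M" "(\<lambda>\<theta>. (?T \<theta>)\<^sup>2) \<in> borel_measurable ?M"
      by measurable
    have "integrable ?M (\<lambda>\<theta>. real h * (ntk_mat \<phi> h X \<theta> $ i $ j - Kbar $ i $ j)\<^sup>2)"
      unfolding integrable_cong_AE[OF m ae] by (rule neuron_sum_square_integrable[OF gm gs g0 h])
    moreover have "(\<integral>\<theta>. real h * (ntk_mat \<phi> h X \<theta> $ i $ j - Kbar $ i $ j)\<^sup>2 \<partial>?M) = (\<integral>\<eta>. (kmat \<eta> $ i $ j - Kbar $ i $ j)\<^sup>2 \<partial>neuron_law)"
      using neuron_sum_second_moment[OF gm gs g0 h, of 0 i i]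
      unfolding integral_cong_AE[OF m ae] by (simp add: gn power2_eq_square)
    ultimately show ?thesis using h by (simp add: field_simps)
  qed
  have eq: "(norm (A - Kbar))\<^sup>2 = (\<Sum>i\<in>UNIV. \<Sum>j\<in>UNIV. (A $ i $ j - Kbar $ i $ j)\<^sup>2)" for A
    unfolding power2_norm_eq_inner inner_vec_def by (simp add: power2_eq_square)
  show "integrable ?M (\<lambda>\<theta>. (norm (ntk_mat \<phi> h X \<theta> - Kbar))\<^sup>2)"
    unfolding eq using entry by simp
  show "(\<integral>\<theta>. (norm (ntk_mat \<phi> h X \<theta> - Kbar))\<^sup>2 \<partial>?M)
      = (\<Sum>i\<in>UNIV. \<Sum>j\<in>UNIV. \<integral>\<eta>. (kmat \<eta> $ i $ j - Kbar $ i $ j)\<^sup>2 \<partial>neuron_law) / real h"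
    unfolding eq using entry by (simp add: sum_divide_distrib)
qed

text \<open>The exact identity \<open>Q - mean_Q = z v* matrix_inv M\<close> leaves an error that is
  bilinear in the scaled residual \<open>r\<close> and \<open>w\<close>, with the matrix
  \<open>matrix_inv M - J\<close> of small entries.\<close>

lemma Q_residual_le:
  fixes w :: "real ^ 'n"
  assumes h: "0 < h" and inv: "invertible (ntk_mat \<phi> h X \<theta>)"
    and close: "\<And>i j. \<bar>matrix_inv (ntk_mat \<phi> h X \<theta>) $ i $ j - J $ i $ j\<bar> \<le> \<eta>"
  shows "\<bar>sqrt (real h) * ((Q \<phi> h x X \<theta> - mean_Q \<phi> h x X) \<bullet> w) - U h \<theta> \<bullet> w\<bar>
    \<le> \<eta> * (\<Sum>a\<in>UNIV. \<Sum>b\<in>UNIV. ((column a Kbar \<bullet> U h \<theta>)\<^sup>2 + (w $ b)\<^sup>2))"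
proof -
  define M where "M = ntk_mat \<phi> h X \<theta>"
  define z where "z = ntk_row \<phi> h x X \<theta> - q v* M"
  define r where "r = sqrt (real h) *\<^sub>R z"
  have scale: "(c *\<^sub>R y) v* A = c *\<^sub>R (y v* A)" for c and y :: "real ^ 'n" and A :: "real ^ 'n ^ 'n"
    by (simp add: vec_eq_iff vector_matrix_mult_def sum_distrib_left mult_ac)
  have diff: "(y - y') v* A = y v* A - y' v* A" for y y' :: "real ^ 'n" and A :: "real ^ 'n ^ 'n"
    by (simp add: vec_eq_iff vector_matrix_mult_def sum_subtractf algebra_simps)
  have U: "U h \<theta> = r v* J"
    by (simp add: U_def residual_map_def r_def z_def M_def scale)
  \<comment> \<open>Undoing \<open>J\<close> expresses the scaled residual through \<open>U\<close>,
    whose second moments are known.\<close>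
  have r: "U h \<theta> v* Kbar = r"
    unfolding U J_def by (simp add: vector_matrix_mul_assoc matrix_inv_mult(2)[OF invertible_K])
  have rn: "r $ a = column a Kbar \<bullet> U h \<theta>" for a
    unfolding r[symmetric] by (simp add: vector_matrix_mult_def inner_vec_def column_def mult.commute)
  have "Q \<phi> h x X \<theta> - mean_Q \<phi> h x X = z v* matrix_inv M"
    using matrix_inv_mult(1)[OF inv]
    unfolding Q_def mean_Q_eq[OF h] z_def diff M_def[symmetric] by (simp add: vector_matrix_mul_assoc M_def)
  then have "sqrt (real h) * ((Q \<phi> h x X \<theta> - mean_Q \<phi> h x X) \<bullet> w) - U h \<theta> \<bullet> w = r \<bullet> ((matrix_inv M - J) *v w)"
    by (simp add: U dot_lmul_matrix r_def matrix_vector_mult_diff_rdistrib inner_diff_right)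
  then show ?thesis
    using inner_matrix_le[of "matrix_inv M - J" \<eta> r w] close by (simp add: M_def rn)
qed

lemma Q_measurable:
  assumes h: "0 < h"
  shows "Q \<phi> h x X \<in> borel_measurable (init h)"
proof (rule borel_measurable_vecI)
  note [measurable] = ntk_vec_measurable[OF h]
  have [measurable]: "(\<lambda>\<theta>. matrix_inv (ntk_mat \<phi> h X \<theta>) $ i $ j) \<in> borel_measurable (init h)" for i j
    by (rule borel_measurable_matrix_inv_entry) measurable
  show "(\<lambda>\<theta>. Q \<phi> h x X \<theta> $ a) \<in> borel_measurable (init h)" for a
    unfolding Q_def vector_matrix_mult_def vec_lambda_beta by measurable
qed

section \<open>Limits as the width grows\<close>

text \<open>Widths are written \<open>Suc n\<close> from here on, since the facts about
  \<open>U\<close> and the network require a positive width.\<close>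

lemma U_cf_tendsto:
  "\<exists>\<epsilon>. \<epsilon> \<longlonglongrightarrow> 0 \<and> (\<forall>n y. norm y \<le> R \<longrightarrow>
      norm ((CLINT \<theta>|init (Suc n). iexp (y \<bullet> U (Suc n) \<theta>))
        - of_real (exp (- (\<integral>\<eta>. (y \<bullet> u \<eta>)\<^sup>2 \<partial>neuron_law) / 2))) \<le> \<epsilon> n)"
proof -
  interpret N: prob_space "neuron_law :: ('d param \<Rightarrow> real) measure" by (rule prob_space_neuron_law)
  note ex = N.inner_square_expand[OF u_measurable u_square_integrable]
  have "N.expectation (\<lambda>\<eta>. y \<bullet> u \<eta>) = 0" for y unfolding ex(5) u_mean by simp
  from N.cf_clt_uniform[OF u_measurable ex(3) this, of R] obtain \<epsilon> where "\<epsilon> \<longlonglongrightarrow> 0"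
    "\<And>h y. h > 0 \<Longrightarrow> norm y \<le> R \<Longrightarrow> norm ((CLINT \<eta>|neuron_law. iexp (y \<bullet> u \<eta> / sqrt (real h))) ^ h
        - of_real (exp (- N.expectation (\<lambda>\<eta>. (y \<bullet> u \<eta>)\<^sup>2) / 2))) \<le> \<epsilon> h"
    by blast
  then show ?thesis
    by (intro exI[of _ "\<lambda>n. \<epsilon> (Suc n)"]) (auto simp: U_cf LIMSEQ_Suc simp del: power_Suc of_nat_Suc)
qed

text \<open>The central limit theorem covers the hidden neurons; the Gaussian factor of the output
  bias is present at every width and completes the covariance to \<open>C\<close>.\<close>

lemma net_vec_cf_tendsto:
  "(\<lambda>n. CLINT \<theta>|init (Suc n). iexp (y \<bullet> net_vec \<phi> (Suc n) X \<theta>))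
    \<longlonglongrightarrow> of_real (exp (- (\<Sum>a\<in>UNIV. \<Sum>b\<in>UNIV. y $ a * y $ b * C a b) / 2))"
proof -
  interpret N: prob_space "neuron_law :: ('d param \<Rightarrow> real) measure" by (rule prob_space_neuron_law)
  note ex = N.inner_square_expand[OF v_measurable v_square_integrable]
  have "N.expectation (\<lambda>\<eta>. y \<bullet> v \<eta>) = 0" for y unfolding ex(5) v_mean by simp
  from N.cf_clt_uniform[OF v_measurable ex(3) this, of "norm y"] obtain \<epsilon> where \<epsilon>: "\<epsilon> \<longlonglongrightarrow> 0"
    "\<And>h. h > 0 \<Longrightarrow> norm ((CLINT \<eta>|neuron_law. iexp (y \<bullet> v \<eta> / sqrt (real h))) ^ h
        - of_real (exp (- N.expectation (\<lambda>\<eta>. (y \<bullet> v \<eta>)\<^sup>2) / 2))) \<le> \<epsilon> h"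
    by blast
  let ?c = "\<lambda>h. (CLINT \<eta>|neuron_law. iexp (y \<bullet> v \<eta> / sqrt (real h))) ^ h"
  let ?g = "complex_of_real (exp (- N.expectation (\<lambda>\<eta>. (y \<bullet> v \<eta>)\<^sup>2) / 2))"
  have "(\<lambda>n. ?c n - ?g) \<longlonglongrightarrow> 0"
    by (rule Lim_null_comparison[OF _ \<epsilon>(1)])
       (use \<epsilon>(2) in \<open>auto intro!: eventually_mono[OF eventually_gt_at_top[of "0::nat"]]\<close>)
  then have "?c \<longlonglongrightarrow> ?g" by (rule LIM_zero_cancel)
  from LIMSEQ_Suc[OF this]
  have "(\<lambda>n. ?c (Suc n) * of_real (exp (- (y \<bullet> (\<chi> _. 1))\<^sup>2 / 2))) \<longlonglongrightarrow> ?g * of_real (exp (- (y \<bullet> (\<chi> _. 1))\<^sup>2 / 2))"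
    by (intro tendsto_mult tendsto_const)
  moreover have "?g * of_real (exp (- (y \<bullet> (\<chi> _. 1))\<^sup>2 / 2)) = of_real (exp (- (\<Sum>a\<in>UNIV. \<Sum>b\<in>UNIV. y $ a * y $ b * C a b) / 2))"
  proof -
    have one: "(y \<bullet> (\<chi> _. 1))\<^sup>2 = (\<Sum>a\<in>UNIV. \<Sum>b\<in>UNIV. y $ a * y $ b)"
      unfolding inner_vec_def power2_eq_square sum_product by simp
    have "(\<Sum>a\<in>UNIV. \<Sum>b\<in>UNIV. y $ a * y $ b * C a b) = N.expectation (\<lambda>\<eta>. (y \<bullet> v \<eta>)\<^sup>2) + (y \<bullet> (\<chi> _. 1))\<^sup>2"
      unfolding ex(1) C_def one by (simp add: sum.distrib distrib_left)
    then show ?thesis by (simp add: exp_add[symmetric] of_real_mult[symmetric] add_divide_distrib del: of_real_mult)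
  qed
  ultimately show ?thesis unfolding net_vec_cf[OF zero_less_Suc] by (simp only:)
qed

text \<open>Markov's inequality for the squared distance, whose mean is a constant over the width.
  It is stated on the product of the two draws, where the statistic lives.\<close>

lemma ntk_mat_close_tendsto:
  assumes "0 < \<delta>"
  shows "(\<lambda>n. measure (init (Suc n) \<Otimes>\<^sub>M init (Suc n) :: (('d param \<Rightarrow> real) \<times> ('d param \<Rightarrow> real)) measure)
      {p \<in> space (init (Suc n) \<Otimes>\<^sub>M init (Suc n)). \<delta>\<^sup>2 \<le> (norm (ntk_mat \<phi> (Suc n) X (fst p) - Kbar))\<^sup>2}) \<longlonglongrightarrow> 0"
proof (rule Lim_null_comparison)
  define c where "c = (\<Sum>i\<in>UNIV. \<Sum>j\<in>UNIV. \<integral>\<eta>. (kmat \<eta> $ i $ j - Kbar $ i $ j)\<^sup>2 \<partial>neuron_law)"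
  show "eventually (\<lambda>n. norm (measure (init (Suc n) \<Otimes>\<^sub>M init (Suc n) :: (('d param \<Rightarrow> real) \<times> ('d param \<Rightarrow> real)) measure)
      {p \<in> space (init (Suc n) \<Otimes>\<^sub>M init (Suc n)). \<delta>\<^sup>2 \<le> (norm (ntk_mat \<phi> (Suc n) X (fst p) - Kbar))\<^sup>2})
      \<le> c / \<delta>\<^sup>2 * (1 / real (Suc n))) sequentially"
  proof (rule always_eventually, rule allI)
    fix n
    let ?M = "init (Suc n) :: ('d param \<Rightarrow> real) measure"
    interpret M: prob_space ?M by (rule prob_space_init)
    interpret pair_prob_space ?M ?M ..
    have h: "0 < Suc n" by simp
    note ic = integrable_fst_only[OF ntk_mat_concentration(1)[OF h]]
    have "measure (?M \<Otimes>\<^sub>M ?M) {p \<in> space (?M \<Otimes>\<^sub>M ?M). (norm (ntk_mat \<phi> (Suc n) X (fst p) - Kbar))\<^sup>2 \<ge> \<delta>\<^sup>2}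
        \<le> P.expectation (\<lambda>p. (norm (ntk_mat \<phi> (Suc n) X (fst p) - Kbar))\<^sup>2) / \<delta>\<^sup>2"
      by (rule integral_Markov_inequality_measure[OF ic, where A="{}"]) (use assms in auto)
    also have "P.expectation (\<lambda>p. (norm (ntk_mat \<phi> (Suc n) X (fst p) - Kbar))\<^sup>2) = c / real (Suc n)"
      unfolding integral_fst_only[OF ntk_mat_concentration(1)[OF h]] ntk_mat_concentration(2)[OF h] c_def ..
    finally show "norm (measure (?M \<Otimes>\<^sub>M ?M) {p \<in> space (?M \<Otimes>\<^sub>M ?M). \<delta>\<^sup>2 \<le> (norm (ntk_mat \<phi> (Suc n) X (fst p) - Kbar))\<^sup>2})
      \<le> c / \<delta>\<^sup>2 * (1 / real (Suc n))"
      by (simp add: mult_ac)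
  qed
  have "(\<lambda>n. c / \<delta>\<^sup>2 * (1 / real (Suc n))) \<longlonglongrightarrow> c / \<delta>\<^sup>2 * 0"
    by (intro tendsto_mult tendsto_const LIMSEQ_Suc[OF lim_1_over_n])
  then show "(\<lambda>n. c / \<delta>\<^sup>2 * (1 / real (Suc n))) \<longlonglongrightarrow> 0" by simp
qed

lemma limit_law:
  fixes Y :: "real ^ 'n"
  shows "\<exists>Z :: real measure.
           lin_comb_two_chi_squares Z \<and>
           weak_conv_m
             (\<lambda>h. distr (init2 h) borel
                (\<lambda>(\<theta>k, \<theta>f). sqrt (real h) * ((Q \<phi> h x X \<theta>k - mean_Q \<phi> h x X) \<bullet> (Y - net_vec \<phi> h X \<theta>f))))
             Z \<and>
           has_second_moment Z (\<lambda>z. z) \<and>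
           (\<lambda>h. real h * V_c \<phi> h x X Y + real h * V_i \<phi> h x X)
             \<longlonglongrightarrow> prob_space.variance Z (\<lambda>z. z)"
proof -
  let ?\<Gamma> = "std_gaussian :: ('n \<Rightarrow> real) measure"
  interpret N: prob_space "neuron_law :: ('d param \<Rightarrow> real) measure" by (rule prob_space_neuron_law)
  interpret M1: prob_space "init 1 :: ('d param \<Rightarrow> real) measure" by (rule prob_space_init)
  interpret \<Gamma>: prob_space ?\<Gamma> by (rule prob_space_PiM) (rule prob_space_std_normal)
  interpret \<Gamma>\<Gamma>: pair_prob_space ?\<Gamma> ?\<Gamma> ..
  have "0 < (1::nat)" by simp
  note f1 = net_vec_measurable[OF this] net_vec_square_integrable[OF this] net_vec_second_moment[OF this]
  define \<sigma> where "\<sigma> y = N.expectation (\<lambda>\<eta>. (y \<bullet> u \<eta>)\<^sup>2)" for y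
  define \<tau> where "\<tau> y = (\<Sum>a\<in>UNIV. \<Sum>b\<in>UNIV. y $ a * y $ b * C a b)" for y
  \<comment> \<open>The covariance \<open>C\<close> is attained at width 1 already, so the network
    of width 1 serves as a model from which a Gaussian vector with covariance \<open>C\<close> is
    built.\<close>
  have \<tau>: "\<tau> y = M1.expectation (\<lambda>\<theta>. (y \<bullet> net_vec \<phi> 1 X \<theta>)\<^sup>2)" for y
    unfolding \<tau>_def M1.inner_square_expand(1)[OF f1(1,2)] f1(3) ..
  obtain G where Gm[measurable]: "G \<in> borel_measurable ?\<Gamma>"
    and G: "\<And>y. (CLINT \<omega>|?\<Gamma>. iexp (y \<bullet> G \<omega>)) = of_real (exp (- \<sigma> y / 2))"
      "\<And>a. integrable ?\<Gamma> (\<lambda>\<omega>. (G \<omega> $ a)\<^sup>2)" "\<And>a. (\<integral>\<omega>. G \<omega> $ a \<partial>?\<Gamma>) = 0"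
      "\<And>a b. (\<integral>\<omega>. G \<omega> $ a * G \<omega> $ b \<partial>?\<Gamma>) = S a b"
    using N.exists_gaussian_vector[OF u_measurable u_square_integrable] unfolding \<sigma>_def S_def by blast
  obtain F where Fm[measurable]: "F \<in> borel_measurable ?\<Gamma>"
    and F: "\<And>y. (CLINT \<omega>|?\<Gamma>. iexp (y \<bullet> F \<omega>)) = of_real (exp (- \<tau> y / 2))"
      "\<And>a. integrable ?\<Gamma> (\<lambda>\<omega>. (F \<omega> $ a)\<^sup>2)" "\<And>a. (\<integral>\<omega>. F \<omega> $ a \<partial>?\<Gamma>) = 0"
      "\<And>a b. (\<integral>\<omega>. F \<omega> $ a * F \<omega> $ b \<partial>?\<Gamma>) = C a b"
    using M1.exists_gaussian_vector[OF f1(1,2)] unfolding \<tau>[symmetric] f1(3) by blast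
  define W where "W \<omega> = Y - F \<omega>" for \<omega>
  have Wm[measurable]: "W \<in> borel_measurable ?\<Gamma>" unfolding W_def by measurable
  note W2 = \<Gamma>.shifted_second_moment[OF Fm F(2,3), of Y, folded W_def]
  note GW = \<Gamma>\<Gamma>.inner_second_moment[OF Gm Wm G(2) W2(1), unfolded split_beta']
  \<comment> \<open>Shifting by \<open>Y\<close> evaluates the characteristic function of
    \<open>F\<close> at \<open>- y\<close>.\<close>
  have neg: "\<tau> (- y) = \<tau> y" for y by (simp add: \<tau>_def)
  have cfW: "(CLINT \<omega>|?\<Gamma>. iexp (y \<bullet> W \<omega>)) = iexp (y \<bullet> Y) * of_real (exp (- \<tau> y / 2))" for y
    unfolding W_def cf_shifted F(1) neg ..
  define Z where "Z = distr (?\<Gamma> \<Otimes>\<^sub>M ?\<Gamma>) borel (\<lambda>p. G (fst p) \<bullet> W (snd p))"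
  have chi: "lin_comb_two_chi_squares Z"
    unfolding Z_def
  proof (rule lin_comb_two_chi_squares_inner)
    show "prob_space (?\<Gamma> \<Otimes>\<^sub>M ?\<Gamma>)" by (rule \<Gamma>\<Gamma>.P.prob_space_axioms)
    show "normal_law (distr (?\<Gamma> \<Otimes>\<^sub>M ?\<Gamma>) borel (\<lambda>p. a \<bullet> G (fst p) + b \<bullet> W (snd p)))" for a b
    proof (rule \<Gamma>\<Gamma>.normal_law_linear_form[OF Gm Wm _ _ _ _ G(1) cfW])
      show "0 \<le> \<sigma> y" "0 \<le> \<tau> y" for y unfolding \<sigma>_def \<tau> by (simp_all add: integral_nonneg_AE)
      show "\<sigma> (t *\<^sub>R y) = t\<^sup>2 * \<sigma> y" "\<tau> (t *\<^sub>R y) = t\<^sup>2 * \<tau> y" for t y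
        unfolding \<sigma>_def \<tau> by (simp_all add: power_mult_distrib)
    qed
  qed measurable
  have Zsq: "has_second_moment Z (\<lambda>z. z)"
    unfolding has_second_moment_def Z_def using GW(1) by (auto simp: integrable_distr_eq)
  have var: "prob_space.variance Z (\<lambda>z. z) = (\<Sum>a\<in>UNIV. \<Sum>b\<in>UNIV. S a b * (Y $ a * Y $ b + C a b))"
  proof -
    have "prob_space.expectation Z (\<lambda>z. z) = 0"
      unfolding Z_def using GW(2) G(3) by (subst integral_distr) auto
    then have "prob_space.variance Z (\<lambda>z. z) = \<Gamma>\<Gamma>.expectation (\<lambda>p. (G (fst p) \<bullet> W (snd p))\<^sup>2)"
      unfolding Z_def by (simp add: integral_distr)
    then show ?thesis unfolding GW(3) G(4) W2(2) F(4) .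
  qed
  \<comment> \<open>The sequence is constant for positive widths, so its limit requires no
    estimate.\<close>
  have V: "real h * V_c \<phi> h x X Y + real h * V_i \<phi> h x X = prob_space.variance Z (\<lambda>z. z)" if "0 < h" for h
    unfolding V_c_eq[OF that] V_i_eq[OF that] var by (simp add: sum.distrib distrib_left)
  have Vlim: "(\<lambda>h. real h * V_c \<phi> h x X Y + real h * V_i \<phi> h x X) \<longlonglongrightarrow> prob_space.variance Z (\<lambda>z. z)"
    using V by (intro tendsto_eventually eventually_mono[OF eventually_gt_at_top[of "0::nat"]])

  define w where "w n \<theta> = Y - net_vec \<phi> (Suc n) X \<theta>" for n \<theta>
  define P where "P n = (init (Suc n) \<Otimes>\<^sub>M init (Suc n) :: (('d param \<Rightarrow> real) \<times> ('d param \<Rightarrow> real)) measure)" for n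
  define D where "D n p = sqrt (real (Suc n)) * ((Q \<phi> (Suc n) x X (fst p) - mean_Q \<phi> (Suc n) x X) \<bullet> w n (snd p))" for n p
  have pos: "0 < Suc n" for n by simp
  have wm: "w n \<in> borel_measurable (init (Suc n))" for n
    unfolding w_def using net_vec_measurable[OF pos[of n]] by measurable
  have wsq: "integrable (init (Suc n)) (\<lambda>\<theta>. (w n \<theta> $ a)\<^sup>2)"
    and wmom: "(\<integral>\<theta>. w n \<theta> $ a * w n \<theta> $ b \<partial>init (Suc n)) = Y $ a * Y $ b + C a b" for n a b
    using prob_space.shifted_second_moment[OF prob_space_init net_vec_measurable net_vec_square_integrable net_vec_mean, of "Suc n" Y]
    by (simp_all add: w_def net_vec_second_moment)
  have lim_W: "(\<lambda>n. CLINT p|P n. iexp (t * (U (Suc n) (fst p) \<bullet> w n (snd p))))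
    \<longlonglongrightarrow> (CLINT p|?\<Gamma> \<Otimes>\<^sub>M ?\<Gamma>. iexp (t * (G (fst p) \<bullet> W (snd p))))" for t
    unfolding P_def
  \<comment> \<open>The mean of the squared norm of \<open>w n\<close> is the same at all widths and
    serves as the bound.\<close>
  proof (rule cf_inner_product_tendsto[where C="\<Sum>a\<in>UNIV. Y $ a * Y $ a + C a a"])
    show "prob_space (init (Suc n))" "prob_space (init (Suc n))" for n by (rule prob_space_init)+
    show "prob_space ?\<Gamma>" "prob_space ?\<Gamma>" by (rule \<Gamma>.prob_space_axioms)+
    show "U (Suc n) \<in> borel_measurable (init (Suc n))" "w n \<in> borel_measurable (init (Suc n))" for n
      by (rule U_measurable[OF pos] wm)+
    show "G \<in> borel_measurable ?\<Gamma>" "W \<in> borel_measurable ?\<Gamma>" by (rule Gm Wm)+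
    show "\<exists>\<epsilon>. \<epsilon> \<longlonglongrightarrow> 0 \<and> (\<forall>n y. norm y \<le> R \<longrightarrow>
      norm ((CLINT a|init (Suc n). iexp (y \<bullet> U (Suc n) a)) - (CLINT a|?\<Gamma>. iexp (y \<bullet> G a))) \<le> \<epsilon> n)" for R
      unfolding G(1) \<sigma>_def by (rule U_cf_tendsto)
    show "(\<lambda>n. CLINT b|init (Suc n). iexp (y \<bullet> w n b)) \<longlonglongrightarrow> (CLINT b|?\<Gamma>. iexp (y \<bullet> W b))" for y
      unfolding w_def W_def cf_shifted F(1) \<tau>_def by (intro tendsto_mult tendsto_const net_vec_cf_tendsto)
    show "integrable (init (Suc n)) (\<lambda>b. (norm (w n b))\<^sup>2)"
      "(\<integral>b. (norm (w n b))\<^sup>2 \<partial>init (Suc n)) \<le> (\<Sum>a\<in>UNIV. Y $ a * Y $ a + C a a)" for n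
      using prob_space.inner_square_expand(3,4)[OF prob_space_init wm wsq, of n] by (simp_all add: wmom)
  qed
  define B where "B n p = (\<Sum>a\<in>UNIV. \<Sum>b\<in>UNIV. (column a Kbar \<bullet> U (Suc n) (fst p))\<^sup>2 + (w n (snd p) $ b)\<^sup>2)" for n p
  \<comment> \<open>The exact mean of \<open>B n\<close> at every width.\<close>
  define c where "c = (\<Sum>a\<in>UNIV. \<Sum>b\<in>UNIV. (\<Sum>i\<in>UNIV. \<Sum>j\<in>UNIV. column a Kbar $ i * column a Kbar $ j * S i j) + (Y $ b * Y $ b + C b b))"
  have Dm: "D n \<in> borel_measurable (P n)" for n
  proof -
    note [measurable] = wm[of n] Q_measurable[OF pos[of n]]
    show ?thesis unfolding D_def P_def by measurable
  qed
  have Pp: "prob_space (P n)" for n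
    unfolding P_def by (intro prob_space_pair prob_space_init)
  have lim_D: "(\<lambda>n. (CLINT p|P n. iexp (t * D n p)) - (CLINT p|P n. iexp (t * (U (Suc n) (fst p) \<bullet> w n (snd p))))) \<longlonglongrightarrow> 0" for t
  proof (rule cf_diff_tendsto_0[where B=B and C=c])
    fix n
    let ?M = "init (Suc n) :: ('d param \<Rightarrow> real) measure"
    interpret M: prob_space ?M by (rule prob_space_init)
    interpret pair_prob_space ?M ?M ..
    note [measurable] = wm[of n] U_measurable[OF pos[of n]]
    show "prob_space (P n)" by (rule Pp)
    show "D n \<in> borel_measurable (P n)" by (rule Dm)
    show "(\<lambda>p. U (Suc n) (fst p) \<bullet> w n (snd p)) \<in> borel_measurable (P n)"
      unfolding P_def by measurable
    note Usq = M.inner_square_expand(2)[OF U_measurable[OF pos] U_square_integrable[OF pos]]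
    have i: "integrable (P n) (\<lambda>p. (column a Kbar \<bullet> U (Suc n) (fst p))\<^sup>2)" "integrable (P n) (\<lambda>p. (w n (snd p) $ b)\<^sup>2)" for a b
      unfolding P_def by (rule integrable_fst_only[OF Usq] integrable_snd_only[OF wsq])+
    show "integrable (P n) (B n)" unfolding B_def using i by simp
    have "(\<integral>p. B n p \<partial>P n) = (\<Sum>a\<in>UNIV. \<Sum>b\<in>UNIV. (\<integral>p. (column a Kbar \<bullet> U (Suc n) (fst p))\<^sup>2 \<partial>P n) + (\<integral>p. (w n (snd p) $ b)\<^sup>2 \<partial>P n))"
      unfolding B_def using i by simp
    also have "\<dots> = c"
      unfolding P_def integral_fst_only[OF Usq] integral_snd_only[OF wsq]
        M.inner_square_expand(1)[OF U_measurable[OF pos] U_square_integrable[OF pos]] U_second_moment[OF pos] c_def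
      using wmom[of n] by (simp add: power2_eq_square)
    finally show "(\<integral>p. B n p \<partial>P n) \<le> c" by simp
    show "0 \<le> B n p" for p unfolding B_def by (intro sum_nonneg) simp
  next
    fix \<eta> :: real assume \<eta>: "0 < \<eta>"
    obtain \<delta> where \<delta>: "\<delta> > 0" "\<And>A. norm (A - Kbar) < \<delta> \<Longrightarrow> invertible A"
      "\<And>A i j. norm (A - Kbar) < \<delta> \<Longrightarrow> \<bar>matrix_inv A $ i $ j - J $ i $ j\<bar> < \<eta>"
      using matrix_inv_near[OF invertible_K \<eta>] unfolding J_def by blast
    show "(\<lambda>n. measure (P n) {p \<in> space (P n). \<not> \<bar>D n p - U (Suc n) (fst p) \<bullet> w n (snd p)\<bar> \<le> \<eta> * B n p}) \<longlonglongrightarrow> 0"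
    proof (rule Lim_null_comparison[OF _ ntk_mat_close_tendsto[OF \<delta>(1)]], rule always_eventually, rule allI)
      fix n
      \<comment> \<open>Despite the name, the event that the kernel matrix is at distance at least
        \<open>\<delta>\<close> from its mean. Inside the ball the error bound always holds, so it
        can fail only here.\<close>
      let ?near = "{p \<in> space (P n). \<delta>\<^sup>2 \<le> (norm (ntk_mat \<phi> (Suc n) X (fst p) - Kbar))\<^sup>2}"
      interpret P: prob_space "P n" by (rule Pp)
      have [measurable]: "(\<lambda>\<theta>. ntk_mat \<phi> (Suc n) X \<theta>) \<in> borel_measurable (init (Suc n))"
      proof -
        have "(\<lambda>\<theta>. ntk_mat \<phi> (Suc n) X \<theta> $ i) \<in> borel_measurable (init (Suc n))" for i
          by (rule borel_measurable_vecI) (rule ntk_vec_measurable(2)[OF pos])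
        then show ?thesis
          unfolding borel_measurable_euclidean_space[of "\<lambda>\<theta>. ntk_mat \<phi> (Suc n) X \<theta>"]
          by (auto simp: Basis_vec_def inner_axis)
      qed
      have "measure (P n) {p \<in> space (P n). \<not> \<bar>D n p - U (Suc n) (fst p) \<bullet> w n (snd p)\<bar> \<le> \<eta> * B n p} \<le> measure (P n) ?near"
      proof (rule P.finite_measure_mono)
        show "?near \<in> sets (P n)" unfolding P_def by measurable
        show "{p \<in> space (P n). \<not> \<bar>D n p - U (Suc n) (fst p) \<bullet> w n (snd p)\<bar> \<le> \<eta> * B n p} \<subseteq> ?near"
        proof clarify
          fix \<theta> \<theta>' :: "'d param \<Rightarrow> real"
          assume bad: "\<not> \<bar>D n (\<theta>, \<theta>') - U (Suc n) (fst (\<theta>, \<theta>')) \<bullet> w n (snd (\<theta>, \<theta>'))\<bar> \<le> \<eta> * B n (\<theta>, \<theta>')"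
          have "\<not> norm (ntk_mat \<phi> (Suc n) X \<theta> - Kbar) < \<delta>"
          proof
            assume near: "norm (ntk_mat \<phi> (Suc n) X \<theta> - Kbar) < \<delta>"
            show False
              using bad Q_residual_le[OF pos \<delta>(2)[OF near] less_imp_le[OF \<delta>(3)[OF near]], of "w n \<theta>'"]
              by (simp add: D_def B_def)
          qed
          then show "\<delta>\<^sup>2 \<le> (norm (ntk_mat \<phi> (Suc n) X (fst (\<theta>, \<theta>')) - Kbar))\<^sup>2"
            using \<delta>(1) by (intro power_mono) auto
        qed
      qed
      then show "norm (measure (P n) {p \<in> space (P n). \<not> \<bar>D n p - U (Suc n) (fst p) \<bullet> w n (snd p)\<bar> \<le> \<eta> * B n p})
        \<le> measure (init (Suc n) \<Otimes>\<^sub>M init (Suc n) :: (('d param \<Rightarrow> real) \<times> ('d param \<Rightarrow> real)) measure)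
      {p \<in> space (init (Suc n) \<Otimes>\<^sub>M init (Suc n)). \<delta>\<^sup>2 \<le> (norm (ntk_mat \<phi> (Suc n) X (fst p) - Kbar))\<^sup>2}"
        by (simp add: P_def)
    qed
  qed
  have "weak_conv_m (\<lambda>n. distr (P n) borel (D n)) Z"
  proof (rule levy_continuity)
    show "real_distribution (distr (P n) borel (D n))" for n
      by (rule prob_space.real_distribution_distr[OF Pp Dm])
    show "real_distribution Z"
      unfolding Z_def by (rule \<Gamma>\<Gamma>.P.real_distribution_distr) measurable
    fix t
    have "char (distr (P n) borel (D n)) t = (CLINT p|P n. iexp (t * D n p))" for n
      unfolding char_def using Dm[of n] by (subst integral_distr) auto
    moreover have "char Z t = (CLINT p|?\<Gamma> \<Otimes>\<^sub>M ?\<Gamma>. iexp (t * (G (fst p) \<bullet> W (snd p))))"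
      unfolding char_def Z_def by (subst integral_distr) auto
    ultimately show "(\<lambda>n. char (distr (P n) borel (D n)) t) \<longlonglongrightarrow> char Z t"
      using tendsto_add[OF lim_D[of t] lim_W[of t]] by simp
  qed
  moreover have "distr (P n) borel (D n) = distr (init2 (Suc n)) borel
      (\<lambda>(\<theta>k, \<theta>f). sqrt (real (Suc n)) * ((Q \<phi> (Suc n) x X \<theta>k - mean_Q \<phi> (Suc n) x X) \<bullet> (Y - net_vec \<phi> (Suc n) X \<theta>f)))" for n
    unfolding P_def D_def[abs_def] w_def init2_def split_beta' ..
  ultimately have "weak_conv_m
             (\<lambda>h. distr (init2 h) borel
                (\<lambda>(\<theta>k, \<theta>f). sqrt (real h) * ((Q \<phi> h x X \<theta>k - mean_Q \<phi> h x X) \<bullet> (Y - net_vec \<phi> h X \<theta>f))))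
             Z"
    \<comment> \<open>Convergence along \<open>Suc n\<close> gives convergence along all widths; the
      value at width 0 does not affect the limit.\<close>
    unfolding weak_conv_m_def weak_conv_def by (auto intro: LIMSEQ_imp_Suc)
  then show ?thesis using chi Zsq Vlim by blast
qed

end

theorem proposition2p1:
  fixes \<phi> :: "real \<Rightarrow> real" and x :: "real ^ 'd" and X :: "'n::finite \<Rightarrow> real ^ 'd"
    and Y :: "real ^ 'n"
  assumes "\<phi> \<in> borel_measurable borel"
    and "AE z in lborel. \<phi> differentiable (at z)"
    and "\<And>h i j. h > 0 \<Longrightarrow> has_second_moment (init h) (ntk \<phi> h (X i) (X j))"
    and "\<And>h j. h > 0 \<Longrightarrow> has_second_moment (init h) (ntk \<phi> h x (X j))"
    and "\<And>h. h > 0 \<Longrightarrow> invertible (mean_ntk_mat \<phi> h X)"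
  shows "\<exists>Z :: real measure.
           lin_comb_two_chi_squares Z \<and>
           weak_conv_m
             (\<lambda>h. distr (init2 h) borel
                (\<lambda>(\<theta>k, \<theta>f). sqrt (real h) * ((Q \<phi> h x X \<theta>k - mean_Q \<phi> h x X) \<bullet> (Y - net_vec \<phi> h X \<theta>f))))
             Z \<and>
           has_second_moment Z (\<lambda>z. z) \<and>
           (\<lambda>h. real h * V_c \<phi> h x X Y + real h * V_i \<phi> h x X)
             \<longlonglongrightarrow> prob_space.variance Z (\<lambda>z. z)"
proof -
  interpret ntk_regression \<phi> x X
    using assms by unfold_locales
  show ?thesis by (rule limit_law)
qed

end
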